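(* Let $0<q<1$, let $N\ge1$ be an integer and let $\widetilde\alpha,\widetilde\beta$ be real with either $0<\widetilde\alpha q<1$, $0<\widetilde\beta q<1$, or $\widetilde\alpha>q^{-N}$, $\widetilde\beta>q^{-N}$. Let $\alpha,\beta\in\mathbb R$ be given by $q^\alpha=\widetilde\beta$, $q^\beta=\widetilde\alpha$, for real $a$ let $b=a+N+1$, and put $C_n=q^{\frac n2(2a+1)}\kappa_q^{2n}$, $x(s)=q^{-s}$. Write $h_n(s)_q=h_n^{\widetilde\alpha,\widetilde\beta}(x(s);N|q)$ for the monic $q$-Hahn polynomials. Then, as $q^a\to0$ (i.e. $a\to+\infty$): (1) The orthogonality relation of the non-standard $q$-Racah polynomials $$\sum_{s=0}^{N}u_n^{\alpha,\beta}(s+a)_q\,u_m^{\alpha,\beta}(s+a)_q\,\rho(s+a)\,[2s+2a+1]_q=\delta_{n,m}d_n^2,$$ multiplied by $C_nC_m$, becomes the orthogonality relation of the $q$-Hahn polynomials $$\sum_{s=0}^Nh_n(s)_qh_m(s)_q\,\widetilde\rho(s)\,\Delta x(s-\tfrac12)=\widetilde d_n^{\,2}\,\delta_{n,m},$$ that is, $\rho(s+a)[2s+2a+1]_q\to\widetilde\rho(s)\Delta x(s-\frac12)$ for $s=0,\dots,N$ and $C_n^2d_n^2\to\widetilde d_n^{\,2}$ for $0\le n\le N$. (2) The three-term recurrence relation $\mu(s)u_n^{\alpha,\beta}(s)_q=u_{n+1}^{\alpha,\beta}(s)_q+\beta_nu_n^{\alpha,\beta}(s)_q+\gamma_nu_{n-1}^{\alpha,\beta}(s)_q$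 of the non-standard $q$-Racah polynomials transforms into the one of the $q$-Hahn polynomials: for $0\le n\le N-1$ and $s=0,\dots,N$, $$x(s)h_n(s)_q=h_{n+1}(s)_q+\widehat\beta_nh_n(s)_q+\widehat\gamma_nh_{n-1}(s)_q,$$ where $$\widehat\beta_n=\lim_{q^a\to0}\frac{q^{a+1}}{c_1}\beta_n=1-\frac{(1-\widetilde\alpha\widetilde\beta q^{n+1})(1-\widetilde\alpha q^{n+1})(1-q^{n-N})}{(1-\widetilde\alpha\widetilde\beta q^{2n+1})(1-\widetilde\alpha\widetilde\beta q^{2n+2})}+\frac{\widetilde\alpha q^{n-N}(1-q^n)(1-\widetilde\beta q^n)(1-\widetilde\alpha\widetilde\beta q^{n+N+1})}{(1-\widetilde\alpha\widetilde\beta q^{2n})(1-\widetilde\alpha\widetilde\beta q^{2n+1})},$$ $$\widehat\gamma_n=\lim_{q^a\to0}\frac{q^{a+1}}{c_1}\frac{C_n}{C_{n-1}}\gamma_n=-\widetilde\alpha q^{n-N}\frac{(1-\widetilde\alpha\widetilde\beta q^n)(1-\widetilde\alpha q^n)(1-\widetilde\beta q^n)(1-\widetilde\alpha\widetilde\beta q^{n+N+1})(1-q^n)(1-q^{n-N-1})}{(1-\widetilde\alpha\widetilde\beta q^{2n-1})(1-\widetilde\alpha\widetilde\beta q^{2n})^2(1-\widetilde\alpha\widetilde\beta q^{2n+1})}$$ (the second limit for $n\ge1$).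
   Context: Notation. $0<q<1$, $q^z=e^{z\log q}$. $(x;q)_k=\prod_{i=0}^{k-1}(1-xq^i)$, $(x;q)_\infty=\prod_{i\ge0}(1-xq^i)$, $(x_1,\dots,x_r;q)_k=\prod_j(x_j;q)_k$; ${}_r\varphi_{r-1}$ is the standard basic hypergeometric series. $\kappa_q=q^{1/2}-q^{-1/2}$; $[s]_q=\dfrac{q^{s/2}-q^{-s/2}}{q^{1/2}-q^{-1/2}}$. $\Delta f(s)=f(s+1)-f(s)$. Lattice: $\mu(s)=[s]_q[s+1]_q=c_1(q^s+q^{-s-1})+c_3$ with $c_1=q^{1/2}\kappa_q^{-2}$, $c_3=-q^{-1/2}(1+q)\kappa_q^{-2}$. Non-standard monic $q$-Racah polynomials ($0\le n\le b-a-1$): $$u_n^{\alpha,\beta}(s)_q=q^{-\frac n2(2a+1)}\frac{(q^{a-b+1},q^{\beta+1},q^{a+b+\alpha+1};q)_n}{\kappa_q^{2n}(q^{\alpha+\beta+n+1};q)_n}\;{}_4\varphi_3\!\left(\begin{matrix}q^{-n},q^{\alpha+\beta+n+1},q^{a-s},q^{a+s+1}\\ q^{a-b+1},q^{\beta+1},q^{a+b+\alpha+1}\end{matrix}\Big|\,q,q\right).$$ Squared norms: $$d_n^2=\frac{(q,q^{\alpha+1},q^{\beta+1},q^{b-a+\alpha+\beta+1},q^{a+b+\alpha+1},q^{a-b+1},q^{\beta-a-b+1};q)_n}{\kappa_q^{4n}(q^{\alpha+\beta+2};q)_{2n}(q^{\alpha+\beta+n+1};q)_n}.$$ Weight: $$\rho(s)=\frac{\widetilde\Gamma_q(s+a+1)\widetilde\Gamma_q(s-a+\beta+1)\widetilde\Gamma_q(s+\alpha+b+1)\widetilde\Gamma_q(b+\alpha-s)\widetilde\Gamma_q(\alpha+\beta+2)\widetilde\Gamma_q(b-a)\widetilde\Gamma_q(a+b-\beta)}{\widetilde\Gamma_q(s-a+1)\widetilde\Gamma_q(s+b+1)\widetilde\Gamma_q(s+a-\beta+1)\widetilde\Gamma_q(b-s)\widetilde\Gamma_q(\alpha+1)\widetilde\Gamma_q(\beta+1)\widetilde\Gamma_q(b-a+\alpha+\beta+1)\widetilde\Gamma_q(a+b+\alpha+1)},$$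 where $\widetilde\Gamma_q(s)=q^{-\frac{(s-1)(s-2)}4}(1-q)^{1-s}\dfrac{(q;q)_\infty}{(q^s;q)_\infty}$, so that $\widetilde\Gamma_q(s+1)=[s]_q\widetilde\Gamma_q(s)$. Quotients of $\widetilde\Gamma_q$-values whose arguments differ by integers are understood through this functional equation (removable singularities removed). Recurrence coefficients: $$\beta_n=[a]_q[a+1]_q-\frac{[\alpha+\beta+n+1]_q[a-b+n+1]_q[\beta+n+1]_q[a+b+\alpha+n+1]_q}{[\alpha+\beta+2n+1]_q[\alpha+\beta+2n+2]_q}-\frac{[\alpha+n]_q[b-a+\alpha+\beta+n]_q[-a-b+\beta+n]_q[n]_q}{[\alpha+\beta+2n]_q[\alpha+\beta+2n+1]_q},$$ $$\gamma_n=\frac{[n]_q[\alpha+\beta+n]_q[\alpha+n]_q[\beta+n]_q[b-a+\alpha+\beta+n]_q[-a-b+\beta+n]_q[a-b+n]_q[a+b+\alpha+n]_q}{[\alpha+\beta+2n-1]_q([\alpha+\beta+2n]_q)^2[\alpha+\beta+2n+1]_q}.$$ Monic $q$-Hahn polynomials: $$h_n^{\widetilde\alpha,\widetilde\beta}(x(s);N|q)=\frac{(q^{-N},\widetilde\alpha q;q)_n}{(\widetilde\alpha\widetilde\beta q^{n+1};q)_n}\;{}_3\varphi_2\!\left(\begin{matrix}q^{-n},\widetilde\alpha\widetilde\beta q^{n+1},x(s)\\ q^{-N},\widetilde\alpha q\end{matrix}\Big|\,q,q\right),\qquad x(s)=q^{-s},$$ with $\Delta x(s-\frac12)=x(s+\frac12)-x(s-\frac12)=-\kappa_qq^{-s}$,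 $$\widetilde\rho(s)=\frac{(\widetilde\alpha\widetilde\beta)^{-s}}{(-\kappa_q)}\cdot\frac{(\widetilde\alpha q)^N(\widetilde\beta q;q)_N}{(\widetilde\alpha\widetilde\beta q^2;q)_N}\cdot\frac{(\widetilde\alpha q,q^{-N};q)_s}{(q,\widetilde\beta^{-1}q^{-N};q)_s},$$ $$\widetilde d_n^{\,2}=(-\widetilde\alpha q)^nq^{\binom n2-Nn}\frac{1-\widetilde\alpha\widetilde\beta q}{1-\widetilde\alpha\widetilde\beta q^{2n+1}}\cdot\frac{(q,\widetilde\alpha q,\widetilde\beta q,q^{-N},\widetilde\alpha\widetilde\beta q^{N+2};q)_n}{(\widetilde\alpha\widetilde\beta q,\widetilde\alpha\widetilde\beta q^{n+1},\widetilde\alpha\widetilde\beta q^{n+1};q)_n}.$$ Conventions: common factors in numerators and denominators of $d_n^2,\widetilde d_n^{\,2}$ and the recurrence coefficients are cancelled before evaluation; terms containing $[n]_q$ or $1-q^n$ vanish for $n=0$; $u_{-1}=h_{-1}=0$. *)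

theory Defs
  imports "HOL-Analysis.Analysis"
begin

section \<open>Basic hypergeometric notation\<close>

definition qpoch :: "real \<Rightarrow> real \<Rightarrow> nat \<Rightarrow> real" where
  "qpoch x q k = (\<Prod>i<k. 1 - x * q ^ i)"

definition qpoch_inf :: "real \<Rightarrow> real \<Rightarrow> real" where
  "qpoch_inf x q = prodinf (\<lambda>i. 1 - x * q ^ i)"

definition qpochs :: "real list \<Rightarrow> real \<Rightarrow> nat \<Rightarrow> real" where
  "qpochs xs q k = (\<Prod>x\<leftarrow>xs. qpoch x q k)"

text \<open>The series with \<open>r\<close> upper and \<open>r - 1\<close> lower parameters.  If an upper parameter is
  \<open>q powr (- n)\<close>, the terms of index greater than \<open>n\<close> vanish, whatever the denominators are.\<close>

definition qhyp :: "real list \<Rightarrow> real list \<Rightarrow> real \<Rightarrow> real \<Rightarrow> real" where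
  "qhyp as bs q z = (\<Sum>k. qpochs as q k / (qpoch q q k * qpochs bs q k) * z ^ k)"

definition kappa :: "real \<Rightarrow> real" where
  "kappa q = q powr (1/2) - q powr (-1/2)"

definition qnum :: "real \<Rightarrow> real \<Rightarrow> real" where
  "qnum q s = (q powr (s/2) - q powr (-s/2)) / (q powr (1/2) - q powr (-1/2))"

definition fwd_diff :: "(real \<Rightarrow> real) \<Rightarrow> real \<Rightarrow> real" where
  "fwd_diff f s = f (s + 1) - f s"

definition qGamma :: "real \<Rightarrow> real \<Rightarrow> real" where
  "qGamma q s = q powr (- ((s - 1) * (s - 2) / 4)) * (1 - q) powr (1 - s)
     * (qpoch_inf q q / qpoch_inf (q powr s) q)"

text \<open>Quotient of two values of \<^const>\<open>qGamma\<close> with the removable singularities removed.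
  If \<open>x - y\<close> is an integer, then both arguments may be poles, and the limit is the finite
  product of \<open>q\<close>-numbers (or its inverse) given by
  \<open>qGamma q (s + 1) = qnum q s * qGamma q s\<close>.  At regular points it is the plain quotient.\<close>

definition qGamma_quot :: "real \<Rightarrow> real \<Rightarrow> real \<Rightarrow> real" where
  "qGamma_quot q x y = Lim (at 0) (\<lambda>t. qGamma q (x + t) / qGamma q (y + t))"

text \<open>For an expression \<open>f\<close> in a parameter displacement \<open>t\<close>: its value at \<open>t = 0\<close> after
  common factors of numerator and denominator have been cancelled.  Below, the factors which
  can vanish in denominators depend only on \<open>\<alpha> + \<beta>\<close> (only on the product \<open>\<alpha>t * \<beta>t\<close> for the
  q-Hahn quantities), so it is enough to displace \<open>\<alpha>\<close> (respectively \<open>\<alpha>t\<close>).\<close>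

definition cancelled :: "(real \<Rightarrow> real) \<Rightarrow> real" where
  "cancelled f = Lim (at 0) f"

text \<open>The preceding member of a sequence of polynomials, with the convention \<open>p\<^sub>-\<^sub>1 = 0\<close>.\<close>

definition pred_poly :: "(nat \<Rightarrow> real) \<Rightarrow> nat \<Rightarrow> real" where
  "pred_poly p n = (case n of 0 \<Rightarrow> 0 | Suc k \<Rightarrow> p k)"


section \<open>Non-standard q-Racah polynomials\<close>

definition racah_mu :: "real \<Rightarrow> real \<Rightarrow> real" where
  "racah_mu q s = qnum q s * qnum q (s + 1)"

definition racah_c1 :: "real \<Rightarrow> real" where
  "racah_c1 q = q powr (1/2) / kappa q ^ 2"

definition racah_u :: "real \<Rightarrow> real \<Rightarrow> real \<Rightarrow> real \<Rightarrow> real \<Rightarrow> nat \<Rightarrow> real \<Rightarrow> real" where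
  "racah_u q a b \<alpha> \<beta> n s =
     q powr (- (real n / 2 * (2 * a + 1)))
     * (qpochs [q powr (a - b + 1), q powr (\<beta> + 1), q powr (a + b + \<alpha> + 1)] q n
        / (kappa q ^ (2 * n) * qpoch (q powr (\<alpha> + \<beta> + real n + 1)) q n))
     * qhyp [q powr (- real n), q powr (\<alpha> + \<beta> + real n + 1), q powr (a - s), q powr (a + s + 1)]
            [q powr (a - b + 1), q powr (\<beta> + 1), q powr (a + b + \<alpha> + 1)] q q"

definition racah_d2_raw :: "real \<Rightarrow> real \<Rightarrow> real \<Rightarrow> real \<Rightarrow> real \<Rightarrow> nat \<Rightarrow> real" where
  "racah_d2_raw q a b \<alpha> \<beta> n =
     qpochs [q, q powr (\<alpha> + 1), q powr (\<beta> + 1), q powr (b - a + \<alpha> + \<beta> + 1),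
             q powr (a + b + \<alpha> + 1), q powr (a - b + 1), q powr (\<beta> - a - b + 1)] q n
     / (kappa q ^ (4 * n) * qpoch (q powr (\<alpha> + \<beta> + 2)) q (2 * n)
        * qpoch (q powr (\<alpha> + \<beta> + real n + 1)) q n)"

definition racah_d2 :: "real \<Rightarrow> real \<Rightarrow> real \<Rightarrow> real \<Rightarrow> real \<Rightarrow> nat \<Rightarrow> real" where
  "racah_d2 q a b \<alpha> \<beta> n = cancelled (\<lambda>t. racah_d2_raw q a b (\<alpha> + t) \<beta> n)"

text \<open>The values of \<^const>\<open>qGamma\<close> are grouped into quotients whose arguments differ by
  integers when \<open>b - a\<close> is a positive integer and \<open>s \<in> {a, a + 1, \<dots>, b - 1}\<close>.\<close>

definition racah_rho :: "real \<Rightarrow> real \<Rightarrow> real \<Rightarrow> real \<Rightarrow> real \<Rightarrow> real \<Rightarrow> real" where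
  "racah_rho q a b \<alpha> \<beta> s =
     qGamma_quot q (s + a + 1) (s + b + 1)
     * qGamma_quot q (s - a + \<beta> + 1) (\<beta> + 1)
     * qGamma_quot q (s + \<alpha> + b + 1) (a + b + \<alpha> + 1)
     * qGamma_quot q (b + \<alpha> - s) (\<alpha> + 1)
     * qGamma_quot q (\<alpha> + \<beta> + 2) (b - a + \<alpha> + \<beta> + 1)
     * qGamma_quot q (a + b - \<beta>) (s + a - \<beta> + 1)
     * qGamma_quot q (b - a) (b - s)
     / qGamma q (s - a + 1)"

definition racah_beta_raw :: "real \<Rightarrow> real \<Rightarrow> real \<Rightarrow> real \<Rightarrow> real \<Rightarrow> nat \<Rightarrow> real" where
  "racah_beta_raw q a b \<alpha> \<beta> n =
     qnum q a * qnum q (a + 1)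
     - qnum q (\<alpha> + \<beta> + real n + 1) * qnum q (a - b + real n + 1) * qnum q (\<beta> + real n + 1)
         * qnum q (a + b + \<alpha> + real n + 1)
       / (qnum q (\<alpha> + \<beta> + 2 * real n + 1) * qnum q (\<alpha> + \<beta> + 2 * real n + 2))
     - qnum q (\<alpha> + real n) * qnum q (b - a + \<alpha> + \<beta> + real n) * qnum q (- a - b + \<beta> + real n)
         * qnum q (real n)
       / (qnum q (\<alpha> + \<beta> + 2 * real n) * qnum q (\<alpha> + \<beta> + 2 * real n + 1))"

definition racah_beta :: "real \<Rightarrow> real \<Rightarrow> real \<Rightarrow> real \<Rightarrow> real \<Rightarrow> nat \<Rightarrow> real" where
  "racah_beta q a b \<alpha> \<beta> n = cancelled (\<lambda>t. racah_beta_raw q a b (\<alpha> + t) \<beta> n)"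

definition racah_gamma_raw :: "real \<Rightarrow> real \<Rightarrow> real \<Rightarrow> real \<Rightarrow> real \<Rightarrow> nat \<Rightarrow> real" where
  "racah_gamma_raw q a b \<alpha> \<beta> n =
     qnum q (real n) * qnum q (\<alpha> + \<beta> + real n) * qnum q (\<alpha> + real n) * qnum q (\<beta> + real n)
       * qnum q (b - a + \<alpha> + \<beta> + real n) * qnum q (- a - b + \<beta> + real n)
       * qnum q (a - b + real n) * qnum q (a + b + \<alpha> + real n)
     / (qnum q (\<alpha> + \<beta> + 2 * real n - 1) * qnum q (\<alpha> + \<beta> + 2 * real n) ^ 2
        * qnum q (\<alpha> + \<beta> + 2 * real n + 1))"

definition racah_gamma :: "real \<Rightarrow> real \<Rightarrow> real \<Rightarrow> real \<Rightarrow> real \<Rightarrow> nat \<Rightarrow> real" where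
  "racah_gamma q a b \<alpha> \<beta> n = cancelled (\<lambda>t. racah_gamma_raw q a b (\<alpha> + t) \<beta> n)"

definition scale_C :: "real \<Rightarrow> real \<Rightarrow> nat \<Rightarrow> real" where
  "scale_C q a n = q powr (real n / 2 * (2 * a + 1)) * kappa q ^ (2 * n)"


section \<open>Monic q-Hahn polynomials\<close>

definition hahn_x :: "real \<Rightarrow> real \<Rightarrow> real" where
  "hahn_x q s = q powr (- s)"

definition hahn_h :: "real \<Rightarrow> real \<Rightarrow> real \<Rightarrow> nat \<Rightarrow> nat \<Rightarrow> real \<Rightarrow> real" where
  "hahn_h q \<alpha>t \<beta>t N n x =
     qpochs [q powr (- real N), \<alpha>t * q] q n / qpoch (\<alpha>t * \<beta>t * q ^ (n + 1)) q n
     * qhyp [q powr (- real n), \<alpha>t * \<beta>t * q ^ (n + 1), x] [q powr (- real N), \<alpha>t * q] q q"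

definition hahn_rho :: "real \<Rightarrow> real \<Rightarrow> real \<Rightarrow> nat \<Rightarrow> nat \<Rightarrow> real" where
  "hahn_rho q \<alpha>t \<beta>t N s =
     (\<alpha>t * \<beta>t) powi (- int s) / (- kappa q)
     * ((\<alpha>t * q) ^ N * qpoch (\<beta>t * q) q N / qpoch (\<alpha>t * \<beta>t * q ^ 2) q N)
     * (qpochs [\<alpha>t * q, q powr (- real N)] q s
        / qpochs [q, inverse \<beta>t * q powr (- real N)] q s)"

definition hahn_d2_raw :: "real \<Rightarrow> real \<Rightarrow> real \<Rightarrow> nat \<Rightarrow> nat \<Rightarrow> real" where
  "hahn_d2_raw q \<alpha>t \<beta>t N n =
     (- \<alpha>t * q) ^ n * q powr (real (n choose 2) - real N * real n)
     * ((1 - \<alpha>t * \<beta>t * q) / (1 - \<alpha>t * \<beta>t * q ^ (2 * n + 1)))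
     * (qpochs [q, \<alpha>t * q, \<beta>t * q, q powr (- real N), \<alpha>t * \<beta>t * q ^ (N + 2)] q n
        / qpochs [\<alpha>t * \<beta>t * q, \<alpha>t * \<beta>t * q ^ (n + 1), \<alpha>t * \<beta>t * q ^ (n + 1)] q n)"

definition hahn_d2 :: "real \<Rightarrow> real \<Rightarrow> real \<Rightarrow> nat \<Rightarrow> nat \<Rightarrow> real" where
  "hahn_d2 q \<alpha>t \<beta>t N n = cancelled (\<lambda>t. hahn_d2_raw q (\<alpha>t + t) \<beta>t N n)"

definition hahn_beta_raw :: "real \<Rightarrow> real \<Rightarrow> real \<Rightarrow> nat \<Rightarrow> nat \<Rightarrow> real" where
  "hahn_beta_raw q \<alpha>t \<beta>t N n =
     1 - (1 - \<alpha>t * \<beta>t * q ^ (n + 1)) * (1 - \<alpha>t * q ^ (n + 1)) * (1 - q powr (real n - real N))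
         / ((1 - \<alpha>t * \<beta>t * q ^ (2 * n + 1)) * (1 - \<alpha>t * \<beta>t * q ^ (2 * n + 2)))
       + \<alpha>t * q powr (real n - real N) * (1 - q ^ n) * (1 - \<beta>t * q ^ n)
           * (1 - \<alpha>t * \<beta>t * q ^ (n + N + 1))
         / ((1 - \<alpha>t * \<beta>t * q ^ (2 * n)) * (1 - \<alpha>t * \<beta>t * q ^ (2 * n + 1)))"

definition hahn_beta :: "real \<Rightarrow> real \<Rightarrow> real \<Rightarrow> nat \<Rightarrow> nat \<Rightarrow> real" where
  "hahn_beta q \<alpha>t \<beta>t N n = cancelled (\<lambda>t. hahn_beta_raw q (\<alpha>t + t) \<beta>t N n)"

definition hahn_gamma_raw :: "real \<Rightarrow> real \<Rightarrow> real \<Rightarrow> nat \<Rightarrow> nat \<Rightarrow> real" where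
  "hahn_gamma_raw q \<alpha>t \<beta>t N n =
     - \<alpha>t * q powr (real n - real N)
     * ((1 - \<alpha>t * \<beta>t * q ^ n) * (1 - \<alpha>t * q ^ n) * (1 - \<beta>t * q ^ n)
          * (1 - \<alpha>t * \<beta>t * q ^ (n + N + 1)) * (1 - q ^ n) * (1 - q powr (real n - real N - 1))
        / ((1 - \<alpha>t * \<beta>t * q powr (2 * real n - 1)) * (1 - \<alpha>t * \<beta>t * q ^ (2 * n)) ^ 2
           * (1 - \<alpha>t * \<beta>t * q ^ (2 * n + 1))))"

definition hahn_gamma :: "real \<Rightarrow> real \<Rightarrow> real \<Rightarrow> nat \<Rightarrow> nat \<Rightarrow> real" where
  "hahn_gamma q \<alpha>t \<beta>t N n = cancelled (\<lambda>t. hahn_gamma_raw q (\<alpha>t + t) \<beta>t N n)"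

end

(* In the variable X = q^(-s) + z q^s with z = q^(2a+1), the polynomials C_n u_n, the weight, the
   norms and the rescaled recurrence coefficients are rational functions of q^alpha, q^beta and z
   that are regular at z = 0, where they are the q-Hahn ones.  Hence every limit is continuity at
   z = 0, and both families obey one orthogonality and one recurrence relation.

   The recurrence relation is checked on coefficients in the basis (q^(-s), z q^s; q)_k.
   A telescoping sum gives the moments of that basis, so that the n-th polynomial has mean zero for
   n >= 1.  Since the (N+1)-st polynomial vanishes on the lattice, the recurrence relation then
   yields orthogonality.  This works for generic parameters; the values at which a factor
   1 - q^(alpha+beta+m) that has to be cancelled vanishes follow by continuity. *)

theory Submission
  imports Defs
begin

section \<open>The recurrence relation\<close>

text \<open>The scaling rests on C_(n+1) / C_n = q^(a+1) / c_1: multiplied by C_n q^(a+1) / c_1, the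
  recurrence relation has C_(n+1) u_(n+1) with coefficient one. The same factor q^(a+1) / c_1 turns
  mu(s + a) into X - (1 + q) q^a. The coefficient beta_n acquires the same shift, so it drops out of
  the relation for every a, and it tends to 0 in the limit of the coefficients. The obstacle is
  resonance. With A = q^\<beta> and B = q^\<alpha> the two parameter ranges exclude A B q^m = 1 only
  for 2 \<le> m \<le> 2N, whereas the raw formulas also divide by 1 - A B q^m with m = 0, 1 and 2N +
  1. Those factors either recur in the numerator or stand beside 1 - q^n at n = 0. Each quantity is
  therefore given a form without them, and the limit hidden in \<open>cancelled\<close> is evaluated
  by comparison with that form. Orthogonality also uses the recurrence relation at degree N, where m
  = 2N + 2 enters, and this is why it is first proved for generic B. Allowing 0 \<le> z < 1
  throughout treats the q-Racah case z > 0 and the q-Hahn case z = 0 by one argument.\<close>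

lemma qpoch_0 [simp]: "qpoch x q 0 = 1"
  by (simp add: qpoch_def)

lemma qpoch_Suc: "qpoch x q (Suc k) = qpoch x q k * (1 - x * q ^ k)"
  by (simp add: qpoch_def)

lemma qpoch_Suc_left: "qpoch x q (Suc k) = (1 - x) * qpoch (x * q) q k"
  unfolding qpoch_def by (subst prod.lessThan_Suc_shift) (simp add: mult.assoc)

lemma qpoch_add: "qpoch x q (m + n) = qpoch x q m * qpoch (x * q ^ m) q n"
  by (induction n) (simp_all add: qpoch_Suc power_add mult_ac)

lemma qpoch_eq_0_iff: "qpoch x q k = 0 \<longleftrightarrow> (\<exists>i<k. x * q ^ i = 1)"
  by (auto simp: qpoch_def)

lemma qpoch_q_nonzero:
  assumes "0 < q" "q < 1"
  shows "qpoch q q k \<noteq> 0"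
proof -
  have "q * q ^ i \<noteq> 1" for i
    using assms power_Suc_less_one[of q i] by simp
  then show ?thesis by (simp add: qpoch_eq_0_iff)
qed

lemma qpoch_inverse_power_eq_0:
  assumes "0 < q" "n < k"
  shows "qpoch (1 / q ^ n) q k = 0"
  using assms by (auto simp: qpoch_eq_0_iff intro!: exI[of _ n])

text \<open>The q-Racah quantities below are written in \<open>A = q\<^sup>\<beta>\<close>, \<open>B = q\<^sup>\<alpha>\<close> and \<open>z = q\<^bsup>2a+1\<^esup>\<close>, with
  the substitution \<open>X = q\<^bsup>-s\<^esup> + z q\<^sup>s\<close> for the lattice \<open>\<mu>(s + a)\<close>.  All of them are
  rational in these parameters, and \<open>z = 0\<close> gives the q-Hahn quantities.\<close>

definition aw_basis :: "real \<Rightarrow> real \<Rightarrow> nat \<Rightarrow> real \<Rightarrow> real" where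
  "aw_basis q z k X = (\<Prod>i<k. 1 + z * q ^ (2 * i) - q ^ i * X)"

text \<open>The j-th factors of the q-factorials of the three lower parameters q^(-N), A q and z B
  q^(N+1), taken together.\<close>

definition qr_fac :: "real \<Rightarrow> nat \<Rightarrow> real \<Rightarrow> real \<Rightarrow> real \<Rightarrow> nat \<Rightarrow> real" where
  "qr_fac q N A B z j = (1 - q ^ j / q ^ N) * (1 - A * q ^ (j + 1)) * (1 - z * B * q ^ (N + 1 + j))"

text \<open>Term k of the series times the monic prefactor, with the quotients of q-factorials
  carried out: the lower parameters leave the factors k \<le> j < n, and (A B q^(n+1))_k / (A B
  q^(n+1))_n leaves the product over m. The formula thus keeps its meaning at degree N + 1, where
  q^(-N) as a lower parameter would give 0/0.\<close>

definition qr_coeff :: "real \<Rightarrow> nat \<Rightarrow> real \<Rightarrow> real \<Rightarrow> real \<Rightarrow> nat \<Rightarrow> nat \<Rightarrow> real" where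
  "qr_coeff q N A B z n k = qpoch (1 / q ^ n) q k * q ^ k / qpoch q q k
     * (\<Prod>j=k..<n. qr_fac q N A B z j) / (\<Prod>m=n+1+k..<2*n+1. 1 - A * B * q ^ m)"

definition qr_poly :: "real \<Rightarrow> nat \<Rightarrow> real \<Rightarrow> real \<Rightarrow> real \<Rightarrow> nat \<Rightarrow> real \<Rightarrow> real" where
  "qr_poly q N A B z n X = (\<Sum>k\<le>n. qr_coeff q N A B z n k * aw_basis q z k X)"

text \<open>The ratio of the polynomials of degrees n + 1 and n at X = 1 + z, the lattice point s =
  0, where every basis element except the zeroth vanishes. For n = 0 a factor 1 - A B q has been
  cancelled.\<close>

definition qr_A :: "real \<Rightarrow> nat \<Rightarrow> real \<Rightarrow> real \<Rightarrow> real \<Rightarrow> nat \<Rightarrow> real" where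
  "qr_A q N A B z n = qr_fac q N A B z n
     * (if n = 0 then 1 else (1 - A * B * q ^ (n + 1)) / (1 - A * B * q ^ (2 * n + 1)))
     / (1 - A * B * q ^ (2 * n + 2))"

text \<open>The factor z (1 - A q^(n-N) / z) is multiplied out, which keeps the value at z = 0
  finite.\<close>

definition qr_C :: "real \<Rightarrow> nat \<Rightarrow> real \<Rightarrow> real \<Rightarrow> real \<Rightarrow> nat \<Rightarrow> real" where
  "qr_C q N A B z n = (1 - q ^ n) * (1 - B * q ^ n) * (1 - A * B * q ^ (n + N + 1))
     * (z - A * q ^ n / q ^ N) / ((1 - A * B * q ^ (2 * n)) * (1 - A * B * q ^ (2 * n + 1)))"

text \<open>At X = 1 + z the recurrence relation reads 1 + z = A_n + beta_n + C_n once gamma_n =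
  A_(n-1) C_n, which fixes the diagonal coefficient.\<close>

definition qr_beta :: "real \<Rightarrow> nat \<Rightarrow> real \<Rightarrow> real \<Rightarrow> real \<Rightarrow> nat \<Rightarrow> real" where
  "qr_beta q N A B z n = 1 + z - qr_A q N A B z n - qr_C q N A B z n"

definition qr_gamma :: "real \<Rightarrow> nat \<Rightarrow> real \<Rightarrow> real \<Rightarrow> real \<Rightarrow> nat \<Rightarrow> real" where
  "qr_gamma q N A B z n = qr_A q N A B z (n - 1) * qr_C q N A B z n"

lemma aw_basis_Suc: "aw_basis q z (Suc k) X = (1 + z * q ^ (2 * k) - q ^ k * X) * aw_basis q z k X"
  by (simp add: aw_basis_def mult.commute)

lemma qr_coeff_eq_0: "0 < q \<Longrightarrow> n < k \<Longrightarrow> qr_coeff q N A B z n k = 0"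
  by (simp add: qr_coeff_def qpoch_inverse_power_eq_0)

lemma qr_poly_0 [simp]: "qr_poly q N A B z 0 X = 1"
  by (simp add: qr_poly_def qr_coeff_def aw_basis_def)

lemma qr_poly_extend:
  assumes "0 < q" "n \<le> m"
  shows "qr_poly q N A B z n X = (\<Sum>k\<le>m. qr_coeff q N A B z n k * aw_basis q z k X)"
  unfolding qr_poly_def
  by (rule sum.mono_neutral_left) (use assms in \<open>auto simp: qr_coeff_eq_0\<close>)

text \<open>The core of the comparison of coefficients, with Q = q^n, K = q^k, e = q^(-N) and g = z
  B q^(N+1). The bracket comes from the diagonal terms and the term k - 1, the second summand from
  \<open>qr_A\<close> and the third from \<open>qr_C\<close>.\<close>

lemma qr_recurrence_identity:
  fixes q A B z e Q K :: real
  assumes "q \<noteq> 0" "e \<noteq> 0" "Q \<noteq> 0" "K \<noteq> 0"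
  defines "g \<equiv> z * B * q / e"
  shows "((1 - z*K) * (1 - K/(q*Q)) * (1 - A*B*Q*K) - (1 - e*K/q) * (1 - A*K) * (1 - g*K/q))
           * (1 - A*B*q*Q^2) / K
       + (1 - e*Q) * (1 - A*q*Q) * (1 - g*Q) * (1 - A*B*Q*K) / (q*Q)
       + (1 - K/(q*Q)) * (1 - B*Q) * (1 - A*B*q*Q/e) * (z - A*Q*e) = 0"
  using assms(1-4) unfolding g_def
  apply (simp add: divide_simps)
  apply algebra
  done

lemma qr_C_0 [simp]: "qr_C q N A B z 0 = 0"
  by (simp add: qr_C_def)

lemma power_ne_1:
  fixes q :: real
  assumes "0 < q" "q < 1" "0 < n"
  shows "q ^ n \<noteq> 1"
  using assms power_Suc_less_one[of q "n - 1"] by (cases n) auto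

text \<open>Reduces the full comparison of coefficients to the core relation \<open>D\<close>. The
  relations \<open>PA\<close> and \<open>PC\<close> between shifted factors 1 - A B q^m extract a
  factor 1 - K from the terms of degree n + 1 and n - 1, after which everything is 1 - K times the
  left side of \<open>D\<close>.\<close>

lemma qr_recurrence_assembly:
  fixes x :: real
  assumes x: "x * t2 = x1" and y: "y' * (1 - y) = 1" and C: "C * t0 * (y * y') = - C1"
    and D: "((1 - z*K) * u * sk - Ej) * i + En * sk * r * x1 + u * C1 = 0"
    and PA: "u * s1 - (1 - r) * sk1 = (1 - K) * t2 * r"
    and PC: "sk * (1 - y) - s0 * w = - (1 - K) * t0 * y"
  shows "((1 - K) * (1 - z*K) * i + En * s1 * x + C) * u * sk - (1 - K) * i * Ej
      - (1 - r) * En * sk * sk1 * x - C * s0 * u * w * y' = 0" (is "?U = 0")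
proof -
  have "?U = (1 - K) * ((1 - z*K) * u * sk - Ej) * i + En * sk * x * (u * s1 - (1 - r) * sk1)
      + C * u * y' * (sk * (1 - y) - s0 * w) + C * u * sk * (1 - y' * (1 - y))"
    by algebra
  also have "\<dots> = (1 - K) * (((1 - z*K) * u * sk - Ej) * i + En * sk * r * (x * t2)
      - u * (C * t0 * (y * y')))"
    unfolding PA PC y by algebra
  finally show ?thesis unfolding x C using D by simp
qed

text \<open>Multiplication by X is bidiagonal in this basis, because the next basis element arises
  through the factor 1 + z q^(2k) - q^k X. The left side is therefore coefficient k of X times the
  n-th polynomial. At n = 0 the truncated index n - 1 is harmless, since gamma_0 = 0.\<close>

lemma qr_coeff_recurrence:
  assumes q: "0 < q" "q < 1" and gen: "\<And>m. m \<le> 2 * n + 2 \<Longrightarrow> A * B * q ^ m \<noteq> 1"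
  shows "(1 + z * q ^ (2 * k)) / q ^ k * qr_coeff q N A B z n k
           - (if k = 0 then 0 else qr_coeff q N A B z n (k - 1) / q ^ (k - 1))
         = qr_coeff q N A B z (n + 1) k + qr_beta q N A B z n * qr_coeff q N A B z n k
           + qr_gamma q N A B z n * qr_coeff q N A B z (n - 1) k"
proof -
  let ?cf = "qr_coeff q N A B z"
  let ?E = "qr_fac q N A B z"
  define s where "s m = 1 - A * B * q ^ m" for m
  have s: "s m \<noteq> 0" if "m \<le> 2 * n + 2" for m
    using gen[OF that] by (simp add: s_def)
  have A: "qr_A q N A B z m = ?E m * s (m + 1) / (s (2 * m + 1) * s (2 * m + 2))" if "m \<le> n" for m
    using s[of 1] that by (auto simp: qr_A_def s_def)
  have cf: "?cf n k = qpoch (1 / q ^ n) q k * q ^ k / qpoch q q k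
     * (\<Prod>j=k..<n. ?E j) / (\<Prod>m=n+1+k..<2*n+1. s m)" for n k
    by (simp add: qr_coeff_def s_def)
  have qn: "q ^ m \<noteq> 0" for m using q by simp
  \<comment> \<open>The denominator is that of coefficient k - 1 at degree n, the numerator that of
    coefficient k; the products in the other coefficients differ from \<open>R\<close> by a few
    factors only.\<close>
  define R where "R = (\<Prod>j=k..<n. ?E j) / (\<Prod>m=n+k..<2*n+1. s m)"
  define r where "r n k = (\<Prod>j=k..<n. ?E j) / (\<Prod>m=n+1+k..<2*n+1. s m)" for n k
  have cf: "?cf n k = qpoch (1 / q ^ n) q k * q ^ k / qpoch q q k * r n k" for n k
    by (simp add: qr_coeff_def s_def r_def)
  have peel: "(\<Prod>m=a..<b. f m) = f a * (\<Prod>m=a+1..<b. f m)" if "a < b" for a b and f :: "nat \<Rightarrow> real"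
    using prod.atLeast_Suc_lessThan[OF that, of f] by simp
  have r1: "r n k = R * s (n + k)" if "k \<le> n"
  proof -
    have "n + k < 2 * n + 1" "n + 1 + k = n + k + 1" using that by auto
    then show ?thesis
      using s[of "n + k"] that unfolding r_def R_def by (simp only: peel) simp
  qed
  have r2: "r n (k - 1) = R * ?E (k - 1)" if "k \<le> n" "0 < k"
  proof -
    have "k - 1 < n" "k - 1 + 1 = k" "n + 1 + (k - 1) = n + k" using that by auto
    then show ?thesis
      unfolding r_def R_def by (simp only: peel) simp
  qed
  have r3: "r (n + 1) k = R * ?E n * s (n + k) * s (n + k + 1) / (s (2 * n + 1) * s (2 * n + 2))"
    if "k \<le> n"
  proof -
    have lt: "n + k + 1 < 2 * n + 3" "n + k + 1 \<le> 2 * n + 1" "n + k < 2 * n + 1"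
      "n + k + 1 + 1 = n + 2 + k" using that by auto
    have s1: "s (n + k + 1) \<noteq> 0" using that s by simp
    have "(\<Prod>m=n+2+k..<2*n+3. s m) * s (n + k + 1) = (\<Prod>m=n+k+1..<2*n+3. s m)"
      unfolding peel[OF lt(1)] lt(4) by simp
    also have "\<dots> = (\<Prod>m=n+k+1..<2*n+1. s m) * s (2 * n + 1) * s (2 * n + 2)"
      using lt(2) prod.atLeastLessThan_Suc[of "n + k + 1" "2 * n + 1" s]
        prod.atLeastLessThan_Suc[of "n + k + 1" "2 * n + 2" s] by (simp add: numeral_3_eq_3)
    also have "(\<Prod>m=n+k+1..<2*n+1. s m) = (\<Prod>m=n+k..<2*n+1. s m) / s (n + k)"
      unfolding peel[OF lt(3)] using that s[of "n + k"] by simp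
    finally have *: "(\<Prod>m=n+2+k..<2*n+3. s m)
        = (\<Prod>m=n+k..<2*n+1. s m) / s (n + k) * s (2 * n + 1) * s (2 * n + 2) / s (n + k + 1)"
      unfolding nonzero_eq_divide_eq[OF s1] .
    have "n + 1 + 1 + k = n + 2 + k" "2 * (n + 1) + 1 = 2 * n + 3" by auto
    then have "r (n + 1) k = (\<Prod>j=k..<n. ?E j) * ?E n / (\<Prod>m=n+2+k..<2*n+3. s m)"
      using that by (simp only: r_def) simp
    then show ?thesis
      unfolding * R_def using that s[of "n + k"] s[of "n + k + 1"] by simp
  qed
  have r4: "qr_gamma q N A B z n * r (n - 1) k = R * qr_C q N A B z n * s n" if "k < n"
  proof -
    have "n \<noteq> 0" using that by simp
    then obtain n' where n': "n = Suc n'" by (cases n) auto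
    show ?thesis
      using that s[of "2 * n' + 1"] s[of "2 * n' + 2"] unfolding n'
      by (simp add: qr_gamma_def r_def R_def A n' mult_ac)
  qed
  have beta: "qr_beta q N A B z n = 1 + z - ?E n * s (n + 1) / (s (2 * n + 1) * s (2 * n + 2))
     - qr_C q N A B z n"
    by (simp add: qr_beta_def A)
  \<comment> \<open>For k = n + 1 only leading coefficients meet. For k = 0 there is no term k - 1,
    and the claim is the value of the recurrence relation at X = 1 + z. The remaining case has all
    terms in the range of the general formulas, except that the degree n - 1 contributes nothing at
    k = n.\<close>
  consider "k > n + 1" | "k = n + 1" | "k = 0" | j where "k = Suc j" "j < n"
    by (metis Suc_eq_plus1 Suc_less_eq less_Suc_eq linorder_neqE_nat not0_implies_Suc)
  then show ?thesis
  proof cases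
    case 1
    then show ?thesis using q by (simp add: qr_coeff_eq_0)
  next
    case 2
    have 0: "?cf n k = 0" "?cf (n - 1) k = 0"
      using 2 q by (simp_all add: qr_coeff_eq_0)
    have r: "r (Suc n) (Suc n) = 1" "r n n = 1"
      by (simp_all add: r_def)
    have "1 - q * q ^ n \<noteq> 0"
      using power_ne_1[OF q, of "Suc n"] by simp
    then show ?thesis using 2 q qpoch_q_nonzero[OF q, of n] unfolding 0
      by (simp add: cf r qpoch_Suc_left[of "1 / (q * q ^ n)"] qpoch_Suc[of q] divide_simps)
        (simp add: algebra_simps)
  next
    case 3
    show ?thesis
    proof (cases "n = 0")
      case True
      then show ?thesis
        using 3 s[of 1] s[of 2] beta by (simp add: qr_gamma_def cf r_def numeral_2_eq_2)
    next
      case False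
      have "r (n + 1) 0 = R * s n * (?E n * s (n + 1) / (s (2 * n + 1) * s (2 * n + 2)))"
        using r3 3 by simp
      then show ?thesis
        using 3 False r1 r4 by (simp add: beta cf algebra_simps)
    qed
  next
    case 4
    define K where "K = q ^ k"
    define Q where "Q = q ^ n"
    define e where "e = 1 / q ^ N"
    define g where "g = z * B * q / e"
    \<comment> \<open>(q^(-n))_(k-1) divides (q^(-n))_k and also (q^(-n-1))_k; for degree n - 1 it
      enters through (1 - q^(-n)) (q^(1-n))_k = (q^(-n))_(k+1).\<close>
    define F where "F = q ^ k / qpoch q q k * qpoch (1 / q ^ n) q j"
    have nz: "q \<noteq> 0" "e \<noteq> 0" "Q \<noteq> 0" "K \<noteq> 0" using q by (simp_all add: K_def Q_def e_def)
    have "K \<noteq> 1" "Q \<noteq> 1" "q * Q \<noteq> 1"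
      using power_ne_1[OF q, of k] power_ne_1[OF q, of n] power_ne_1[OF q, of "Suc n"] 4
      by (simp_all add: K_def Q_def)
    have Kj: "q ^ j = K / q" using 4 q by (simp add: K_def)
    have p1: "qpoch (1 / q ^ n) q k = qpoch (1 / q ^ n) q j * (1 - K / (q * Q))"
      using 4 by (simp add: qpoch_Suc Kj Q_def)
    have p3: "qpoch (1 / q ^ Suc n) q k = (1 - 1 / (q * Q)) * qpoch (1 / q ^ n) q j"
      using 4 q by (simp add: qpoch_Suc_left Q_def)
    have p4: "qpoch (1 / q ^ (n - 1)) q k * (1 - 1 / Q)
        = qpoch (1 / q ^ n) q j * (1 - K / (q * Q)) * (1 - K / Q)"
    proof -
      have "1 / q ^ n * q = 1 / q ^ (n - 1)"
        using 4 q by (cases n) auto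
      then have "(1 - 1 / Q) * qpoch (1 / q ^ (n - 1)) q k = qpoch (1 / q ^ n) q (Suc k)"
        by (simp add: qpoch_Suc_left Q_def)
      also have "\<dots> = qpoch (1 / q ^ n) q j * (1 - K / (q * Q)) * (1 - K / Q)"
        by (simp add: qpoch_Suc[of _ _ k] p1) (simp add: K_def Q_def)
      finally show ?thesis by (simp add: mult.commute)
    qed
    have cf1: "?cf n k = F * R * (1 - K / (q * Q)) * s (n + k)"
      using 4 r1 unfolding cf p1 F_def by simp
    have q1: "q ^ (k - 1) / qpoch q q (k - 1) / q ^ (k - 1) = q ^ k / qpoch q q k * (1 - K) / K"
      using 4 q qpoch_q_nonzero[OF q, of j] \<open>K \<noteq> 1\<close> \<open>K \<noteq> 0\<close>
      by (simp add: qpoch_Suc K_def divide_simps)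
    have "?cf n (k - 1) / q ^ (k - 1) = qpoch (1 / q ^ n) q j
        * (q ^ (k - 1) / qpoch q q (k - 1) / q ^ (k - 1)) * r n (k - 1)"
      using 4 by (simp add: cf)
    also have "\<dots> = F * R * (1 - K) / K * ?E j"
      unfolding q1 using r2 4 by (simp add: F_def)
    finally have cf2: "?cf n (k - 1) / q ^ (k - 1) = F * R * (1 - K) / K * ?E j" .
    have cf3: "?cf (n + 1) k = F * R * (1 - 1 / (q * Q)) * ?E n * s (n+k) * s (n+k+1) / (s (2*n+1) * s (2*n+2))"
      using 4 r3 p3 by (simp add: cf F_def)
    have cf4: "qr_gamma q N A B z n * ?cf (n - 1) k
      = F * R * qr_C q N A B z n * s n * (1 - K / (q * Q)) * (1 - K / Q) / (1 - 1 / Q)"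
      (is "?g * _ = ?rhs")
    proof (cases "k = n")
      \<comment> \<open>Here k exceeds the degree n - 1, and on the right 1 - K / Q = 0.\<close>
      case True
      then show ?thesis using nz q 4 by (simp add: qr_coeff_eq_0 K_def Q_def)
    next
      case False
      then have "k < n" using 4 by simp
      have "?g * ?cf (n - 1) k = qpoch (1 / q ^ (n - 1)) q k * (1 - 1 / Q) / (1 - 1 / Q) * q ^ k / qpoch q q k * (?g * r (n - 1) k)"
        using \<open>Q \<noteq> 1\<close> nz by (simp add: cf)
      also have "\<dots> = ?rhs"
        unfolding p4 r4[OF \<open>k < n\<close>] by (simp add: F_def mult_ac)
      finally show ?thesis .
    qed
    have ss: "s (n + k) = 1 - A*B*Q*K" "s (n + k + 1) = 1 - A*B*q*Q*K" "s n = 1 - A*B*Q"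
      "s (n + 1) = 1 - A*B*q*Q" "s (2 * n) = 1 - A*B*Q^2" "s (2 * n + 1) = 1 - A*B*q*Q^2"
      "s (2 * n + 2) = 1 - A*B*q^2*Q^2"
      by (simp_all add: s_def Q_def K_def power_add power_mult power2_eq_square power_mult_distrib mult_ac)
    have Ej: "?E j = (1 - e*K/q) * (1 - A*K) * (1 - g*K/q)"
      using 4 q by (simp add: qr_fac_def e_def g_def K_def power_add field_simps)
    have En: "?E n = (1 - e*Q) * (1 - A*q*Q) * (1 - g*Q)"
      using q by (simp add: qr_fac_def e_def g_def Q_def power_add field_simps)
    define C1 where "C1 = (1 - B*Q) * (1 - A*B*q*Q/e) * (z - A*Q*e) / s (2*n+1)"
    have C: "qr_C q N A B z n = C1 * (1 - Q) / s (2 * n)"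
      by (simp add: qr_C_def C1_def Q_def e_def s_def power_add mult_ac)
    have nz': "s (2 * n) \<noteq> 0" "s (2 * n + 1) \<noteq> 0" "s (2 * n + 2) \<noteq> 0"
      using s by simp_all
    have "(((1 - z*K) * (1 - K/(q*Q)) * s (n + k) - ?E j) * s (2*n+1) / K
       + ?E n * s (n + k) / (q*Q) + (1 - K/(q*Q)) * (C1 * s (2*n+1))) / s (2*n+1) = 0"
      using qr_recurrence_identity[OF \<open>q \<noteq> 0\<close> \<open>e \<noteq> 0\<close> \<open>Q \<noteq> 0\<close> \<open>K \<noteq> 0\<close>, of z A B] nz'
      unfolding Ej En ss(1,6) C1_def g_def by (simp add: mult.assoc)
    then have D: "((1 - z*K) * (1 - K/(q*Q)) * s (n + k) - ?E j) / K
       + ?E n * s (n + k) / (q*Q* s (2*n+1)) + (1 - K/(q*Q)) * C1 = 0"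
      using nz' by (simp add: add_divide_distrib mult_ac)
    have PA: "(1 - K/(q*Q)) * s (n + 1) - (1 - 1/(q*Q)) * s (n + k + 1) = (1 - K) * s (2*n+2) / (q*Q)"
      unfolding ss using nz by (simp add: field_simps power2_eq_square)
    have PC: "s (n + k) * (1 - 1/Q) - s n * (1 - K/Q) = - (1 - K) * s (2*n) / Q"
      unfolding ss using nz by (simp add: field_simps power2_eq_square)
    define a t2 t3 t4 where "a = (1 + z * q ^ (2 * k)) / q ^ k" and "t2 = (1 - K) / K * ?E j"
      and "t3 = (1 - 1 / (q * Q)) * ?E n * s (n+k) * s (n+k+1) / (s (2*n+1) * s (2*n+2))"
      and "t4 = qr_C q N A B z n * s n * (1 - K / (q * Q)) * (1 - K / Q) / (1 - 1 / Q)"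
    have a: "a = (1 - K) * (1 - z*K) / K + 1 + z"
      using nz unfolding a_def K_def[symmetric] power_mult[of q 2 k] mult.commute[of 2 k]
      by (simp add: power_mult K_def[symmetric] power2_eq_square field_simps)
    have Cy: "qr_C q N A B z n * s (2*n) * (1 / Q * (1 / (1 - 1/Q))) = - C1"
      unfolding C using nz' nz \<open>Q \<noteq> 1\<close> by (simp add: field_simps)
    have aB: "a - qr_beta q N A B z n
        = (1 - K) * (1 - z*K) * (1/K) + ?E n * s (n + 1) * (1 / (s (2*n+1) * s (2*n+2))) + qr_C q N A B z n"
      unfolding a beta by simp
    \<comment> \<open>This is the claim with the common factor \<open>F * R\<close> removed.\<close>
    have "(a - qr_beta q N A B z n) * (1 - K/(q*Q)) * s (n + k) - t2 - t3 - t4 = 0"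
      using qr_recurrence_assembly[of "1 / (s (2*n+1) * s (2*n+2))" "s (2*n+2)" "1 / s (2*n+1)"
          "1 / (1 - 1/Q)" "1/Q" "qr_C q N A B z n" "s (2 * n)" C1 z K "1 - K/(q*Q)" "s (n+k)" "?E j"
          "1/K" "?E n" "1/(q*Q)" "s (n+1)" "s (n+k+1)" "s n" "1 - K/Q", OF _ _ Cy _ _ _]
        D PA PC nz' nz \<open>Q \<noteq> 1\<close>
      by (simp add: aB t2_def t3_def t4_def mult_ac)
    then have U: "a * (1 - K/(q*Q)) * s (n + k) - t2 - t3
        - qr_beta q N A B z n * (1 - K/(q*Q)) * s (n + k) - t4 = 0"
      unfolding left_diff_distrib by linarith
    have "?cf n (k - 1) / q ^ (k - 1) = F * R * t2" "?cf (n + 1) k = F * R * t3"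
      "qr_gamma q N A B z n * ?cf (n - 1) k = F * R * t4"
      unfolding cf2 cf3 cf4 t2_def t3_def t4_def by (simp_all add: mult.assoc)
    moreover have "a * ?cf n k - F * R * t2 - (F * R * t3 + qr_beta q N A B z n * ?cf n k + F * R * t4)
       = F * R * (a * (1 - K/(q*Q)) * s (n + k) - t2 - t3
        - qr_beta q N A B z n * (1 - K/(q*Q)) * s (n + k) - t4)"
      unfolding cf1 by algebra
    ultimately show ?thesis
      unfolding a_def[symmetric] U using 4 by simp
  qed
qed

lemma qr_poly_recurrence:
  assumes q: "0 < q" "q < 1" and gen: "\<And>m. m \<le> 2 * n + 2 \<Longrightarrow> A * B * q ^ m \<noteq> 1"
  shows "X * qr_poly q N A B z n X = qr_poly q N A B z (n + 1) X
           + qr_beta q N A B z n * qr_poly q N A B z n X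
           + qr_gamma q N A B z n * qr_poly q N A B z (n - 1) X"
proof -
  let ?cf = "qr_coeff q N A B z" and ?phi = "\<lambda>k. aw_basis q z k X"
  have X: "X * ?phi k = (1 + z * q ^ (2 * k)) / q ^ k * ?phi k - ?phi (Suc k) / q ^ k" for k
    using q by (simp add: aw_basis_Suc field_simps)
  have shift: "(\<Sum>k\<le>n+1. (if k = 0 then 0 else ?cf n (k - 1) / q ^ (k - 1)) * ?phi k)
      = (\<Sum>k\<le>n. ?cf n k / q ^ k * ?phi (Suc k))"
    by (simp add: sum.atMost_Suc_shift del: sum.atMost_Suc)
  have "X * qr_poly q N A B z n X = (\<Sum>k\<le>n. ?cf n k * (X * ?phi k))"
    by (simp add: qr_poly_def sum_distrib_left mult_ac)
  also have "\<dots> = (\<Sum>k\<le>n. (1 + z * q ^ (2 * k)) / q ^ k * ?cf n k * ?phi k)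
      - (\<Sum>k\<le>n. ?cf n k / q ^ k * ?phi (Suc k))"
    by (simp add: X sum_subtractf[symmetric] algebra_simps)
  also have "(\<Sum>k\<le>n. (1 + z * q ^ (2 * k)) / q ^ k * ?cf n k * ?phi k)
      = (\<Sum>k\<le>n+1. (1 + z * q ^ (2 * k)) / q ^ k * ?cf n k * ?phi k)"
    using q by (simp add: qr_coeff_eq_0)
  also have "\<dots> - (\<Sum>k\<le>n. ?cf n k / q ^ k * ?phi (Suc k))
     = (\<Sum>k\<le>n+1. ((1 + z * q ^ (2 * k)) / q ^ k * ?cf n k
           - (if k = 0 then 0 else ?cf n (k - 1) / q ^ (k - 1))) * ?phi k)"
    unfolding shift[symmetric] sum_subtractf[symmetric] by (intro sum.cong) (auto simp: algebra_simps)
  also have "\<dots> = (\<Sum>k\<le>n+1. (?cf (n + 1) k + qr_beta q N A B z n * ?cf n k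
           + qr_gamma q N A B z n * ?cf (n - 1) k) * ?phi k)"
    by (simp only: qr_coeff_recurrence[OF q gen])
  also have "\<dots> = qr_poly q N A B z (n + 1) X
           + qr_beta q N A B z n * qr_poly q N A B z n X
           + qr_gamma q N A B z n * qr_poly q N A B z (n - 1) X"
    using qr_poly_extend[OF q(1), of n "n+1" N A B z X] qr_poly_extend[OF q(1), of "n-1" "n+1" N A B z X]
      qr_poly_extend[OF q(1), of "n+1" "n+1" N A B z X]
    by (simp only: sum.distrib sum_distrib_left distrib_right mult.assoc)
  finally show ?thesis .
qed

section \<open>Orthogonality\<close>

text \<open>Normalised to total mass 1. The product over A - z q^i is A^(N-s) (z q^s / A)_(N-s) with
  the powers of A multiplied in, and at z = 0 it becomes A^(N-s).\<close>

definition qr_weight :: "real \<Rightarrow> nat \<Rightarrow> real \<Rightarrow> real \<Rightarrow> real \<Rightarrow> nat \<Rightarrow> real" where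
  "qr_weight q N A B z s =
     q ^ (N - s) * qpoch (A * q) q s * qpoch (z * B * q ^ (N + 1)) q s * qpoch (B * q) q (N - s)
     * (\<Prod>i=s..<N. A - z * q ^ i) * (qpoch q q N / (qpoch q q (N - s) * qpoch q q s))
     * (1 - z * q ^ (2 * s)) / (qpoch (z * q ^ s) q (N + 1) * qpoch (A * B * q ^ 2) q N)"

text \<open>At n = N the factors of (A B q^(N+2))_N cancel the upper half of (A B q^2)_(2N). The
  last of them, 1 - A B q^(2N+1), may vanish for admissible parameters, so the cancellation is built
  in.\<close>

definition qr_norm :: "real \<Rightarrow> nat \<Rightarrow> real \<Rightarrow> real \<Rightarrow> real \<Rightarrow> nat \<Rightarrow> real" where
  "qr_norm q N A B z n =
     qpoch q q n * qpoch (B * q) q n * qpoch (A * q) q n * qpoch (z * B * q ^ (N + 1)) q n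
     * qpoch (1 / q ^ N) q n * (\<Prod>i<n. z - A * q ^ (i + 1) / q ^ N)
     * (if n = N then 1 / qpoch (A * B * q ^ 2) q N
        else qpoch (A * B * q ^ (N + 2)) q n / qpoch (A * B * q ^ 2) q (2 * n))
     / qpoch (A * B * q ^ (n + 1)) q n"

definition qr_X :: "real \<Rightarrow> real \<Rightarrow> nat \<Rightarrow> real" where
  "qr_X q z s = 1 / q ^ s + z * q ^ s"

section \<open>Moments of the basis under the weight\<close>

lemma aw_basis_lattice:
  assumes "q \<noteq> 0"
  shows "aw_basis q z k (qr_X q z s) = qpoch (1 / q ^ s) q k * qpoch (z * q ^ s) q k"
proof -
  have "1 + z * q ^ (2 * i) - q ^ i * qr_X q z s = (1 - 1 / q ^ s * q ^ i) * (1 - z * q ^ s * q ^ i)" for i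
    using assms by (simp add: qr_X_def field_simps power_mult power2_eq_square flip: power_mult_distrib)
  then show ?thesis
    by (simp add: aw_basis_def qpoch_def prod.distrib)
qed

lemma qpoch_shift: "qpoch x q k * (1 - x * q ^ k) = (1 - x) * qpoch (x * q) q k"
  by (metis qpoch_Suc qpoch_Suc_left)

lemma qpoch_power_nonzero:
  assumes "\<And>j. j < k \<Longrightarrow> x * q ^ (i + j) \<noteq> 1"
  shows "qpoch (x * q ^ i) q k \<noteq> 0"
  using assms by (auto simp: qpoch_eq_0_iff power_add mult.assoc)

lemma power_le_one_mult_less:
  fixes q z :: real
  assumes "0 < q" "q < 1" "0 \<le> z" "z < 1"
  shows "z * q ^ m < 1"
proof -
  have "z * q ^ m \<le> z"
    using assms by (simp add: mult_left_le power_le_one)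
  with assms show ?thesis by simp
qed

lemma prod_qr_fac:
  "(\<Prod>j<k. qr_fac q N A B z j)
     = qpoch (1 / q ^ N) q k * qpoch (A * q) q k * qpoch (z * B * q ^ (N + 1)) q k"
  by (simp add: qr_fac_def qpoch_def prod.distrib power_add mult_ac)

lemma qpoch_mult_tail:
  assumes "k \<le> n"
  shows "qpoch (x * q ^ (n + 1)) q k * (\<Prod>m=n+1+k..<2*n+1. 1 - x * q ^ m) = qpoch (x * q ^ (n + 1)) q n"
proof -
  have "(\<Prod>m=n+1+k..<2*n+1. 1 - x * q ^ m) = (\<Prod>m=k..<n. 1 - x * q ^ (n + 1 + m))"
    using prod.shift_bounds_nat_ivl[of "\<lambda>m. 1 - x * q ^ m" k "n + 1" n]
    by (simp add: add.commute mult_2 del: power_Suc)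
  moreover have "qpoch (x * q ^ (n + 1)) q k * (\<Prod>m=k..<n. 1 - x * q ^ (n + 1 + m))
    = qpoch (x * q ^ (n + 1)) q n"
    unfolding qpoch_def lessThan_atLeast0 power_add mult.assoc[symmetric]
    by (rule prod.atLeastLessThan_concat) (use assms in auto)
  ultimately show ?thesis by simp
qed

text \<open>The weighted difference of consecutive basis moments telescopes: the two identities say that
  the upper boundary term at \<open>s\<close> is the lower one at \<open>s + 1\<close>, and that the summand is the
  difference of the two.  Here \<open>S = q\<^sup>s\<close>, \<open>K = q\<^sup>k\<close> and \<open>q\<^sup>N = q S M\<close>.\<close>

lemma telescope_step_identity:
  fixes q S M K z :: real
  assumes nz: "q \<noteq> 0" "S \<noteq> 0" "M \<noteq> 0" "q * S \<noteq> 1" "q * M \<noteq> 1" "z * S \<noteq> 1" "Z \<noteq> 0"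
    "z * q * (q * S * M) * S \<noteq> 1"
    and Z: "Z' * (1 - z * S) = Z * (1 - z * q * (q * S * M) * S)"
    and phi: "p' * (1 - K / (q * S)) * (1 - z * S) = p * (1 - 1 / (q * S)) * (1 - z * S * K)"
  shows "(c * (1 - A * q * S) * (1 - g * S) / (1 - q * S) / Z') * p' * (K / (q * S)) * (q * S - K)
       * (A * q - z * (q * S)) * (B * q * (q * S * M) - q * S) * (1 / (q * S * M) - z * (q * S))
     = - (c * q * (1 - B * q * M) * (A - z * S) / (1 - q * M) / Z) * p / S * K
       * (1 - A * q * S) * (1 - g * S) * (1 - S / (q * S * M)) * (1 - z * S * K)"
proof -
  define y where "y = 1 - z * q * (q * S * M) * S"
  have y: "y \<noteq> 0" using nz by (simp add: y_def)
  have Z': "Z' = Z * y / (1 - z * S)"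
    using Z nz by (simp add: field_simps y_def)
  have phi': "p' * (q * S - K) = p * (q * S - 1) * (1 - z * S * K) / (1 - z * S)"
    using phi nz by (simp add: field_simps)
  have e1: "1 / (q * S * M) - z * (q * S) = y / (q * S * M)"
    using nz by (simp add: field_simps y_def)
  have e2: "1 - S / (q * S * M) = - (1 - q * M) / (q * M)"
    using nz by (simp add: field_simps)
  have "(c * (1 - A * q * S) * (1 - g * S) / (1 - q * S) / Z') * p' * (K / (q * S)) * (q * S - K)
       * (A * q - z * (q * S)) * (B * q * (q * S * M) - q * S) * (1 / (q * S * M) - z * (q * S))
     = (c * (1 - A * q * S) * (1 - g * S) / (1 - q * S) / Z') * (p' * (q * S - K)) * (K / (q * S))
       * (q * (A - z * S)) * (- q * S * (1 - B * q * M)) * (y / (q * S * M))"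
    unfolding e1 by algebra
  also have "\<dots> = c * (1 - A * q * S) * (1 - g * S) / Z * p * (1 - z * S * K) * K * (A - z * S)
      * (1 - B * q * M) / (S * M)"
  proof -
    define r where "r = 1 - q * S"
    define t where "t = 1 - z * S"
    have "r \<noteq> 0" "t \<noteq> 0" "q * S - 1 = - r" using nz by (auto simp: r_def t_def)
    then show ?thesis
      unfolding phi' Z' r_def[symmetric] t_def[symmetric] using nz y by simp
  qed
  also have "\<dots> = - (c * q * (1 - B * q * M) * (A - z * S) / (1 - q * M) / Z) * p / S * K
       * (1 - A * q * S) * (1 - g * S) * (1 - S / (q * S * M)) * (1 - z * S * K)"
  proof -
    define r where "r = 1 - q * M"
    have "r \<noteq> 0" using nz by (auto simp: r_def)
    then show ?thesis
      unfolding e2 r_def[symmetric] using nz by simp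
  qed
  finally show ?thesis .
qed

lemma moment_identity:
  fixes q A B z e K S :: real
  assumes "q \<noteq> 0" "e \<noteq> 0" "S \<noteq> 0"
  defines "g \<equiv> z * B * q / e"
  shows "(1 - z*S^2) * ((1 - A*B*q^2*K) * ((1 - K/S) * (1 - z*K*S)) - (1 - K*e) * (1 - A*(q*K)) * (1 - g*K))
    = - K/S * (1 - A*q*S) * (1 - g*S) * (1 - S*e) * (1 - z*S*K)
      - K/S * (S - K) * (A*q - z*S) * (B*q/e - S) * (e - z*S)"
  using assms(1-3) unfolding g_def
  apply (simp add: divide_simps)
  apply algebra
  done

text \<open>A discrete integration by parts on the lattice without boundary contributions, which
  leaves a first-order recursion in k for the moments.\<close>

lemma qr_moment_step:
  fixes q z A B :: real and N :: nat
  assumes q: "0 < q" "q < 1" and z: "0 \<le> z" "z < 1" 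
  defines "L \<equiv> \<lambda>k. \<Sum>s\<le>N. qr_weight q N A B z s * aw_basis q z k (qr_X q z s)"
  shows "(1 - A * B * q ^ (k + 2)) * L (Suc k) = qr_fac q N A B z k * L k"
proof -
  define phi where "phi s = aw_basis q z k (qr_X q z s)" for s
  define K where "K = q ^ k"
  define g where "g = z * B * q ^ (N + 1)"
  \<comment> \<open>The weight without 1 - z q^(2s): that factor belongs to the lattice difference
    and is absorbed by the algebraic identity behind \<open>term_eq\<close>.\<close>
  define V where "V s = q ^ (N - s) * qpoch (A * q) q s * qpoch g q s * qpoch (B * q) q (N - s)
     * (\<Prod>i=s..<N. A - z * q ^ i) * (qpoch q q N / (qpoch q q (N - s) * qpoch q q s))
     / (qpoch (z * q ^ s) q (N + 1) * qpoch (A * B * q ^ 2) q N)" for s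
  define up where "up s = - V s * phi s / q ^ s * K * (1 - A * q * q ^ s) * (1 - g * q ^ s)
     * (1 - q ^ s / q ^ N) * (1 - z * q ^ s * K)" for s
  define dn where "dn s = V s * phi s * (K / q ^ s) * (q ^ s - K) * (A * q - z * q ^ s)
     * (B * q * q ^ N - q ^ s) * (1 / q ^ N - z * q ^ s)" for s
  have W: "qr_weight q N A B z s = V s * (1 - z * (q ^ s)\<^sup>2)" for s
    by (simp add: qr_weight_def V_def g_def power_mult power2_eq_square power_mult_distrib[symmetric]
        mult.commute[of 2])
  have q0: "q \<noteq> 0" using q by simp
  have zne: "z * q ^ m \<noteq> 1" for m
    using power_le_one_mult_less[OF q z, of m] by simp
  have phi_Suc: "aw_basis q z (Suc k) (qr_X q z s) = (1 - K / q ^ s) * (1 - z * K * q ^ s) * phi s" for s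
    using q by (simp add: phi_def aw_basis_lattice qpoch_Suc K_def mult_ac)
  have term_eq: "(1 - A * B * q ^ (k + 2)) * (qr_weight q N A B z s * aw_basis q z (Suc k) (qr_X q z s))
      - qr_fac q N A B z k * (qr_weight q N A B z s * aw_basis q z k (qr_X q z s)) = up s - dn s" for s
  proof -
    have fac: "qr_fac q N A B z k = (1 - K*(1/q^N)) * (1 - A*(q*K)) * (1 - g*K)"
      by (simp add: qr_fac_def K_def g_def power_add mult_ac)
    have k2: "A * B * q ^ (k + 2) = A*B*q^2*K"
      by (simp add: K_def power_add power2_eq_square mult_ac)
    have gq: "z * B * q / (1 / q ^ N) = g" "B * q / (1 / q ^ N) = B * q * q ^ N" "q ^ s * (1 / q ^ N) = q ^ s / q ^ N"
      by (simp_all add: g_def)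
    have comm: "a * ((v * w) * (u * p)) - f * ((v * w) * p) = v * p * (w * (a * u - f))" for a v w u p f :: real
      by algebra
    have "(1 - A * B * q ^ (k + 2)) * (qr_weight q N A B z s * aw_basis q z (Suc k) (qr_X q z s))
      - qr_fac q N A B z k * (qr_weight q N A B z s * aw_basis q z k (qr_X q z s))
      = V s * phi s * ((1 - z*(q^s)^2) * ((1 - A*B*q^2*K) * ((1 - K/q^s) * (1 - z*K*q^s))
          - (1 - K*(1/q^N)) * (1 - A*(q*K)) * (1 - g*K)))"
      unfolding W phi_Suc fac phi_def[symmetric] k2 by (rule comm)
    also have "(1 - z*(q^s)^2) * ((1 - A*B*q^2*K) * ((1 - K/q^s) * (1 - z*K*q^s))
          - (1 - K*(1/q^N)) * (1 - A*(q*K)) * (1 - g*K))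
      = - K/q^s * (1 - A*q*q^s) * (1 - g*q^s) * (1 - q^s/q^N) * (1 - z*q^s*K)
      - K/q^s * (q^s - K) * (A*q - z*q^s) * (B*q*q^N - q^s) * (1/q^N - z*q^s)"
      by (rule moment_identity[of q "1/q^N" "q^s" z A B K, unfolded gq]) (use q0 in auto)
    also have "V s * phi s * \<dots> = up s - dn s"
    proof -
      have "v * p * (- k/S * a * b * c * d - k/S * a' * b' * c' * d')
         = - v * p / S * k * a * b * c * d - v * p * (k/S) * a' * b' * c' * d'"
        for v p k S a b c d a' b' c' d' :: real
        by (simp add: right_diff_distrib)
      then show ?thesis unfolding up_def dn_def .
    qed
    finally show ?thesis .
  qed
  \<comment> \<open>The boundary terms vanish: at s = N through 1 - q^s / q^N, and at s = 0 through
    q^s - K if k = 0 and through (1; q)_k = 0 if k > 0.\<close>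
  have up_N: "up N = 0" using q by (simp add: up_def)
  have dn_0: "dn 0 = 0"
    using q by (cases k) (simp_all add: dn_def phi_def aw_basis_lattice qpoch_Suc_left K_def)
  have step: "dn (Suc s) = up s" if s: "s < N" for s
  proof -
    obtain m where N: "N = Suc (s + m)" using less_imp_Suc_add[OF s] by blast
    define S where "S = q ^ s"
    define M where "M = q ^ m"
    define c where "c = q ^ m * qpoch (A * q) q s * qpoch g q s * qpoch (B * q) q m
     * (\<Prod>i=Suc s..<N. A - z * q ^ i) * (qpoch q q N / (qpoch q q m * qpoch q q s))
     / qpoch (A * B * q ^ 2) q N"
    have NS: "q ^ N = q * S * M" by (simp add: N S_def M_def power_add)
    have "N - s = Suc m" "N - Suc s = m" using N by auto
    then have V1: "V s = c * q * (1 - B * q * M) * (A - z * S) / (1 - q * M) / qpoch (z * S) q (N + 1)"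
      and V2: "V (Suc s) = c * (1 - A * q * S) * (1 - g * S) / (1 - q * S) / qpoch (z * S * q) q (N + 1)"
      using s by (simp_all add: V_def c_def qpoch_Suc prod.atLeast_Suc_lessThan S_def M_def mult_ac)
    have Z: "qpoch (z * S * q) q (N + 1) * (1 - z * S) = qpoch (z * S) q (N + 1) * (1 - z * q * (q * S * M) * S)"
      using qpoch_shift[of "z * S" q "N + 1"] by (simp add: NS mult_ac)
    have phi: "phi (Suc s) * (1 - K / (q * S)) * (1 - z * S) = phi s * (1 - 1 / (q * S)) * (1 - z * S * K)"
      using q qpoch_shift[of "1 / (q * S)" q k] qpoch_shift[of "z * S" q k]
      by (simp add: phi_def aw_basis_lattice S_def K_def mult_ac)
    have ne: "q * S \<noteq> 1" "q * M \<noteq> 1"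
      using power_ne_1[OF q, of "Suc s"] power_ne_1[OF q, of "Suc m"] by (simp_all add: S_def M_def)
    have ne2: "z * S \<noteq> 1" "z * q * (q * S * M) * S \<noteq> 1"
      using zne[of s] zne[of "N + 1 + s"] unfolding NS[symmetric]
      by (simp_all add: S_def power_add mult_ac)
    have ne3: "qpoch (z * S) q (N + 1) \<noteq> 0"
      using zne by (auto simp: qpoch_eq_0_iff S_def mult.assoc simp flip: power_add)
    show ?thesis
      using telescope_step_identity[OF q0 _ _ ne ne2(1) ne3 ne2(2) Z phi, of c A g B] q0
      unfolding dn_def up_def V1 V2 NS by (simp add: S_def M_def)
  qed
  have "(1 - A * B * q ^ (k + 2)) * L (Suc k) - qr_fac q N A B z k * L k = (\<Sum>s\<le>N. up s - dn s)"
    unfolding L_def sum_distrib_left sum_subtractf[symmetric] term_eq ..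
  also have "\<dots> = (\<Sum>s<N. up s) + up N - (dn 0 + (\<Sum>s<N. dn (Suc s)))"
    unfolding sum_subtractf sum.atMost_shift[of dn] by (simp flip: lessThan_Suc_atMost)
  also have "(\<Sum>s<N. dn (Suc s)) = (\<Sum>s<N. up s)"
    using step by (intro sum.cong) auto
  finally show ?thesis using up_N dn_0 by simp
qed

text \<open>The recursion in \<open>k\<close> is run downwards from \<open>k = N\<close>, where only \<open>s = N\<close> contributes to the
  sum; \<open>k = 0\<close> then gives the total mass without a summation theorem.\<close>

lemma qr_moment:
  assumes q: "0 < q" "q < 1" and z: "0 \<le> z" "z < 1"
    and AB: "\<And>m. 2 \<le> m \<Longrightarrow> m \<le> N + 1 \<Longrightarrow> A * B * q ^ m \<noteq> 1"
    and A: "\<And>m. 1 \<le> m \<Longrightarrow> m \<le> N \<Longrightarrow> A * q ^ m \<noteq> 1"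
    and B: "0 < B" "z * B < 1"
    and k: "k \<le> N"
  shows "(\<Sum>s\<le>N. qr_weight q N A B z s * aw_basis q z k (qr_X q z s)) * qpoch (A * B * q ^ 2) q k
    = (\<Prod>j<k. qr_fac q N A B z j)"
  using k
proof (induction rule: inc_induct)
  case base
  have zne: "z * q ^ m \<noteq> 1" for m
    using power_le_one_mult_less[OF q z, of m] by simp
  have ne: "qpoch (z * q ^ N) q N \<noteq> 0" "z * q ^ N * q ^ N \<noteq> 1"
    using zne by (auto simp: qpoch_eq_0_iff mult.assoc simp flip: power_add)
  have ne2: "qpoch (A * B * q ^ 2) q N \<noteq> 0"
    by (rule qpoch_power_nonzero, rule AB) auto
  have "aw_basis q z N (qr_X q z s) = 0" if "s < N" for s
    using q that by (simp add: aw_basis_lattice qpoch_inverse_power_eq_0)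
  then have "(\<Sum>s\<le>N. qr_weight q N A B z s * aw_basis q z N (qr_X q z s))
    = qr_weight q N A B z N * aw_basis q z N (qr_X q z N)"
    by (simp flip: lessThan_Suc_atMost)
  also have "\<dots> * qpoch (A * B * q ^ 2) q N = (\<Prod>j<N. qr_fac q N A B z j)"
    unfolding prod_qr_fac using q ne ne2 qpoch_q_nonzero[OF q, of N]
    by (simp add: qr_weight_def aw_basis_lattice qpoch_Suc[of "z * q ^ N"])
      (simp add: power_add mult_2 mult.assoc)
  finally show ?case .
next
  case (step k)
  \<comment> \<open>Descending from k + 1 to k divides by \<open>qr_fac\<close>, so its three
    factors must be nonzero.\<close>
  have "z * B * q ^ (N + 1 + k) < 1"
    by (rule power_le_one_mult_less[OF q]) (use z B in auto)
  moreover have "q ^ N < q ^ k"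
    by (rule power_strict_decreasing) (use q step.hyps in auto)
  then have "q ^ N \<noteq> q ^ k" by (rule less_imp_neq)
  then have "q ^ k / q ^ N \<noteq> 1"
    by auto
  ultimately have fac: "qr_fac q N A B z k \<noteq> 0"
    using A[of "k + 1"] step.hyps by (auto simp: qr_fac_def)
  have "A * B * q ^ 2 * q ^ k = A * B * q ^ (k + 2)"
    by (simp add: power_add power2_eq_square mult_ac)
  then have IH: "(\<Sum>s\<le>N. qr_weight q N A B z s * aw_basis q z (Suc k) (qr_X q z s))
      * (qpoch (A * B * q ^ 2) q k * (1 - A * B * q ^ (k + 2)))
      = (\<Prod>j<k. qr_fac q N A B z j) * qr_fac q N A B z k"
    using step.IH by (simp only: qpoch_Suc prod.lessThan_Suc)
  have "qr_fac q N A B z k * ((\<Sum>s\<le>N. qr_weight q N A B z s * aw_basis q z k (qr_X q z s))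
      * qpoch (A * B * q ^ 2) q k) = qr_fac q N A B z k * (\<Prod>j<k. qr_fac q N A B z j)"
  proof -
    have "f * (y * v) = f * p" if "x * (v * t) = p * f" "t * x = f * y" for f y v p x t :: real
      using that by algebra
    then show ?thesis
      using qr_moment_step[OF q z, of A B k N] IH by blast
  qed
  then show ?case using fac by simp
qed

text \<open>An indefinite summation: the partial sums have a closed form because (1 - x)(1 - a b x)
  + (1 - a)(1 - b) x = (1 - a x)(1 - b x) with x = q^(n+1).\<close>

lemma q_vandermonde_partial_sum:
  assumes "\<And>k. qpoch q q k \<noteq> 0" "\<And>k. k \<le> n \<Longrightarrow> qpoch (a * b * q) q k \<noteq> 0"
  shows "(\<Sum>k\<le>n. qpoch a q k * qpoch b q k * q ^ k / (qpoch q q k * qpoch (a * b * q) q k))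
     = qpoch (a * q) q n * qpoch (b * q) q n / (qpoch q q n * qpoch (a * b * q) q n)"
  using assms(2)
proof (induction n)
  case 0
  show ?case by simp
next
  case (Suc n)
  define D where "D = qpoch q q n * qpoch (a * b * q) q n"
  define F where "F = qpoch (a * q) q n * qpoch (b * q) q n"
  define x where "x = (1 - q ^ Suc n)"
  define y where "y = (1 - a * b * q ^ Suc n)"
  have D: "qpoch q q (Suc n) * qpoch (a * b * q) q (Suc n) = D * (x * y)"
    by (simp add: D_def qpoch_Suc x_def y_def mult_ac)
  have nz: "D \<noteq> 0" "x * y \<noteq> 0"
    using assms(1)[of "Suc n"] Suc.prems[of "Suc n"] D by auto
  have ab: "qpoch a q (Suc n) * qpoch b q (Suc n) = F * ((1 - a) * (1 - b))"
    by (simp add: qpoch_Suc_left F_def)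
  have F: "qpoch (a * q) q (Suc n) * qpoch (b * q) q (Suc n) = F * ((1 - a * q ^ Suc n) * (1 - b * q ^ Suc n))"
    by (simp add: qpoch_Suc F_def mult_ac)
  have "F / D + F * ((1 - a) * (1 - b)) * q ^ Suc n / (D * (x * y))
      = F * (x * y + (1 - a) * (1 - b) * q ^ Suc n) / (D * (x * y))"
    using nz by (simp add: field_simps)
  also have "x * y + (1 - a) * (1 - b) * q ^ Suc n = (1 - a * q ^ Suc n) * (1 - b * q ^ Suc n)"
    by (simp add: x_def y_def algebra_simps)
  finally show ?case
    using Suc unfolding sum.atMost_Suc F ab D by (simp add: F_def D_def)
qed

text \<open>In coefficient times moment the products of \<open>qr_fac\<close> join into one that
  does not depend on k. What remains is the preceding sum with a = q^(-n) and b = A B q^(n+1), so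
  that a b q = A B q^2, and its closed form contains (q^(1-n))_n = 0.\<close>

lemma qr_mean_eq_0:
  assumes q: "0 < q" "q < 1" and z: "0 \<le> z" "z < 1"
    and AB: "\<And>m. m \<le> 2 * N + 2 \<Longrightarrow> A * B * q ^ m \<noteq> 1"
    and A: "\<And>m. 1 \<le> m \<Longrightarrow> m \<le> N \<Longrightarrow> A * q ^ m \<noteq> 1"
    and B: "0 < B" "z * B < 1"
    and n: "1 \<le> n" "n \<le> N"
  shows "(\<Sum>s\<le>N. qr_weight q N A B z s * qr_poly q N A B z n (qr_X q z s)) = 0"
proof -
  define L where "L k = (\<Sum>s\<le>N. qr_weight q N A B z s * aw_basis q z k (qr_X q z s))" for k
  define E where "E = (\<Prod>j<n. qr_fac q N A B z j) / qpoch (A * B * q ^ (n + 1)) q n"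
  have ne: "qpoch (A * B * q ^ i) q k \<noteq> 0" if "i + k \<le> 2 * N + 2" for i k
    using AB that by (auto simp: qpoch_eq_0_iff mult.assoc simp flip: power_add)
  have "(\<Sum>s\<le>N. qr_weight q N A B z s * qr_poly q N A B z n (qr_X q z s))
    = (\<Sum>k\<le>n. qr_coeff q N A B z n k * L k)"
    unfolding qr_poly_def L_def sum_distrib_left by (subst sum.swap) (simp add: mult_ac)
  also have "\<dots> = (\<Sum>k\<le>n. E * (qpoch (1 / q ^ n) q k * qpoch (A * B * q ^ (n + 1)) q k * q ^ k
      / (qpoch q q k * qpoch (1 / q ^ n * (A * B * q ^ (n + 1)) * q) q k)))"
  proof (intro sum.cong refl)
    fix k assume "k \<in> {..n}"
    then have k: "k \<le> n" by simp
    have "L k * qpoch (A * B * q ^ 2) q k = (\<Prod>j<k. qr_fac q N A B z j)"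
      unfolding L_def by (rule qr_moment[OF q z _ A B]) (use k n AB in auto)
    then have L: "L k = (\<Prod>j<k. qr_fac q N A B z j) / qpoch (A * B * q ^ 2) q k"
      using ne[of 2 k] k n by (simp add: field_simps)
    have D: "(\<Prod>m=n+1+k..<2*n+1. 1 - A * B * q ^ m)
       = qpoch (A * B * q ^ (n + 1)) q n / qpoch (A * B * q ^ (n + 1)) q k"
      using ne[of "n + 1" k] k n qpoch_mult_tail[OF k, of "A * B" q] by (simp add: field_simps)
    have E': "(\<Prod>j=k..<n. qr_fac q N A B z j) * (\<Prod>j<k. qr_fac q N A B z j) = (\<Prod>j<n. qr_fac q N A B z j)"
      unfolding lessThan_atLeast0 using k
      by (subst mult.commute, intro prod.atLeastLessThan_concat) auto
    have q2: "1 / q ^ n * (A * B * q ^ (n + 1)) * q = A * B * q\<^sup>2"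
      using q by (simp add: power2_eq_square)
    show "qr_coeff q N A B z n k * L k = E * (qpoch (1 / q ^ n) q k * qpoch (A * B * q ^ (n + 1)) q k * q ^ k
      / (qpoch q q k * qpoch (1 / q ^ n * (A * B * q ^ (n + 1)) * q) q k))"
      unfolding qr_coeff_def L E_def D q2 E'[symmetric] by (simp add: mult_ac)
  qed
  also have "\<dots> = E * (qpoch (1 / q ^ n * q) q n * qpoch (A * B * q ^ (n + 1) * q) q n
      / (qpoch q q n * qpoch (1 / q ^ n * (A * B * q ^ (n + 1)) * q) q n))"
    unfolding sum_distrib_left[symmetric]
  proof (subst q_vandermonde_partial_sum)
    show "qpoch (1 / q ^ n * (A * B * q ^ (n + 1)) * q) q k \<noteq> 0" if "k \<le> n" for k
      using ne[of 2 k] that n q by (simp add: power2_eq_square mult.assoc)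
  qed (use qpoch_q_nonzero[OF q] in auto)
  also have "qpoch (1 / q ^ n * q) q n = 0"
    using qpoch_inverse_power_eq_0[OF q(1), of "n - 1" n] n q by (cases n) simp_all
  finally show ?thesis by simp
qed

section \<open>From the recurrence relation to orthogonality\<close>

text \<open>The sum of x P_k P_m W can be expanded by the recurrence relation at k or at m. Equating
  the results expresses the sum for (k + 1, m) by sums in which one index is at most k. The
  induction starts from index 0, where the sum is the total mass or a mean.\<close>

lemma three_term_recurrence_orthogonality:
  fixes P :: "nat \<Rightarrow> 'a \<Rightarrow> real"
  assumes P0: "\<And>s. s \<in> S \<Longrightarrow> P 0 s = 1"
    and rec: "\<And>n s. n \<le> N \<Longrightarrow> s \<in> S \<Longrightarrow> x s * P n s = P (n + 1) s + b n * P n s + c n * P (n - 1) s"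
    and c0: "c 0 = 0"
    and last: "\<And>s. s \<in> S \<Longrightarrow> P (N + 1) s = 0"
    and W: "sum W S = 1"
    and mean: "\<And>n. 1 \<le> n \<Longrightarrow> n \<le> N \<Longrightarrow> (\<Sum>s\<in>S. W s * P n s) = 0"
  assumes "n \<le> N" "m \<le> N"
  shows "(\<Sum>s\<in>S. P n s * P m s * W s) = (if n = m then \<Prod>j<n. c (j + 1) else 0)"
  using assms(7,8)
proof (induction n arbitrary: m rule: less_induct)
  case (less n)
  define G where "G n m = (\<Sum>s\<in>S. P n s * P m s * W s)" for n m
  have IH: "G k m = (if k = m then \<Prod>j<k. c (j + 1) else 0)" if "k < n" "m \<le> N" for k m
    using less.IH[OF that(1)] that less.prems by (simp add: G_def)
  have shift: "(\<Sum>s\<in>S. x s * P k s * P m s * W s) = G (k + 1) m + b k * G k m + c k * G (k - 1) m"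
    if "k \<le> N" for k m
    unfolding G_def sum_distrib_left sum.distrib[symmetric]
    by (intro sum.cong refl) (simp only: rec[OF that], simp add: algebra_simps)
  have sym: "G k l = G l k" for k l
    by (simp add: G_def mult_ac)
  have "G n m = (if n = m then \<Prod>j<n. c (j + 1) else 0)"
  proof (cases n)
    case 0
    have "G n m = (\<Sum>s\<in>S. W s * P m s)"
      unfolding G_def 0 by (intro sum.cong) (simp_all add: P0)
    also have "\<dots> = (if n = m then \<Prod>j<n. c (j + 1) else 0)"
    proof (cases "m = 0")
      case True
      then show ?thesis using 0 W by (simp add: P0)
    next
      case False
      then show ?thesis using 0 mean[of m] less.prems by simp
    qed
    finally show ?thesis .
  next
    case (Suc k)
    have "G (k + 1) m + b k * G k m + c k * G (k - 1) m = G (m + 1) k + b m * G m k + c m * G (m - 1) k"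
      using shift[of k m] shift[of m k] less.prems Suc by (simp add: mult_ac)
    \<comment> \<open>For m = N the index m + 1 leaves the range of the induction hypothesis; there
      P_(N+1) = 0 on the lattice takes over.\<close>
    moreover have "G (m + 1) k = (if m + 1 = k then \<Prod>j<k. c (j + 1) else 0)"
    proof (cases "m = N")
      case True
      then show ?thesis using last less.prems Suc by (simp add: G_def)
    next
      case False
      then show ?thesis using IH[of k "m + 1"] less.prems Suc sym[of "m+1" k] by simp
    qed
    moreover have "G m k = (if k = m then \<Prod>j<k. c (j + 1) else 0)"
      using IH[of k m] Suc less.prems sym[of m k] by simp
    moreover have "c m * G (m - 1) k = (if m = Suc k then c m * (\<Prod>j<k. c (j + 1)) else 0)"
      using IH[of k "m - 1"] Suc less.prems sym[of "m-1" k] by (cases m) (auto simp: c0)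
    moreover have "c k * G (k - 1) m = (if k = Suc m then \<Prod>j<k. c (j + 1) else 0)"
      using IH[of "k - 1" m] Suc less.prems by (cases k) (auto simp: c0)
    moreover have "G k m = G m k" by (rule sym)
    ultimately show ?thesis using Suc by (auto split: if_splits)
  qed
  then show ?case by (simp add: G_def)
qed

text \<open>Every coefficient with k \<le> N contains the factor j = N, which has 1 - q^N / q^N = 0,
  and the top basis element vanishes on the lattice because (q^(-s))_(N+1) = 0.\<close>

lemma qr_poly_lattice_last:
  assumes "0 < q" "s \<le> N"
  shows "qr_poly q N A B z (N + 1) (qr_X q z s) = 0"
proof -
  have "qr_coeff q N A B z (N + 1) k * aw_basis q z k (qr_X q z s) = 0" if "k \<le> N + 1" for k
  proof (cases "k = N + 1")
    case True
    then show ?thesis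
      using assms by (simp add: aw_basis_lattice qpoch_inverse_power_eq_0 del: One_nat_def)
  next
    case False
    have "qr_fac q N A B z N = 0"
      using assms by (simp add: qr_fac_def)
    then have "(\<Prod>j=k..<N+1. qr_fac q N A B z j) = 0"
      using False that by (intro prod_zero) auto
    then show ?thesis by (simp add: qr_coeff_def)
  qed
  then show ?thesis
    unfolding qr_poly_def by (intro sum.neutral ballI) (simp del: mult_eq_0_iff)
qed

lemma qr_norm_generic:
  assumes "qpoch (A * B * q ^ (N + 2)) q N \<noteq> 0"
  shows "qr_norm q N A B z n =
    qpoch q q n * qpoch (B * q) q n * qpoch (A * q) q n * qpoch (z * B * q ^ (N + 1)) q n
     * qpoch (1 / q ^ N) q n * (\<Prod>i<n. z - A * q ^ (i + 1) / q ^ N)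
     * (qpoch (A * B * q ^ (N + 2)) q n
        / (qpoch (A * B * q ^ 2) q (2 * n) * qpoch (A * B * q ^ (n + 1)) q n))"
proof -
  have "qpoch (A * B * q ^ 2) q (2 * N) = qpoch (A * B * q ^ 2) q N * qpoch (A * B * q ^ (N + 2)) q N"
    unfolding mult_2 qpoch_add by (simp add: power_add power2_eq_square mult_ac)
  then show ?thesis
    using assms unfolding qr_norm_def by (cases "n = N") simp_all
qed

text \<open>Orthogonality by recurrence yields the norm as a product of the gamma_j, so only the
  ratio of consecutive closed forms has to be compared. \<open>M\<close> holds the factors free of A
  B, \<open>R\<close> the factors 1 - A B q^m.\<close>

lemma qr_norm_eq_prod:
  assumes q: "0 < q" "q < 1" and AB: "\<And>m. m \<le> 2 * N + 2 \<Longrightarrow> A * B * q ^ m \<noteq> 1"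
    and n: "n \<le> N"
  shows "qr_norm q N A B z n = (\<Prod>j<n. qr_gamma q N A B z (j + 1))"
proof -
  define s where "s m = 1 - A * B * q ^ m" for m
  have s: "s m \<noteq> 0" if "m \<le> 2 * N + 2" for m
    using AB[OF that] by (simp add: s_def)
  define M where "M n = (\<Prod>j<n. (1 - q ^ (j + 1)) * (1 - B * q ^ (j + 1)) * qr_fac q N A B z j
      * (z - A * q ^ (j + 1) / q ^ N))" for n
  define R where "R n = (\<Prod>j<n. s (N + 2 + j)) / ((\<Prod>j<2*n. s (2 + j)) * (\<Prod>j<n. s (n + 1 + j)))" for n
  have qp: "qpoch (A * B * q ^ i) q k = (\<Prod>j<k. s (i + j))" for i k
    by (simp add: qpoch_def s_def power_add mult_ac)
  have M: "qpoch q q n * qpoch (B * q) q n * qpoch (A * q) q n * qpoch (z * B * q ^ (N + 1)) q n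
     * qpoch (1 / q ^ N) q n * (\<Prod>i<n. z - A * q ^ (i + 1) / q ^ N) = M n"
    unfolding M_def prod.distrib prod_qr_fac by (simp add: qpoch_def mult_ac)
  have ne: "qpoch (A * B * q ^ (N + 2)) q N \<noteq> 0"
    unfolding qp using s by simp
  have "qr_norm q N A B z n = M n * R n"
    unfolding qr_norm_generic[OF ne] M R_def qp by simp
  also have "\<dots> = (\<Prod>j<n. qr_gamma q N A B z (j + 1))"
    using n
  proof (induction n)
    case 0
    show ?case by (simp add: M_def R_def)
  next
    case (Suc n)
    have A: "qr_A q N A B z n = qr_fac q N A B z n * s (n + 1) / (s (2 * n + 1) * s (2 * n + 2))"
      using s[of 1] Suc by (auto simp: qr_A_def s_def)
    have C: "qr_C q N A B z (n + 1) = (1 - q ^ (n + 1)) * (1 - B * q ^ (n + 1)) * s (N + 2 + n)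
      * (z - A * q ^ (n + 1) / q ^ N) / (s (2 * n + 2) * s (2 * n + 3))"
      by (simp add: qr_C_def s_def add_ac numeral_3_eq_3)
    have p: "(\<Prod>j<2 * Suc n. s (2 + j)) = (\<Prod>j<2*n. s (2 + j)) * (s (2 * n + 2) * s (2 * n + 3))"
      by (simp add: numeral_3_eq_3 numeral_2_eq_2)
    \<comment> \<open>Passing from n to n + 1 moves the window n+1, ..., 2n of indices to n+2, ...,
      2n+2: it loses one factor and gains two.\<close>
    have "(\<Prod>j<Suc n. s (Suc n + 1 + j)) * s (n + 1) = (\<Prod>j<Suc (Suc n). s (n + 1 + j))"
      by (simp add: prod.lessThan_Suc_shift mult.commute del: prod.lessThan_Suc)
    also have "\<dots> = (\<Prod>j<n. s (n + 1 + j)) * (s (2 * n + 1) * s (2 * n + 2))"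
      by (simp add: mult_2)
    finally have p2: "(\<Prod>j<Suc n. s (Suc n + 1 + j)) = (\<Prod>j<n. s (n + 1 + j)) * (s (2 * n + 1) * s (2 * n + 2)) / s (n + 1)"
      using s[of "n + 1"] Suc.prems by (simp add: nonzero_eq_divide_eq)
    have "R (Suc n) = R n * (s (N + 2 + n) * s (n + 1)
        / ((s (2 * n + 2) * s (2 * n + 3)) * (s (2 * n + 1) * s (2 * n + 2))))"
      unfolding R_def p p2 by (simp add: mult_ac)
    moreover have "M (Suc n) = M n * ((1 - q ^ (n + 1)) * (1 - B * q ^ (n + 1)) * qr_fac q N A B z n
      * (z - A * q ^ (n + 1) / q ^ N))"
      by (simp add: M_def)
    ultimately have "M (Suc n) * R (Suc n) = (M n * R n) * (qr_A q N A B z n * qr_C q N A B z (n + 1))"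
      unfolding A C by (simp add: mult_ac)
    then show ?case
      using Suc by (simp add: qr_gamma_def)
  qed
  finally show ?thesis .
qed

lemma qr_orthogonality_generic:
  assumes q: "0 < q" "q < 1" and z: "0 \<le> z" "z < 1"
    and AB: "\<And>m. m \<le> 2 * N + 2 \<Longrightarrow> A * B * q ^ m \<noteq> 1"
    and A: "\<And>m. 1 \<le> m \<Longrightarrow> m \<le> N \<Longrightarrow> A * q ^ m \<noteq> 1"
    and B: "0 < B" "z * B < 1"
    and nm: "n \<le> N" "m \<le> N"
  shows "(\<Sum>s\<le>N. qr_poly q N A B z n (qr_X q z s) * qr_poly q N A B z m (qr_X q z s)
      * qr_weight q N A B z s) = (if n = m then qr_norm q N A B z n else 0)"
proof -
  have "(\<Sum>s\<le>N. qr_poly q N A B z n (qr_X q z s) * qr_poly q N A B z m (qr_X q z s)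
      * qr_weight q N A B z s) = (if n = m then \<Prod>j<n. qr_gamma q N A B z (j + 1) else 0)"
  proof (rule three_term_recurrence_orthogonality[where x = "qr_X q z" and b = "qr_beta q N A B z"])
    show "qr_X q z s * qr_poly q N A B z n (qr_X q z s) = qr_poly q N A B z (n + 1) (qr_X q z s)
        + qr_beta q N A B z n * qr_poly q N A B z n (qr_X q z s)
        + qr_gamma q N A B z n * qr_poly q N A B z (n - 1) (qr_X q z s)" if "n \<le> N" for n s
      by (rule qr_poly_recurrence[OF q AB]) (use that in auto)
    show "qr_gamma q N A B z 0 = 0" by (simp add: qr_gamma_def)
    show "qr_poly q N A B z (N + 1) (qr_X q z s) = 0" if "s \<in> {..N}" for s
      using qr_poly_lattice_last q that by simp
    have "(\<Sum>s\<le>N. qr_weight q N A B z s * aw_basis q z 0 (qr_X q z s)) * qpoch (A * B * q ^ 2) q 0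
        = (\<Prod>j<0. qr_fac q N A B z j)"
      by (rule qr_moment[OF q z AB A B]) auto
    then show "(\<Sum>s\<le>N. qr_weight q N A B z s) = 1"
      by (simp add: aw_basis_def)
    show "(\<Sum>s\<le>N. qr_weight q N A B z s * qr_poly q N A B z n (qr_X q z s)) = 0"
      if "1 \<le> n" "n \<le> N" for n
      by (rule qr_mean_eq_0[OF q z AB A B that]) auto
  qed (use nm in auto)
  moreover have norm: "qr_norm q N A B z n = (\<Prod>j<n. qr_gamma q N A B z (j + 1))"
    by (rule qr_norm_eq_prod[OF q AB nm(1)])
  ultimately show ?thesis
    by (simp only: norm)
qed

section \<open>Continuity in the parameters and removal of genericity\<close>

lemma tendsto_qpoch [tendsto_intros]:
  "(f \<longlongrightarrow> x) F \<Longrightarrow> ((\<lambda>t. qpoch (f t) q k) \<longlongrightarrow> qpoch x q k) F"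
  unfolding qpoch_def by (intro tendsto_intros)

lemma tendsto_aw_basis [tendsto_intros]:
  "(fz \<longlongrightarrow> z) F \<Longrightarrow> (fX \<longlongrightarrow> X) F \<Longrightarrow>
     ((\<lambda>t. aw_basis q (fz t) k (fX t)) \<longlongrightarrow> aw_basis q z k X) F"
  unfolding aw_basis_def by (intro tendsto_intros)

lemma tendsto_qr_X [tendsto_intros]:
  "(fz \<longlongrightarrow> z) F \<Longrightarrow> ((\<lambda>t. qr_X q (fz t) s) \<longlongrightarrow> qr_X q z s) F"
  unfolding qr_X_def by (intro tendsto_intros)

text \<open>Both parameter ranges of the theorem guarantee this, but they allow \<open>A B q\<^sup>m = 1\<close> for
  \<open>m = 0\<close>, \<open>m = 1\<close> or \<open>m > 2N\<close>; such parameters are reached by continuity in \<open>B\<close>.\<close>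

definition qr_regular :: "real \<Rightarrow> nat \<Rightarrow> real \<Rightarrow> real \<Rightarrow> bool" where
  "qr_regular q N A B \<longleftrightarrow> (\<forall>m. 2 \<le> m \<longrightarrow> m \<le> 2 * N \<longrightarrow> A * B * q ^ m \<noteq> 1)"

lemma qr_regularD:
  "qr_regular q N A B \<Longrightarrow> 2 \<le> m \<Longrightarrow> m \<le> 2 * N \<Longrightarrow> 1 - A * B * q ^ m \<noteq> 0"
  by (simp add: qr_regular_def)

lemma qr_regular_qpoch:
  "qr_regular q N A B \<Longrightarrow> 2 \<le> i \<Longrightarrow> i + k \<le> 2 * N + 1 \<Longrightarrow> qpoch (A * B * q ^ i) q k \<noteq> 0"
  by (rule qpoch_power_nonzero) (auto simp: qr_regular_def)

text \<open>All three parameters may move along an arbitrary filter. B moves in the removal of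
  genericity and in the displacement of \<alpha>, A moves in the displacement of the q-Hahn
  parameter, and z moves in the final limit.\<close>

context
  fixes fA fB fz :: "'a \<Rightarrow> real" and A B z :: real and F :: "'a filter" and q :: real and N :: nat
  assumes fA: "(fA \<longlongrightarrow> A) F" and fB: "(fB \<longlongrightarrow> B) F" and fz: "(fz \<longlongrightarrow> z) F"
    and reg: "qr_regular q N A B" and N: "1 \<le> N"
begin

lemmas regular_D = qr_regularD[OF reg] and regular_qpoch = qr_regular_qpoch[OF reg]

lemma tendsto_qr_fac: "((\<lambda>t. qr_fac q N (fA t) (fB t) (fz t) j) \<longlongrightarrow> qr_fac q N A B z j) F"
  unfolding qr_fac_def by (intro tendsto_intros fA fB fz)

lemma tendsto_qr_poly:
  assumes "n \<le> N" and fX: "(fX \<longlongrightarrow> X) F"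
  shows "((\<lambda>t. qr_poly q N (fA t) (fB t) (fz t) n (fX t)) \<longlongrightarrow> qr_poly q N A B z n X) F"
  unfolding qr_poly_def qr_coeff_def divide_inverse
proof (intro tendsto_intros tendsto_qr_fac fA fB fz fX)
  fix k assume k: "k \<in> {..n}"
  have "1 - A * B * q ^ m \<noteq> 0" if "m \<in> {n+1+k..<2*n+1}" for m
    by (rule regular_D) (use k that assms(1) in auto)
  then show "(\<Prod>m=n+1+k..<2*n+1. 1 - A * B * q ^ m) \<noteq> 0"
    by simp
qed

lemma tendsto_qr_A:
  assumes "n < N"
  shows "((\<lambda>t. qr_A q N (fA t) (fB t) (fz t) n) \<longlongrightarrow> qr_A q N A B z n) F"
proof (cases "n = 0")
  case True
  then show ?thesis
    unfolding qr_A_def using regular_D[of 2] N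
    by (auto simp: power2_eq_square intro!: tendsto_eq_intros tendsto_qr_fac fA fB fz)
next
  case False
  then have "1 - A * B * q ^ (2 * n + 1) \<noteq> 0" "1 - A * B * q ^ (2 * n + 2) \<noteq> 0"
    using assms by (intro regular_D; simp)+
  with False show ?thesis
    unfolding qr_A_def by (simp only: if_False) (intro tendsto_intros tendsto_qr_fac fA fB fz)
qed

text \<open>At n = 0 the factor 1 - q^n makes this the zero function, so a vanishing 1 - A B does no
  harm.\<close>

lemma tendsto_qr_C:
  assumes "n < N"
  shows "((\<lambda>t. qr_C q N (fA t) (fB t) (fz t) n) \<longlongrightarrow> qr_C q N A B z n) F"
proof (cases "n = 0")
  case False
  then have "1 - A * B * q ^ (2 * n) \<noteq> 0" "1 - A * B * q ^ (2 * n + 1) \<noteq> 0"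
    using assms by (intro regular_D; simp)+
  then show ?thesis
    unfolding qr_C_def divide_inverse[of _ "q ^ N"]
    by (intro tendsto_intros fA fB fz) simp
qed simp

lemma tendsto_qr_beta:
  assumes "n < N"
  shows "((\<lambda>t. qr_beta q N (fA t) (fB t) (fz t) n) \<longlongrightarrow> qr_beta q N A B z n) F"
  unfolding qr_beta_def by (intro tendsto_intros tendsto_qr_A tendsto_qr_C fz assms)

lemma tendsto_qr_gamma:
  assumes "n < N"
  shows "((\<lambda>t. qr_gamma q N (fA t) (fB t) (fz t) n) \<longlongrightarrow> qr_gamma q N A B z n) F"
  unfolding qr_gamma_def using assms by (intro tendsto_intros tendsto_qr_A tendsto_qr_C) auto

lemma tendsto_qr_norm:
  assumes "n \<le> N"
  shows "((\<lambda>t. qr_norm q N (fA t) (fB t) (fz t) n) \<longlongrightarrow> qr_norm q N A B z n) F"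
proof -
  have ne: "qpoch (A * B * q ^ (n + 1)) q n \<noteq> 0"
  proof (cases "n = 0")
    case False
    then show ?thesis by (intro regular_qpoch) (use assms in auto)
  qed simp
  have ratio: "((\<lambda>t. if n = N then 1 / qpoch (fA t * fB t * q ^ 2) q N
        else qpoch (fA t * fB t * q ^ (N + 2)) q n / qpoch (fA t * fB t * q ^ 2) q (2 * n))
      \<longlongrightarrow> (if n = N then 1 / qpoch (A * B * q ^ 2) q N
        else qpoch (A * B * q ^ (N + 2)) q n / qpoch (A * B * q ^ 2) q (2 * n))) F"
  proof (cases "n = N")
    case True
    have "qpoch (A * B * q ^ 2) q N \<noteq> 0" by (rule regular_qpoch) (use N in auto)
    then show ?thesis using True by (auto intro!: tendsto_intros fA fB)
  next
    case False
    have "qpoch (A * B * q ^ 2) q (2 * n) \<noteq> 0" by (rule regular_qpoch) (use False assms in auto)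
    then show ?thesis using False by (auto intro!: tendsto_intros fA fB)
  qed
  show ?thesis
    unfolding qr_norm_def divide_inverse[of _ "q ^ N"]
    by (intro tendsto_intros ratio fA fB fz ne)
qed

lemma tendsto_qr_weight:
  assumes q: "0 < q" "q < 1" and z: "0 \<le> z" "z < 1"
  shows "((\<lambda>t. qr_weight q N (fA t) (fB t) (fz t) s) \<longlongrightarrow> qr_weight q N A B z s) F"
proof -
  have "qpoch (A * B * q ^ 2) q N \<noteq> 0" by (rule regular_qpoch) (use N in auto)
  moreover have "z * q ^ m \<noteq> 1" for m
    using power_le_one_mult_less[OF q z, of m] by simp
  then have "qpoch (z * q ^ s) q (N + 1) \<noteq> 0"
    by (intro qpoch_power_nonzero)
  ultimately show ?thesis
    unfolding qr_weight_def by (intro tendsto_intros fA fB fz) auto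
qed

end

lemma eventually_AB_generic:
  fixes A B q :: real
  assumes "0 < q" "A \<noteq> 0"
  shows "\<forall>\<^sub>F t in at B. \<forall>m\<in>{..M::nat}. A * t * q ^ m \<noteq> 1"
proof (rule eventually_ball_finite, simp, intro ballI)
  fix m :: nat
  have "\<forall>\<^sub>F t in at B. t \<noteq> 1 / (A * q ^ m)"
    by (rule eventually_neq_at_within)
  then show "\<forall>\<^sub>F t in at B. A * t * q ^ m \<noteq> 1"
    by (rule eventually_mono) (use assms in \<open>auto simp: field_simps\<close>)
qed

text \<open>Both sides are continuous in B at a regular value. They agree at all other points near
  B, because A \<noteq> 0 leaves finitely many values t with A t q^m = 1 for the relevant m.\<close>

theorem qr_orthogonality:
  assumes q: "0 < q" "q < 1" and N: "1 \<le> N" and z: "0 \<le> z" "z < 1"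
    and reg: "qr_regular q N A B"
    and A: "A \<noteq> 0" "\<And>m. 1 \<le> m \<Longrightarrow> m \<le> N \<Longrightarrow> A * q ^ m \<noteq> 1"
    and B: "0 < B" "z * B < 1"
    and nm: "n \<le> N" "m \<le> N"
  shows "(\<Sum>s\<le>N. qr_poly q N A B z n (qr_X q z s) * qr_poly q N A B z m (qr_X q z s)
      * qr_weight q N A B z s) = (if n = m then qr_norm q N A B z n else 0)"
proof -
  have B': "((\<lambda>t. t) \<longlongrightarrow> B) (at B)" by (rule tendsto_ident_at)
  note c = tendsto_const[of A "at B"] B' tendsto_const[of z "at B"] reg N
  define S where "S B = (\<Sum>s\<le>N. qr_poly q N A B z n (qr_X q z s) * qr_poly q N A B z m (qr_X q z s)
      * qr_weight q N A B z s)" for B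
  define D where "D B = (if n = m then qr_norm q N A B z n else 0)" for B
  have S: "(S \<longlongrightarrow> S B) (at B)"
    unfolding S_def
    by (intro tendsto_intros tendsto_qr_poly[OF c] tendsto_qr_weight[OF c] nm q z)
  have D: "(D \<longlongrightarrow> D B) (at B)"
    unfolding D_def using tendsto_qr_norm[OF c nm(1)] by (cases "n = m") simp_all
  have "\<forall>\<^sub>F t in at B. 0 < t"
    using B' B(1) by (rule order_tendstoD)
  moreover have "((\<lambda>t. z * t) \<longlongrightarrow> z * B) (at B)"
    by (intro tendsto_intros)
  then have "\<forall>\<^sub>F t in at B. z * t < 1"
    using B(2) by (rule order_tendstoD)
  ultimately have "\<forall>\<^sub>F t in at B. S t = D t"
    using eventually_AB_generic[OF q(1) A(1), where B = B and M = "2 * N + 2"]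
  proof eventually_elim
    case (elim t)
    show ?case
      unfolding S_def D_def
      by (rule qr_orthogonality_generic[OF q z _ A(2) elim(1,2) nm]) (use elim in auto)
  qed
  then have "(D \<longlongrightarrow> S B) (at B)"
    using S by (simp add: tendsto_cong)
  then have "S B = D B"
    using D by (intro tendsto_unique) (auto simp: trivial_limit_at)
  then show ?thesis by (simp add: S_def D_def)
qed

theorem qr_poly_recurrence_regular:
  assumes q: "0 < q" "q < 1" and N: "1 \<le> N" and reg: "qr_regular q N A B" and A: "A \<noteq> 0"
    and n: "n < N"
  shows "X * qr_poly q N A B z n X = qr_poly q N A B z (n + 1) X
           + qr_beta q N A B z n * qr_poly q N A B z n X
           + qr_gamma q N A B z n * qr_poly q N A B z (n - 1) X"
proof -
  have B': "((\<lambda>t. t) \<longlongrightarrow> B) (at B)" by (rule tendsto_ident_at)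
  note c = tendsto_const[of A "at B"] B' tendsto_const[of z "at B"] reg N
  define S where "S B = X * qr_poly q N A B z n X" for B
  define D where "D B = qr_poly q N A B z (n + 1) X
           + qr_beta q N A B z n * qr_poly q N A B z n X
           + qr_gamma q N A B z n * qr_poly q N A B z (n - 1) X" for B
  have S: "(S \<longlongrightarrow> S B) (at B)"
    unfolding S_def using n by (intro tendsto_intros tendsto_qr_poly[OF c]) auto
  have D: "(D \<longlongrightarrow> D B) (at B)"
    unfolding D_def using n
    by (intro tendsto_intros tendsto_qr_poly[OF c] tendsto_qr_beta[OF c] tendsto_qr_gamma[OF c]) auto
  have "\<forall>\<^sub>F t in at B. S t = D t"
    using eventually_AB_generic[OF q(1) A(1), where B = B and M = "2 * n + 2"]
  proof eventually_elim
    case (elim t)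
    show ?case
      unfolding S_def D_def
      by (rule qr_poly_recurrence[OF q]) (use elim in auto)
  qed
  then have "(D \<longlongrightarrow> S B) (at B)"
    using S by (simp add: tendsto_cong)
  then have "S B = D B"
    using D by (intro tendsto_unique) (auto simp: trivial_limit_at)
  then show ?thesis by (simp add: S_def D_def)
qed

section \<open>Closed forms of the q-Racah and q-Hahn quantities\<close>

text \<open>Up to k = n \<le> N the lower parameter q^(-N) produces no zero, so the prefactor can be
  divided into the terms; beyond n the factor (q^(-n))_k annihilates the term whatever its
  denominator is.\<close>

lemma qr_poly_eq_series:
  assumes q: "0 < q" "q < 1" and n: "n \<le> N"
    and ne: "qpoch (A * q) q n \<noteq> 0" "qpoch (z * B * q ^ (N + 1)) q n \<noteq> 0"
      "qpoch (A * B * q ^ (n + 1)) q n \<noteq> 0"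
  shows "qr_poly q N A B z n (qr_X q z s) =
    qpoch (1 / q ^ N) q n * qpoch (A * q) q n * qpoch (z * B * q ^ (N + 1)) q n
      / qpoch (A * B * q ^ (n + 1)) q n
    * (\<Sum>k. qpoch (1 / q ^ n) q k * qpoch (A * B * q ^ (n + 1)) q k * qpoch (1 / q ^ s) q k
          * qpoch (z * q ^ s) q k
        / (qpoch q q k * (qpoch (1 / q ^ N) q k * qpoch (A * q) q k * qpoch (z * B * q ^ (N + 1)) q k))
        * q ^ k)"
proof -
  define E where "E k = qpoch (1 / q ^ N) q k * qpoch (A * q) q k * qpoch (z * B * q ^ (N + 1)) q k" for k
  define G where "G k = qpoch (A * B * q ^ (n + 1)) q k" for k
  define T where "T k = qpoch (1 / q ^ n) q k * G k * qpoch (1 / q ^ s) q k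
          * qpoch (z * q ^ s) q k / (qpoch q q k * E k) * q ^ k" for k
  have mono: "qpoch x q k \<noteq> 0" if "qpoch x q n \<noteq> 0" "k \<le> n" for x k
    using that by (auto simp: qpoch_eq_0_iff)
  have "qpoch (1 / q ^ N) q n \<noteq> 0"
  proof -
    have "1 / q ^ N * q ^ i \<noteq> 1" if "i < n" for i
    proof -
      have "q ^ N < q ^ i"
        by (rule power_strict_decreasing) (use q n that in auto)
      then have "1 < 1 / q ^ N * q ^ i"
        using q by (simp add: less_divide_eq_1_pos)
      then show ?thesis by linarith
    qed
    then show ?thesis unfolding qpoch_eq_0_iff by blast
  qed
  then have E: "E k \<noteq> 0" if "k \<le> n" for k
    unfolding E_def using mono ne that by simp
  have G: "G k \<noteq> 0" if "k \<le> n" for k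
    unfolding G_def using mono ne that by simp
  have "(\<Sum>k. T k) = (\<Sum>k\<le>n. T k)"
    by (rule suminf_finite) (use q in \<open>auto simp: T_def qpoch_inverse_power_eq_0\<close>)
  also have "E n / G n * \<dots> = qr_poly q N A B z n (qr_X q z s)"
    unfolding qr_poly_def sum_distrib_left
  proof (intro sum.cong refl)
    fix k assume "k \<in> {..n}"
    then have k: "k \<le> n" by simp
    have "(\<Prod>j<k. qr_fac q N A B z j) * (\<Prod>j=k..<n. qr_fac q N A B z j) = (\<Prod>j<n. qr_fac q N A B z j)"
      unfolding lessThan_atLeast0 by (rule prod.atLeastLessThan_concat) (use k in auto)
    then have 1: "(\<Prod>j=k..<n. qr_fac q N A B z j) = E n / E k"
      using E[OF k] unfolding prod_qr_fac E_def[symmetric] by (simp add: field_simps)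
    have 2: "(\<Prod>m=n+1+k..<2*n+1. 1 - A * B * q ^ m) = G n / G k"
      using qpoch_mult_tail[OF k, of "A * B" q] G[OF k] by (simp add: G_def field_simps)
    show "E n / G n * T k = qr_coeff q N A B z n k * aw_basis q z k (qr_X q z s)"
      unfolding qr_coeff_def 1 2 using q by (simp add: T_def aw_basis_lattice mult_ac)
  qed
  finally show ?thesis
    by (simp add: T_def E_def G_def)
qed

lemma kappa_nonzero:
  assumes "0 < q" "q < 1"
  shows "kappa q \<noteq> 0"
proof -
  have "q powr (1/2) < q powr (-1/2)"
    using assms by (intro powr_less_mono') auto
  then show ?thesis by (simp add: kappa_def)
qed

lemma scale_C_racah_u:
  assumes q: "0 < q" "q < 1" and n: "n \<le> N"
    and A: "A = q powr \<beta>" and B: "B = q powr \<alpha>" and z: "z = q powr (2 * a + 1)"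
    and ne: "qpoch (A * q) q n \<noteq> 0" "qpoch (z * B * q ^ (N + 1)) q n \<noteq> 0"
      "qpoch (A * B * q ^ (n + 1)) q n \<noteq> 0"
  shows "scale_C q a n * racah_u q a (a + real N + 1) \<alpha> \<beta> n (real s + a)
    = qr_poly q N A B z n (qr_X q z s)"
proof -
  have k: "kappa q \<noteq> 0" by (rule kappa_nonzero[OF q])
  have p: "q powr real m = q ^ m" for m using q by (simp add: powr_realpow)
  have p1: "q powr (- real n) = 1 / q ^ n"
    using q by (simp add: powr_minus p inverse_eq_divide)
  have "\<alpha> + \<beta> + real n + 1 = \<beta> + \<alpha> + real (n + 1)" by simp
  then have p2: "q powr (\<alpha> + \<beta> + real n + 1) = A * B * q ^ (n + 1)"
    by (simp only: powr_add A B p)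
  have p3: "q powr (a - (real s + a)) = 1 / q ^ s"
    using q by (simp add: powr_minus p inverse_eq_divide)
  have "a + (real s + a) + 1 = (2 * a + 1) + real s" by simp
  then have p4: "q powr (a + (real s + a) + 1) = z * q ^ s"
    by (simp only: powr_add[of q "2 * a + 1"] z p)
  have p5: "q powr (a - (a + real N + 1) + 1) = 1 / q ^ N"
    using q by (simp add: powr_minus p inverse_eq_divide)
  have p6: "q powr (\<beta> + 1) = A * q"
    using q by (simp add: powr_add A)
  have "a + (a + real N + 1) + \<alpha> + 1 = (2 * a + 1) + \<alpha> + real (N + 1)" by simp
  then have p7: "q powr (a + (a + real N + 1) + \<alpha> + 1) = z * B * q ^ (N + 1)"
    by (simp only: powr_add[of q "2 * a + 1 + \<alpha>"] powr_add[of q "2 * a + 1"] z B p)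
  have c: "scale_C q a n * q powr (- (real n / 2 * (2 * a + 1))) / kappa q ^ (2 * n) = 1"
    using q k by (simp add: scale_C_def powr_minus field_simps)
  have "scale_C q a n * racah_u q a (a + real N + 1) \<alpha> \<beta> n (real s + a)
    = (scale_C q a n * q powr (- (real n / 2 * (2 * a + 1))) / kappa q ^ (2 * n))
      * qr_poly q N A B z n (qr_X q z s)"
    unfolding racah_u_def qhyp_def qpochs_def p1 p2 p3 p4 p5 p6 p7
      qr_poly_eq_series[OF q n ne]
    by (simp add: mult_ac)
  then show ?thesis unfolding c by simp
qed

text \<open>At z = 0 the parameters z q^s and z B q^(N+1) become 0, and (0; q)_k = 1 reduces the
  4phi3 to a 3phi2.\<close>

lemma hahn_h_eq_qr_poly:
  assumes q: "0 < q" "q < 1" and n: "n \<le> N"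
    and ne: "qpoch (A * q) q n \<noteq> 0" "qpoch (A * B * q ^ (n + 1)) q n \<noteq> 0"
  shows "hahn_h q A B N n (hahn_x q (real s)) = qr_poly q N A B 0 n (qr_X q 0 s)"
proof -
  have p: "q powr (- real m) = 1 / q ^ m" for m
    using q by (simp add: powr_minus powr_realpow inverse_eq_divide)
  have 0: "qpoch 0 q k = 1" for k by (simp add: qpoch_def)
  show ?thesis
    unfolding hahn_h_def hahn_x_def qhyp_def qpochs_def p
    by (subst qr_poly_eq_series[OF q n]) (use ne in \<open>simp_all add: 0 mult_ac\<close>)
qed

section \<open>The q-Gamma function and the weight\<close>

lemma convergent_prod_qpoch:
  fixes x q :: real
  assumes "0 < q" "q < 1"
  shows "convergent_prod (\<lambda>i. 1 - x * q ^ i)"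
proof -
  have "summable (\<lambda>i. norm (1 - x * q ^ i - 1))"
    using assms by (auto simp: abs_mult intro!: summable_mult summable_geometric)
  then show ?thesis
    by (intro abs_convergent_prod_imp_convergent_prod summable_imp_abs_convergent_prod)
qed

lemma qpoch_inf_nonzero:
  assumes "0 < q" "q < 1" "\<And>i. x * q ^ i \<noteq> 1"
  shows "qpoch_inf x q \<noteq> 0"
  unfolding qpoch_inf_def
  by (rule prodinf_nonzero) (use assms convergent_prod_qpoch in auto)

lemma qpoch_inf_rec:
  assumes "0 < q" "q < 1" "x \<noteq> 1"
  shows "qpoch_inf x q = (1 - x) * qpoch_inf (x * q) q"
proof -
  have "(\<Prod>i. 1 - x * q ^ Suc i) = (\<Prod>i. 1 - x * q ^ i) / (1 - x * q ^ 0)"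
    by (rule prodinf_split_head) (use assms convergent_prod_qpoch in auto)
  then show ?thesis
    using assms by (simp add: qpoch_inf_def mult.assoc)
qed

lemma qnum_eq:
  assumes "0 < q" "q < 1"
  shows "qnum q x = q powr ((1 - x) / 2) * (1 - q powr x) / (1 - q)"
proof -
  have 1: "q powr (x/2) - q powr (-x/2) = - (q powr (-x/2) * (1 - q powr x))" for x
    by (simp add: right_diff_distrib powr_add[symmetric])
  have "q powr (1/2) * q powr (-x/2) = q powr ((1 - x) / 2)"
    by (simp add: powr_add[symmetric] diff_divide_distrib)
  moreover have "q powr (-1/2) = 1 / q powr (1/2)"
    using powr_minus_divide[of q "1/2"] by simp
  ultimately show ?thesis
    unfolding qnum_def 1[of x] using 1[of 1] assms by (simp add: mult_ac)
qed

text \<open>Says that x is not a pole of \<open>qGamma\<close>, in the form in which the infinite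
  product needs it.\<close>

definition qGamma_regular :: "real \<Rightarrow> real \<Rightarrow> bool" where
  "qGamma_regular q x \<longleftrightarrow> (\<forall>i::nat. q powr x * q ^ i \<noteq> 1)"

lemma qGamma_regular_Suc:
  assumes "0 < q" "qGamma_regular q x"
  shows "qGamma_regular q (x + 1)"
  unfolding qGamma_regular_def
proof
  fix i
  have "q powr x * q ^ Suc i \<noteq> 1" using assms(2) unfolding qGamma_regular_def by blast
  then show "q powr (x + 1) * q ^ i \<noteq> 1"
    using assms(1) by (simp add: powr_add mult_ac)
qed

lemma qGamma_nonzero:
  assumes "0 < q" "q < 1" "qGamma_regular q x"
  shows "qGamma q x \<noteq> 0"
proof -
  have "q * q ^ i \<noteq> 1" for i using power_ne_1[OF assms(1,2), of "Suc i"] by simp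
  then have "qpoch_inf q q \<noteq> 0" by (intro qpoch_inf_nonzero assms)
  moreover have "qpoch_inf (q powr x) q \<noteq> 0"
    by (rule qpoch_inf_nonzero) (use assms in \<open>auto simp: qGamma_regular_def\<close>)
  ultimately show ?thesis
    using assms by (simp add: qGamma_def)
qed

lemma qGamma_Suc:
  assumes q: "0 < q" "q < 1" and x: "qGamma_regular q x"
  shows "qGamma q (x + 1) = qnum q x * qGamma q x"
proof -
  have x0: "q powr x \<noteq> 1" using x unfolding qGamma_regular_def by (metis mult.right_neutral power_0)
  have 1: "q powr (x + 1) = q powr x * q" using q by (simp add: powr_add)
  have "(x + 1 - 1) * (x + 1 - 2) / 4 = (x - 1) * (x - 2) / 4 - (1 - x) / 2"
    by (simp add: field_simps)
  then have "- ((x + 1 - 1) * (x + 1 - 2) / 4) = - ((x - 1) * (x - 2) / 4) + (1 - x) / 2"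
    by linarith
  then have 2: "q powr (- ((x + 1 - 1) * (x + 1 - 2) / 4))
      = q powr (- ((x - 1) * (x - 2) / 4)) * q powr ((1 - x) / 2)"
    by (simp only: powr_add)
  have 3: "(1 - q) powr (1 - (x + 1)) = (1 - q) powr (1 - x) / (1 - q)"
    using q powr_diff[of "1 - q" "1 - x" 1] by simp
  show ?thesis
    unfolding qGamma_def 1 2 3 qnum_eq[OF q] qpoch_inf_rec[OF q x0] using x0 by simp
qed

lemma qGamma_add_nat:
  assumes q: "0 < q" "q < 1" and x: "qGamma_regular q x"
  shows "qGamma q (x + real k) = (\<Prod>i<k. qnum q (x + real i)) * qGamma q x \<and> qGamma_regular q (x + real k)"
proof (induction k)
  case (Suc k)
  have "x + real (Suc k) = (x + real k) + 1" by simp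
  then show ?case
    using Suc qGamma_Suc[OF q, of "x + real k"] qGamma_regular_Suc[OF q(1), of "x + real k"]
    by (simp only: prod.lessThan_Suc mult_ac)
qed (use x in simp)

text \<open>The poles are integers, and y + t is not an integer for small t \<noteq> 0, even if y
  is.\<close>

lemma eventually_qGamma_regular:
  assumes "0 < q" "q < 1"
  shows "\<forall>\<^sub>F t in at 0. qGamma_regular q (y + t)"
proof -
  have "\<exists>d>0. \<forall>t. t \<noteq> 0 \<and> dist t 0 < d \<longrightarrow> y + t \<notin> \<int>"
  proof (cases "y \<in> \<int>")
    case True
    have "y + t \<notin> \<int>" if "t \<noteq> 0" "dist t 0 < 1" for t
    proof
      assume "y + t \<in> \<int>"
      then have "t \<in> \<int>" using Ints_diff[OF _ True, of "y + t"] by simp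
      then show False using that Ints_nonzero_abs_less1 by auto
    qed
    then show ?thesis by (intro exI[of _ 1]) auto
  next
    case False
    define f where "f = floor y"
    have f: "real_of_int f < y" "y < real_of_int f + 1"
      using False Ints_of_int[of f] unfolding f_def by (auto simp: less_le) linarith
    show ?thesis
    proof (intro exI[of _ "min (y - f) (f + 1 - y)"] conjI allI impI notI)
      fix t assume t: "t \<noteq> 0 \<and> dist t 0 < min (y - f) (f + 1 - y)" "y + t \<in> \<int>"
      then obtain m where m: "y + t = real_of_int m" by (auto elim: Ints_cases)
      from t have "real_of_int f < real_of_int m" "real_of_int m < real_of_int f + 1"
        unfolding m[symmetric] by (auto simp: dist_real_def)
      then have "f < m" "m < f + 1" by linarith+
      then show False by simp
    qed (use f in auto)
  qed
  then have "\<forall>\<^sub>F t in at 0. y + t \<notin> \<int>"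
    by (simp add: eventually_at)
  then show ?thesis
  proof eventually_elim
    case (elim t)
    have "q powr (y + t) * q ^ i \<noteq> 1" for i
    proof
      assume "q powr (y + t) * q ^ i = 1"
      then have "q powr (y + t + real i) = q powr 0"
        using assms by (simp add: powr_add powr_realpow)
      then have "y + t + real i = 0"
        using assms powr_inj[of q] by simp
      then have "y + t = - real i" by simp
      then show False using elim by simp
    qed
    then show ?case by (simp add: qGamma_regular_def)
  qed
qed

lemma tendsto_qnum_prod:
  assumes "0 < q"
  shows "((\<lambda>t. \<Prod>i<k. qnum q (y + t + real i)) \<longlongrightarrow> (\<Prod>i<k. qnum q (y + real i))) (at 0)"
  unfolding qnum_def divide_inverse using assms
  by (auto intro!: tendsto_eq_intros)

text \<open>Off the poles the functional equation turns the quotient into a product of q-numbers,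
  which is continuous at t = 0; hence y itself may be a pole.\<close>

lemma qGamma_quot_up:
  assumes q: "0 < q" "q < 1" and x: "x = y + real k"
  shows "qGamma_quot q x y = (\<Prod>i<k. qnum q (y + real i))"
  unfolding qGamma_quot_def
proof (rule tendsto_Lim)
  have "\<forall>\<^sub>F t in at 0. (\<Prod>i<k. qnum q (y + t + real i)) = qGamma q (x + t) / qGamma q (y + t)"
    using eventually_qGamma_regular[OF q, of y]
  proof eventually_elim
    case (elim t)
    then show ?case
      using qGamma_add_nat[OF q elim, of k] qGamma_nonzero[OF q elim] by (simp add: x add_ac)
  qed
  then show "((\<lambda>t. qGamma q (x + t) / qGamma q (y + t)) \<longlongrightarrow> (\<Prod>i<k. qnum q (y + real i))) (at 0)"
    by (rule Lim_transform_eventually[OF tendsto_qnum_prod[OF q(1)]])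
qed simp

lemma qGamma_quot_down:
  assumes q: "0 < q" "q < 1" and x: "x = y + real k" and ne: "(\<Prod>i<k. qnum q (y + real i)) \<noteq> 0"
  shows "qGamma_quot q y x = 1 / (\<Prod>i<k. qnum q (y + real i))"
  unfolding qGamma_quot_def
proof (rule tendsto_Lim)
  have "\<forall>\<^sub>F t in at 0. 1 / (\<Prod>i<k. qnum q (y + t + real i)) = qGamma q (y + t) / qGamma q (x + t)"
    using eventually_qGamma_regular[OF q, of y]
  proof eventually_elim
    case (elim t)
    then show ?case
      using qGamma_add_nat[OF q elim, of k] qGamma_nonzero[OF q elim] by (simp add: x add_ac)
  qed
  then show "((\<lambda>t. qGamma q (y + t) / qGamma q (x + t)) \<longlongrightarrow> 1 / (\<Prod>i<k. qnum q (y + real i))) (at 0)"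
    by (rule Lim_transform_eventually[OF tendsto_divide[OF tendsto_const tendsto_qnum_prod[OF q(1)] ne]])
qed simp

text \<open>The exponent is the sum over i < k of (1 - y - i) / 2.\<close>

lemma prod_qnum:
  assumes q: "0 < q" "q < 1"
  shows "(\<Prod>i<k. qnum q (y + real i))
    = q powr (real k * (1 - y) / 2 - real k * (real k - 1) / 4) * qpoch (q powr y) q k / (1 - q) ^ k"
proof (induction k)
  case 0
  show ?case using q by simp
next
  case (Suc k)
  have 1: "qnum q (y + real k) = q powr ((1 - y - real k) / 2) * (1 - q powr y * q ^ k) / (1 - q)"
    unfolding qnum_eq[OF q] using q by (simp add: powr_add powr_realpow algebra_simps)
  have "real (Suc k) * (1 - y) / 2 - real (Suc k) * (real (Suc k) - 1) / 4
     = (real k * (1 - y) / 2 - real k * (real k - 1) / 4) + (1 - y - real k) / 2"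
    by (simp add: field_simps)
  then have 2: "q powr (real (Suc k) * (1 - y) / 2 - real (Suc k) * (real (Suc k) - 1) / 4)
     = q powr (real k * (1 - y) / 2 - real k * (real k - 1) / 4) * q powr ((1 - y - real k) / 2)"
    by (simp only: powr_add)
  show ?case
    unfolding prod.lessThan_Suc Suc.IH 1 2 qpoch_Suc by (simp add: mult_ac)
qed

text \<open>Each q-Gamma quotient is a q-factorial times a power of q over a power of 1 - q. The
  q-factorials give the weight, the powers of 1 - q cancel, and the powers of q combine to A^(N-s)
  q^(N-s).\<close>

lemma racah_rho_eq_qr_weight:
  assumes q: "0 < q" "q < 1" and s: "s \<le> N"
    and A: "A = q powr \<beta>" and B: "B = q powr \<alpha>" and z: "z = q powr (2 * a + 1)"
    and z1: "z < 1" and ne: "qpoch (A * B * q ^ 2) q N \<noteq> 0"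
  shows "racah_rho q a (a + real N + 1) \<alpha> \<beta> (real s + a) * qnum q (2 * real s + 2 * a + 1)
    = qr_weight q N A B z s"
proof -
  define m where "m = N - s"
  have N: "real N = real s + real m" "N = m + s" using s by (simp_all add: m_def)
  have A0: "0 < A" "0 < z" using q by (simp_all add: A z)
  have p: "q powr real k = q ^ k" for k using q by (simp add: powr_realpow)
  define e where "e y k = real k * (1 - y) / 2 - real k * (real k - 1) / 4" for y :: real and k :: nat
  note pq = prod_qnum[OF q, folded e_def]
  have pw: "q powr (2 * a + 1 + real s) = z * q ^ s" "q powr (\<beta> + 1) = A * q"
    "q powr (2 * a + 1 + \<alpha> + real (N + 1)) = z * B * q ^ (N + 1)" "q powr (\<alpha> + 1) = B * q"
    "q powr (\<beta> + \<alpha> + real 2) = A * B * q ^ 2"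
    "q powr (2 * a + 1 + real s - \<beta>) = z * q ^ s / A"
    "q powr (real (m + 1)) = q * q ^ m" "q powr 1 = q"
    using q by (simp_all only: powr_add powr_diff p A B z powr_one) simp
  have zne: "qpoch (z * q ^ s) q (N + 1) \<noteq> 0"
    using power_le_one_mult_less[OF q, of z] A0 z1
    by (intro qpoch_power_nonzero) (metis less_imp_le less_irrefl)
  have e_ne: "q powr x \<noteq> 0" "1 - q \<noteq> 0" for x using q by auto
  have g1: "qGamma_quot q (real s + a + a + 1) (real s + a + (a + real N + 1) + 1)
      = 1 / (q powr e (2 * a + 1 + real s) (N + 1) * qpoch (z * q ^ s) q (N + 1) / (1 - q) ^ (N + 1))"
    using qGamma_quot_down[OF q, of "real s + a + (a + real N + 1) + 1" "2 * a + 1 + real s" "N + 1"]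
      zne e_ne unfolding pq pw by (simp add: add_ac)
  have g2: "qGamma_quot q (real s + a - a + \<beta> + 1) (\<beta> + 1)
      = q powr e (\<beta> + 1) s * qpoch (A * q) q s / (1 - q) ^ s"
    using qGamma_quot_up[OF q, of "real s + a - a + \<beta> + 1" "\<beta> + 1" s] unfolding pq pw by simp
  have g3: "qGamma_quot q (real s + a + \<alpha> + (a + real N + 1) + 1) (a + (a + real N + 1) + \<alpha> + 1)
      = q powr e (2 * a + 1 + \<alpha> + real (N + 1)) s * qpoch (z * B * q ^ (N + 1)) q s / (1 - q) ^ s"
    using qGamma_quot_up[OF q, of "real s + a + \<alpha> + (a + real N + 1) + 1" "2 * a + 1 + \<alpha> + real (N + 1)" s]
    unfolding pq pw by (simp add: add_ac)
  have g4: "qGamma_quot q (a + real N + 1 + \<alpha> - (real s + a)) (\<alpha> + 1)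
      = q powr e (\<alpha> + 1) m * qpoch (B * q) q m / (1 - q) ^ m"
    using qGamma_quot_up[OF q, of "a + real N + 1 + \<alpha> - (real s + a)" "\<alpha> + 1" m]
    unfolding pq pw by (simp add: N)
  have g5: "qGamma_quot q (\<alpha> + \<beta> + 2) (a + real N + 1 - a + \<alpha> + \<beta> + 1)
      = 1 / (q powr e (\<beta> + \<alpha> + real 2) N * qpoch (A * B * q ^ 2) q N / (1 - q) ^ N)"
    using qGamma_quot_down[OF q, of "a + real N + 1 - a + \<alpha> + \<beta> + 1" "\<beta> + \<alpha> + real 2" N]
      ne e_ne unfolding pq pw by (simp add: add_ac)
  have g6: "qGamma_quot q (a + (a + real N + 1) - \<beta>) (real s + a + a - \<beta> + 1)
      = q powr e (2 * a + 1 + real s - \<beta>) m * qpoch (z * q ^ s / A) q m / (1 - q) ^ m"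
    using qGamma_quot_up[OF q, of "a + (a + real N + 1) - \<beta>" "2 * a + 1 + real s - \<beta>" m]
    unfolding pq pw by (simp add: N algebra_simps)
  have g7: "qGamma_quot q (a + real N + 1 - a) (a + real N + 1 - (real s + a))
      = q powr e (real (m + 1)) s * qpoch (q * q ^ m) q s / (1 - q) ^ s"
    using qGamma_quot_up[OF q, of "a + real N + 1 - a" "real (m + 1)" s]
    unfolding pq pw by (simp add: N algebra_simps)
  have g8: "qGamma q (real s + a - a + 1) = q powr e 1 s * qpoch q q s / (1 - q) ^ s"
  proof -
    have "q * q ^ i \<noteq> 1" for i using power_ne_1[OF q, of "Suc i"] by simp
    then have "qGamma_regular q 1" "qpoch_inf q q \<noteq> 0"
      using q by (simp_all add: qGamma_regular_def qpoch_inf_nonzero)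
    then have "qGamma q (1 + real s) = (\<Prod>i<s. qnum q (1 + real i))"
      using qGamma_add_nat[OF q, of 1 s] q by (simp add: qGamma_def)
    then show ?thesis unfolding pq pw by (simp add: add_ac)
  qed
  have g9: "qnum q (2 * real s + 2 * a + 1)
      = q powr ((1 - (2 * real s + 2 * a + 1)) / 2) * (1 - z * q ^ (2 * s)) / (1 - q)"
  proof -
    have "2 * real s + 2 * a + 1 = 2 * a + 1 + real (2 * s)" by simp
    then have "q powr (2 * real s + 2 * a + 1) = z * q ^ (2 * s)"
      by (simp only: powr_add[of q "2 * a + 1"] p z)
    then show ?thesis unfolding qnum_eq[OF q] by simp
  qed
  \<comment> \<open>The surviving A^m is what turns (z q^s / A)_m into the product over A - z q^i,
    and q^m is the leading factor of \<open>qr_weight\<close>.\<close>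
  have expo: "q powr e (\<beta> + 1) s * q powr e (2 * a + 1 + \<alpha> + real (N + 1)) s * q powr e (\<alpha> + 1) m
      * q powr e (2 * a + 1 + real s - \<beta>) m * q powr e (real (m + 1)) s
      * q powr ((1 - (2 * real s + 2 * a + 1)) / 2)
    = A ^ m * q ^ m * (q powr e (2 * a + 1 + real s) (N + 1) * q powr e (\<beta> + \<alpha> + real 2) N * q powr e 1 s)"
  proof -
    have "A ^ m = q powr (\<beta> * real m)"
      using q by (simp add: A powr_powr[symmetric] powr_realpow)
    moreover have "q ^ m = q powr real m" by (simp add: p)
    moreover have "e (\<beta> + 1) s + e (2 * a + 1 + \<alpha> + real (N + 1)) s + e (\<alpha> + 1) m
        + e (2 * a + 1 + real s - \<beta>) m + e (real (m + 1)) s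
        + ((1 - (2 * real s + 2 * a + 1)) / 2)
      = \<beta> * real m + real m + (e (2 * a + 1 + real s) (N + 1) + e (\<beta> + \<alpha> + real 2) N + e 1 s)"
      unfolding e_def N(2) by (simp add: field_simps)
    ultimately show ?thesis
      by (simp only: powr_add[symmetric])
  qed
  have P: "(\<Prod>i=s..<N. A - z * q ^ i) = A ^ m * qpoch (z * q ^ s / A) q m"
  proof -
    have "(\<Prod>i=s..<N. A - z * q ^ i) = (\<Prod>i<m. A - z * q ^ (s + i))"
      using prod.shift_bounds_nat_ivl[of "\<lambda>i. A - z * q ^ i" 0 s m]
      by (simp add: N(2) lessThan_atLeast0 add.commute)
    also have "\<dots> = (\<Prod>i<m. A * (1 - z * q ^ s / A * q ^ i))"
      using A0 by (intro prod.cong) (auto simp: field_simps power_add)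
    finally show ?thesis by (simp add: prod.distrib qpoch_def)
  qed
  have Q: "qpoch (q * q ^ m) q s = qpoch q q N / qpoch q q m"
    using qpoch_add[of q q m s] qpoch_q_nonzero[OF q, of m] by (simp add: N(2))
  define D where "D = (q powr e (2 * a + 1 + real s) (N + 1) * q powr e (\<beta> + \<alpha> + real 2) N * q powr e 1 s)"
  have D: "D \<noteq> 0" using q by (simp add: D_def)
  have qc: "(1 - q) ^ s * (1 - q) ^ s * (1 - q) ^ m * (1 - q) ^ m * (1 - q) ^ s * (1 - q)
     = (1 - q) ^ (N + 1) * (1 - q) ^ N * (1 - q) ^ s"
    by (simp add: N(2) power_add)
  have assemble: "1 / (d1 * x1 / c1) * (d2 * x2 / c2) * (d3 * x3 / c3) * (d4 * x4 / c4) * (1 / (d5 * x5 / c5))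
      * (d6 * x6 / c6) * (d7 * x7 / c7) / (d8 * x8 / c8) * (d9 * x9 / c9)
    = (x2 * x3 * x4 * x6 * x7 * x9 / (x1 * x5 * x8)) * ((d2 * d3 * d4 * d6 * d7 * d9) / (d1 * d5 * d8))
      * ((c1 * c5 * c8) / (c2 * c3 * c4 * c6 * c7 * c9))"
    for d1 x1 c1 d2 x2 c2 d3 x3 c3 d4 x4 c4 d5 x5 c5 d6 x6 c6 d7 x7 c7 d8 x8 c8 d9 x9 c9 :: real
    by (simp add: mult_ac)
  have "racah_rho q a (a + real N + 1) \<alpha> \<beta> (real s + a) * qnum q (2 * real s + 2 * a + 1)
    = (qpoch (A * q) q s * qpoch (z * B * q ^ (N + 1)) q s * qpoch (B * q) q m * qpoch (z * q ^ s / A) q m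
        * qpoch (q * q ^ m) q s * (1 - z * q ^ (2 * s))
        / (qpoch (z * q ^ s) q (N + 1) * qpoch (A * B * q ^ 2) q N * qpoch q q s))
      * (A ^ m * q ^ m * D / D)
      * (((1 - q) ^ (N + 1) * (1 - q) ^ N * (1 - q) ^ s) / ((1 - q) ^ (N + 1) * (1 - q) ^ N * (1 - q) ^ s))"
    unfolding racah_rho_def g1 g2 g3 g4 g5 g6 g7 g8 g9 assemble expo D_def[symmetric] qc by (rule refl)
  also have "\<dots> = qr_weight q N A B z s"
    unfolding qr_weight_def P Q m_def[symmetric] using D q by (simp add: mult_ac)
  finally show ?thesis .
qed

section \<open>Rescaled recurrence coefficients and norms\<close>

lemma qnum_kappa: "qnum q x = - (q powr (- x / 2) * (1 - q powr x)) / kappa q"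
  by (simp add: qnum_def kappa_def right_diff_distrib powr_add[symmetric])

lemma recurrence_scale_eq:
  assumes "0 < q"
  shows "q powr (a + 1) / racah_c1 q = q powr (a + 1/2) * kappa q ^ 2"
proof -
  have "q powr (a + 1) = q powr (a + 1/2 + 1/2)"
    by (simp add: add.assoc)
  also have "\<dots> = q powr (a + 1/2) * q powr (1/2)"
    by (rule powr_add)
  finally have "q powr (a + 1) = q powr (a + 1/2) * q powr (1/2)" .
  then show ?thesis using assms by (simp add: racah_c1_def)
qed

lemma qnum_prod_2:
  assumes "0 < q" "q < 1" "2 * c = x1 + x2"
  shows "q powr c * kappa q ^ 2 * (qnum q x1 * qnum q x2) = (1 - q powr x1) * (1 - q powr x2)"
proof -
  have "q powr c * (q powr (- x1 / 2) * q powr (- x2 / 2)) = q powr (c + - x1 / 2 + - x2 / 2)"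
    by (simp only: powr_add mult.assoc)
  also have "c + - x1 / 2 + - x2 / 2 = 0"
    using assms(3) by (simp add: field_simps)
  finally have *: "q powr c * (q powr (- x1 / 2) * q powr (- x2 / 2)) = 1"
    using assms(1) by simp
  have "q powr c * kappa q ^ 2 * (qnum q x1 * qnum q x2)
     = (q powr c * (q powr (- x1 / 2) * q powr (- x2 / 2))) * ((1 - q powr x1) * (1 - q powr x2))"
    unfolding qnum_kappa using kappa_nonzero[OF assms(1,2)] by (simp add: power2_eq_square)
  then show ?thesis unfolding * by simp
qed

text \<open>Used with c = a + 1/2. For the part \<open>qr_A\<close> the powers of q balance and d =
  0. For the part \<open>qr_C\<close> a factor q^d = z with d = 2a + 1 is left, and it clears the
  1/z in q^(-a-b+\<beta>+n).\<close>

lemma qnum_prod_4_2: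
  assumes "0 < q" "q < 1" "2 * (c - d) = x1 + x2 + x3 + x4 - y1 - y2"
  shows "q powr c * kappa q ^ 2 * (qnum q x1 * qnum q x2 * qnum q x3 * qnum q x4 / (qnum q y1 * qnum q y2))
    = q powr d * ((1 - q powr x1) * (1 - q powr x2) * (1 - q powr x3) * (1 - q powr x4)
      / ((1 - q powr y1) * (1 - q powr y2)))"
proof -
  have "q powr c * (q powr (- x1 / 2) * q powr (- x2 / 2) * q powr (- x3 / 2) * q powr (- x4 / 2))
    = q powr (c + (- x1 / 2 + - x2 / 2 + - x3 / 2 + - x4 / 2))"
    by (simp only: powr_add)
  also have "c + (- x1 / 2 + - x2 / 2 + - x3 / 2 + - x4 / 2) = d + (- y1 / 2 + - y2 / 2)"
    using assms(3) by (simp add: field_simps)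
  finally have *: "q powr c * (q powr (- x1 / 2) * q powr (- x2 / 2) * q powr (- x3 / 2) * q powr (- x4 / 2))
    = q powr d * (q powr (- y1 / 2) * q powr (- y2 / 2))"
    by (simp only: powr_add)
  have "q powr c * kappa q ^ 2 * (qnum q x1 * qnum q x2 * qnum q x3 * qnum q x4 / (qnum q y1 * qnum q y2))
    = (q powr c * (q powr (- x1 / 2) * q powr (- x2 / 2) * q powr (- x3 / 2) * q powr (- x4 / 2)))
      / (q powr (- y1 / 2) * q powr (- y2 / 2))
      * ((1 - q powr x1) * (1 - q powr x2) * (1 - q powr x3) * (1 - q powr x4)
      / ((1 - q powr y1) * (1 - q powr y2)))"
    unfolding qnum_kappa using kappa_nonzero[OF assms(1,2)] by (simp add: power2_eq_square mult_ac)
  then show ?thesis unfolding * using assms(1) by simp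
qed

locale racah_params =
  fixes q a z A B \<alpha> \<beta> :: real and N :: nat
  assumes q: "0 < q" "q < 1" and N: "1 \<le> N"
    and A: "A = q powr \<beta>" and B: "B = q powr \<alpha>" and z: "z = q powr (2 * a + 1)"
begin

abbreviation "E \<equiv> q powr (a + 1) / racah_c1 q"

lemma E_eq: "E = q powr (a + 1/2) * kappa q ^ 2"
  by (rule recurrence_scale_eq[OF q(1)])

lemma E_nonzero: "E \<noteq> 0"
  unfolding E_eq using q kappa_nonzero[OF q] by simp

lemma E2: "E\<^sup>2 \<noteq> 0"
  using E_nonzero by (rule power_not_zero)

lemma powr_nat: "q powr real k = q ^ k"
  using q by (simp add: powr_realpow)

lemma pos: "0 < A" "0 < B" "0 < z"
  using q by (simp_all add: A B z)

lemma E_mult_racah_mu: "E * racah_mu q (real s + a) = qr_X q z s - (1 + q) * q powr a"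
proof -
  have "q powr (a + 1/2) = q powr (- real s) * q powr (real s + a + 1/2)"
    by (simp add: powr_add[symmetric])
  then have "E * racah_mu q (real s + a) = q powr (- real s)
      * (q powr (real s + a + 1/2) * kappa q ^ 2 * (qnum q (real s + a) * qnum q (real s + a + 1)))"
    unfolding E_eq racah_mu_def by simp
  also have "\<dots> = q powr (- real s) * ((1 - q powr (real s + a)) * (1 - q powr (real s + a + 1)))"
    by (subst qnum_prod_2[OF q]) auto
  also have "q powr (- real s) = 1 / q ^ s"
    using q by (simp add: powr_minus powr_nat inverse_eq_divide)
  also have "q powr (real s + a) = q ^ s * q powr a"
    by (simp add: powr_add powr_nat)
  also have "q powr (real s + a + 1) = q ^ s * q powr a * q"
    using q by (simp add: powr_add powr_nat)
  also have "1 / q ^ s * ((1 - q ^ s * q powr a) * (1 - q ^ s * q powr a * q))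
     = 1 / q ^ s + (q powr a * (q powr a * q)) * q ^ s - (1 + q) * q powr a"
    using q by (simp add: field_simps)
  also have "q powr a * (q powr a * q) = z"
  proof -
    have "2 * a + 1 = a + (a + 1)" by simp
    then show ?thesis using q unfolding z by (simp only: powr_add powr_one)
  qed
  finally show ?thesis by (simp add: qr_X_def)
qed

text \<open>At n = 0 the raw formula contains (1 - A B q) / (1 - A B q), which is 1 only away from A
  B q = 1.\<close>

lemma E_mult_beta_raw:
  assumes "n \<noteq> 0 \<or> A * B * q \<noteq> 1"
  shows "E * racah_beta_raw q a (a + real N + 1) \<alpha> \<beta> n = qr_beta q N A B z n - (1 + q) * q powr a"
proof -
  \<comment> \<open>The leading term [a][a+1] of beta_n is mu at s = 0, where X = 1 + z; it brings
    in the same shift as on the lattice.\<close>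
  have mu: "E * (qnum q a * qnum q (a + 1)) = 1 + z - (1 + q) * q powr a"
    using E_mult_racah_mu[of 0] by (simp add: racah_mu_def qr_X_def)
  have pw: "q powr (\<alpha> + \<beta> + real n + 1) = A * B * q ^ (n + 1)"
    "q powr (a - (a + real N + 1) + real n + 1) = q ^ n / q ^ N"
    "q powr (\<beta> + real n + 1) = A * q ^ (n + 1)"
    "q powr (a + (a + real N + 1) + \<alpha> + real n + 1) = z * B * q ^ (N + 1 + n)"
    "q powr (\<alpha> + \<beta> + 2 * real n + 1) = A * B * q ^ (2 * n + 1)"
    "q powr (\<alpha> + \<beta> + 2 * real n + 2) = A * B * q ^ (2 * n + 2)"
    "q powr (\<alpha> + \<beta> + 2 * real n) = A * B * q ^ (2 * n)"
    "q powr (\<alpha> + real n) = B * q ^ n"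
    "q powr (a + real N + 1 - a + \<alpha> + \<beta> + real n) = A * B * q ^ (n + N + 1)"
    "q powr (- a - (a + real N + 1) + \<beta> + real n) = A * q ^ n / q ^ N / z"
    unfolding A B z powr_nat[symmetric] powr_add[symmetric] powr_diff[symmetric]
    by (simp_all add: algebra_simps)
  have "E * (qnum q (\<alpha> + \<beta> + real n + 1) * qnum q (a - (a + real N + 1) + real n + 1)
      * qnum q (\<beta> + real n + 1) * qnum q (a + (a + real N + 1) + \<alpha> + real n + 1)
       / (qnum q (\<alpha> + \<beta> + 2 * real n + 1) * qnum q (\<alpha> + \<beta> + 2 * real n + 2)))
     = (1 - A * B * q ^ (n + 1)) * (1 - q ^ n / q ^ N) * (1 - A * q ^ (n + 1)) * (1 - z * B * q ^ (N + 1 + n))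
       / ((1 - A * B * q ^ (2 * n + 1)) * (1 - A * B * q ^ (2 * n + 2)))"
    unfolding E_eq by (subst qnum_prod_4_2[OF q, where d = 0]) (use q in \<open>simp_all only: pw\<close>, simp_all)
  also have "\<dots> = qr_A q N A B z n"
    using assms by (auto simp: qr_A_def qr_fac_def mult_ac)
  finally have a: "E * (qnum q (\<alpha> + \<beta> + real n + 1) * qnum q (a - (a + real N + 1) + real n + 1)
      * qnum q (\<beta> + real n + 1) * qnum q (a + (a + real N + 1) + \<alpha> + real n + 1)
       / (qnum q (\<alpha> + \<beta> + 2 * real n + 1) * qnum q (\<alpha> + \<beta> + 2 * real n + 2))) = qr_A q N A B z n" .
  have "E * (qnum q (\<alpha> + real n) * qnum q (a + real N + 1 - a + \<alpha> + \<beta> + real n)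
      * qnum q (- a - (a + real N + 1) + \<beta> + real n) * qnum q (real n)
       / (qnum q (\<alpha> + \<beta> + 2 * real n) * qnum q (\<alpha> + \<beta> + 2 * real n + 1)))
     = q powr (2 * a + 1) * ((1 - B * q ^ n) * (1 - A * B * q ^ (n + N + 1)) * (1 - A * q ^ n / q ^ N / z)
       * (1 - q ^ n) / ((1 - A * B * q ^ (2 * n)) * (1 - A * B * q ^ (2 * n + 1))))"
    unfolding E_eq
    by (subst qnum_prod_4_2[OF q, where d = "2 * a + 1"]) (simp_all only: pw powr_nat, simp_all)
  also have "\<dots> = (1 - B * q ^ n) * (1 - A * B * q ^ (n + N + 1)) * (z * (1 - A * q ^ n / q ^ N / z))
       * (1 - q ^ n) / ((1 - A * B * q ^ (2 * n)) * (1 - A * B * q ^ (2 * n + 1)))"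
    unfolding z[symmetric] by simp
  also have "z * (1 - A * q ^ n / q ^ N / z) = z - A * q ^ n / q ^ N"
    using pos by (simp add: right_diff_distrib)
  finally have c: "E * (qnum q (\<alpha> + real n) * qnum q (a + real N + 1 - a + \<alpha> + \<beta> + real n)
      * qnum q (- a - (a + real N + 1) + \<beta> + real n) * qnum q (real n)
       / (qnum q (\<alpha> + \<beta> + 2 * real n) * qnum q (\<alpha> + \<beta> + 2 * real n + 1))) = qr_C q N A B z n"
    by (simp add: qr_C_def mult_ac)
  show ?thesis
    unfolding racah_beta_raw_def right_diff_distrib[of E] mu a c qr_beta_def by simp
qed

text \<open>One factor \<open>E\<close> goes to A_(n-1) and one to C_n; the squared q-number in the
  denominator supplies one factor to each.\<close>

lemma E_mult_gamma_raw:
  assumes "1 < n \<or> n = 1 \<and> A * B * q \<noteq> 1"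
  shows "E\<^sup>2 * racah_gamma_raw q a (a + real N + 1) \<alpha> \<beta> n = qr_gamma q N A B z n"
proof -
  obtain n' where n: "n = Suc n'" using assms by (cases n) auto
  have pw: "q powr (\<alpha> + \<beta> + real n) = A * B * q ^ n"
    "q powr (\<alpha> + real n) = B * q ^ n"
    "q powr (\<beta> + real n) = A * q ^ n"
    "q powr (a + real N + 1 - a + \<alpha> + \<beta> + real n) = A * B * q ^ (n + N + 1)"
    "q powr (- a - (a + real N + 1) + \<beta> + real n) = A * q ^ n / q ^ N / z"
    "q powr (a - (a + real N + 1) + real n) = q ^ n' / q ^ N"
    "q powr (a + (a + real N + 1) + \<alpha> + real n) = z * B * q ^ (N + 1 + n')"
    "q powr (\<alpha> + \<beta> + 2 * real n - 1) = A * B * q ^ (2 * n' + 1)"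
    "q powr (\<alpha> + \<beta> + 2 * real n) = A * B * q ^ (2 * n)"
    "q powr (\<alpha> + \<beta> + 2 * real n + 1) = A * B * q ^ (2 * n + 1)"
    unfolding A B z n powr_nat[symmetric] powr_add[symmetric] powr_diff[symmetric]
    by (simp_all add: algebra_simps)
  have sq: "E\<^sup>2 = E * E" by (simp add: power2_eq_square)
  have "E\<^sup>2 * racah_gamma_raw q a (a + real N + 1) \<alpha> \<beta> n
    = (E * (qnum q (\<alpha> + \<beta> + real n) * qnum q (a - (a + real N + 1) + real n)
         * qnum q (\<beta> + real n) * qnum q (a + (a + real N + 1) + \<alpha> + real n)
         / (qnum q (\<alpha> + \<beta> + 2 * real n - 1) * qnum q (\<alpha> + \<beta> + 2 * real n))))
    * (E * (qnum q (\<alpha> + real n) * qnum q (a + real N + 1 - a + \<alpha> + \<beta> + real n)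
      * qnum q (- a - (a + real N + 1) + \<beta> + real n) * qnum q (real n)
       / (qnum q (\<alpha> + \<beta> + 2 * real n) * qnum q (\<alpha> + \<beta> + 2 * real n + 1))))"
  proof -
    have "e * e * (x1 * x2 * x3 * x4 * x5 * x6 * x7 * x8 / (y1 * y2^2 * y3))
      = (e * (x2 * x7 * x4 * x8 / (y1 * y2))) * (e * (x3 * x5 * x6 * x1 / (y2 * y3)))"
      for e x1 x2 x3 x4 x5 x6 x7 x8 y1 y2 y3 :: real
      by (simp add: power2_eq_square mult_ac)
    then show ?thesis unfolding racah_gamma_raw_def sq .
  qed
  also have "E * (qnum q (\<alpha> + \<beta> + real n) * qnum q (a - (a + real N + 1) + real n)
         * qnum q (\<beta> + real n) * qnum q (a + (a + real N + 1) + \<alpha> + real n)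
         / (qnum q (\<alpha> + \<beta> + 2 * real n - 1) * qnum q (\<alpha> + \<beta> + 2 * real n)))
     = (1 - A * B * q ^ n) * (1 - q ^ n' / q ^ N) * (1 - A * q ^ n) * (1 - z * B * q ^ (N + 1 + n'))
       / ((1 - A * B * q ^ (2 * n' + 1)) * (1 - A * B * q ^ (2 * n)))"
    unfolding E_eq by (subst qnum_prod_4_2[OF q, where d = 0]) (use q in \<open>simp_all only: pw\<close>, simp_all)
  also have "\<dots> = qr_A q N A B z (n - 1)"
    using assms unfolding n by (auto simp: qr_A_def qr_fac_def mult_ac)
  also have "E * (qnum q (\<alpha> + real n) * qnum q (a + real N + 1 - a + \<alpha> + \<beta> + real n)
      * qnum q (- a - (a + real N + 1) + \<beta> + real n) * qnum q (real n)
       / (qnum q (\<alpha> + \<beta> + 2 * real n) * qnum q (\<alpha> + \<beta> + 2 * real n + 1)))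
     = q powr (2 * a + 1) * ((1 - B * q ^ n) * (1 - A * B * q ^ (n + N + 1)) * (1 - A * q ^ n / q ^ N / z)
       * (1 - q ^ n) / ((1 - A * B * q ^ (2 * n)) * (1 - A * B * q ^ (2 * n + 1))))"
    unfolding E_eq
    by (subst qnum_prod_4_2[OF q, where d = "2 * a + 1"]) (simp_all only: pw powr_nat, simp_all)
  also have "\<dots> = (1 - B * q ^ n) * (1 - A * B * q ^ (n + N + 1)) * (z * (1 - A * q ^ n / q ^ N / z))
       * (1 - q ^ n) / ((1 - A * B * q ^ (2 * n)) * (1 - A * B * q ^ (2 * n + 1)))"
    unfolding z[symmetric] by simp
  also have "z * (1 - A * q ^ n / q ^ N / z) = z - A * q ^ n / q ^ N"
    using pos by (simp add: right_diff_distrib)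
  finally show ?thesis
    by (simp add: qr_gamma_def qr_C_def mult_ac)
qed

text \<open>C_n^2 = z^n kappa^(4n): the powers of kappa cancel, and z^n is distributed over the n
  factors of (A q^(1-N) / z; q)_n, which removes the pole at z = 0.\<close>

lemma scale_C_squared_d2_raw:
  assumes "qpoch (A * B * q ^ (N + 2)) q N \<noteq> 0"
  shows "(scale_C q a n)\<^sup>2 * racah_d2_raw q a (a + real N + 1) \<alpha> \<beta> n = qr_norm q N A B z n"
proof -
  have pw: "q powr (\<alpha> + 1) = B * q" "q powr (\<beta> + 1) = A * q"
    "q powr (a + real N + 1 - a + \<alpha> + \<beta> + 1) = A * B * q ^ (N + 2)"
    "q powr (a + (a + real N + 1) + \<alpha> + 1) = z * B * q ^ (N + 1)"
    "q powr (a - (a + real N + 1) + 1) = 1 / q ^ N"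
    "q powr (\<beta> - a - (a + real N + 1) + 1) = A * q / q ^ N / z"
    "q powr (\<alpha> + \<beta> + 2) = A * B * q ^ 2"
    "q powr (\<alpha> + \<beta> + real n + 1) = A * B * q ^ (n + 1)"
  proof -
    show "q powr (\<alpha> + 1) = B * q" "q powr (\<beta> + 1) = A * q"
      using q by (simp_all add: A B powr_add)
    show "q powr (a - (a + real N + 1) + 1) = 1 / q ^ N"
      using q by (simp add: powr_minus powr_nat inverse_eq_divide)
    have "\<beta> - a - (a + real N + 1) + 1 = \<beta> + 1 - real N - (2 * a + 1)" by simp
    then show "q powr (\<beta> - a - (a + real N + 1) + 1) = A * q / q ^ N / z"
      using q unfolding A z by (simp only: powr_diff powr_add powr_nat powr_one)
  qed (unfold A B z powr_nat[symmetric] powr_add[symmetric] powr_diff[symmetric], simp_all add: algebra_simps)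
  have C: "(scale_C q a n)\<^sup>2 = z ^ n * kappa q ^ (4 * n)"
  proof -
    have "(q powr (real n / 2 * (2 * a + 1)))\<^sup>2 = q powr (real n / 2 * (2 * a + 1) + real n / 2 * (2 * a + 1))"
      by (simp only: powr_add power2_eq_square)
    also have "real n / 2 * (2 * a + 1) + real n / 2 * (2 * a + 1) = (2 * a + 1) * real n"
      by (simp add: field_simps)
    also have "q powr \<dots> = z ^ n"
      using q by (simp add: z powr_powr[symmetric] powr_realpow)
    finally show ?thesis
      by (simp add: scale_C_def power_mult_distrib power_mult[symmetric] mult.commute)
  qed
  have zp: "z ^ n * qpoch (A * q / q ^ N / z) q n = (\<Prod>i<n. z - A * q ^ (i + 1) / q ^ N)"
  proof -
    have "z ^ n * qpoch (A * q / q ^ N / z) q n = (\<Prod>i<n. z * (1 - A * q / q ^ N / z * q ^ i))"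
      by (simp add: qpoch_def prod.distrib)
    also have "\<dots> = (\<Prod>i<n. z - A * q ^ (i + 1) / q ^ N)"
      using pos by (intro prod.cong refl) (simp add: right_diff_distrib mult_ac)
    finally show ?thesis .
  qed
  have "(scale_C q a n)\<^sup>2 * racah_d2_raw q a (a + real N + 1) \<alpha> \<beta> n
    = qpoch q q n * qpoch (B * q) q n * qpoch (A * q) q n * qpoch (z * B * q ^ (N + 1)) q n
     * qpoch (1 / q ^ N) q n * (z ^ n * qpoch (A * q / q ^ N / z) q n)
     * (qpoch (A * B * q ^ (N + 2)) q n
        / (qpoch (A * B * q ^ 2) q (2 * n) * qpoch (A * B * q ^ (n + 1)) q n))"
    unfolding C racah_d2_raw_def qpochs_def pw using kappa_nonzero[OF q] by (simp add: mult_ac)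
  then show ?thesis unfolding zp qr_norm_generic[OF assms] .
qed

end

text \<open>The limit ignores the value at 0, so it suffices to agree near 0 with an expression in
  which the common factors are already gone.\<close>

lemma cancelled_eqI:
  assumes "(g \<longlongrightarrow> l) (at 0)" "\<forall>\<^sub>F t in at 0. f t = g t"
  shows "cancelled f = l"
  unfolding cancelled_def
proof (rule tendsto_Lim)
  show "(f \<longlongrightarrow> l) (at 0)"
    using assms tendsto_cong[OF assms(2)] by simp
qed simp

context racah_params
begin

text \<open>Displacing \<alpha> by t multiplies B by q^t and changes neither A nor z, so the
  identities for raw quantities hold at the displaced parameters.\<close>

lemma shifted_params: "racah_params q a z A (B * q powr t) (\<alpha> + t) \<beta> N"
  using q N A B z by unfold_locales (simp_all add: powr_add)

lemma tendsto_shifted: "((\<lambda>t. B * q powr t) \<longlongrightarrow> B) (at 0)"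
  using q by (auto intro!: tendsto_eq_intros)

lemma eventually_shifted_generic:
  "\<forall>\<^sub>F t in at 0. \<forall>m\<in>{..M::nat}. A * (B * q powr t) * q ^ m \<noteq> 1"
proof (rule eventually_ball_finite, simp, intro ballI)
  fix m :: nat
  have "\<forall>\<^sub>F t in at 0. t \<noteq> - (\<alpha> + \<beta> + real m)"
    by (rule eventually_neq_at_within)
  then show "\<forall>\<^sub>F t in at 0. A * (B * q powr t) * q ^ m \<noteq> 1"
  proof eventually_elim
    case (elim t)
    have "A * (B * q powr t) * q ^ m = q powr (\<alpha> + \<beta> + real m + t)"
      unfolding A B powr_nat[symmetric] powr_add[symmetric] by (simp add: algebra_simps)
    moreover have "q powr (\<alpha> + \<beta> + real m + t) \<noteq> q powr 0"
      using elim powr_inj[of q "\<alpha> + \<beta> + real m + t" 0] q by auto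
    ultimately show ?case using q by simp
  qed
qed

context
  assumes reg: "qr_regular q N A B"
begin

lemmas shifted_tendsto = tendsto_const[of A "at (0::real)"] tendsto_shifted tendsto_const[of z "at (0::real)"] reg N

lemma E_mult_racah_beta:
  assumes "n < N"
  shows "E * racah_beta q a (a + real N + 1) \<alpha> \<beta> n = qr_beta q N A B z n - (1 + q) * q powr a"
proof -
  have "racah_beta q a (a + real N + 1) \<alpha> \<beta> n = (qr_beta q N A B z n - (1 + q) * q powr a) / E"
    unfolding racah_beta_def
  proof (rule cancelled_eqI)
    show "((\<lambda>t. (qr_beta q N A (B * q powr t) z n - (1 + q) * q powr a) / E)
        \<longlongrightarrow> (qr_beta q N A B z n - (1 + q) * q powr a) / E) (at 0)"
      by (intro tendsto_intros tendsto_qr_beta[OF shifted_tendsto] assms E_nonzero)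
    show "\<forall>\<^sub>F t in at 0. racah_beta_raw q a (a + real N + 1) (\<alpha> + t) \<beta> n
        = (qr_beta q N A (B * q powr t) z n - (1 + q) * q powr a) / E"
      using eventually_shifted_generic[of 1]
    proof eventually_elim
      case (elim t)
      then have "A * (B * q powr t) * q ^ 1 \<noteq> 1" by blast
      then show ?case
        using racah_params.E_mult_beta_raw[OF shifted_params, of n t]
        unfolding nonzero_eq_divide_eq[OF E_nonzero] by (simp add: mult_ac)
    qed
  qed
  then show ?thesis using E_nonzero by simp
qed

lemma E_mult_racah_gamma:
  assumes "n < N" "1 \<le> n"
  shows "E\<^sup>2 * racah_gamma q a (a + real N + 1) \<alpha> \<beta> n = qr_gamma q N A B z n"
proof -
  have "racah_gamma q a (a + real N + 1) \<alpha> \<beta> n = qr_gamma q N A B z n / E\<^sup>2"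
    unfolding racah_gamma_def
  proof (rule cancelled_eqI)
    show "((\<lambda>t. qr_gamma q N A (B * q powr t) z n / E\<^sup>2) \<longlongrightarrow> qr_gamma q N A B z n / E\<^sup>2) (at 0)"
      using E_nonzero by (intro tendsto_intros tendsto_qr_gamma[OF shifted_tendsto] assms) simp
    show "\<forall>\<^sub>F t in at 0. racah_gamma_raw q a (a + real N + 1) (\<alpha> + t) \<beta> n
        = qr_gamma q N A (B * q powr t) z n / E\<^sup>2"
      using eventually_shifted_generic[of 1]
    proof eventually_elim
      case (elim t)
      then have "A * (B * q powr t) * q ^ 1 \<noteq> 1" by blast
      then have "1 < n \<or> n = 1 \<and> A * (B * q powr t) * q \<noteq> 1"
        using assms by auto
      from racah_params.E_mult_gamma_raw[OF shifted_params this] show ?case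
        unfolding nonzero_eq_divide_eq[OF E2] by (simp only: mult.commute)
    qed
  qed
  then show ?thesis using E_nonzero by simp
qed

lemma scale_C_squared_d2:
  assumes "n \<le> N"
  shows "(scale_C q a n)\<^sup>2 * racah_d2 q a (a + real N + 1) \<alpha> \<beta> n = qr_norm q N A B z n"
proof -
  have C: "(scale_C q a n)\<^sup>2 \<noteq> 0"
    using kappa_nonzero[OF q] q by (simp add: scale_C_def)
  have "racah_d2 q a (a + real N + 1) \<alpha> \<beta> n = qr_norm q N A B z n / (scale_C q a n)\<^sup>2"
    unfolding racah_d2_def
  proof (rule cancelled_eqI)
    show "((\<lambda>t. qr_norm q N A (B * q powr t) z n / (scale_C q a n)\<^sup>2)
        \<longlongrightarrow> qr_norm q N A B z n / (scale_C q a n)\<^sup>2) (at 0)"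
      by (intro tendsto_intros tendsto_qr_norm[OF shifted_tendsto] assms C)
    show "\<forall>\<^sub>F t in at 0. racah_d2_raw q a (a + real N + 1) (\<alpha> + t) \<beta> n
        = qr_norm q N A (B * q powr t) z n / (scale_C q a n)\<^sup>2"
      using eventually_shifted_generic[of "2 * N + 2"]
    proof eventually_elim
      case (elim t)
      have "A * (B * q powr t) * q ^ (N + 2 + j) \<noteq> 1" if "j < N" for j
        using bspec[OF elim, of "N + 2 + j"] that by simp
      then have "qpoch (A * (B * q powr t) * q ^ (N + 2)) q N \<noteq> 0"
        by (rule qpoch_power_nonzero)
      from racah_params.scale_C_squared_d2_raw[OF shifted_params this] show ?case
        unfolding nonzero_eq_divide_eq[OF C] by (simp only: mult.commute)
    qed
  qed
  then show ?thesis using C by simp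
qed

end

end

section \<open>The q-Hahn quantities as values at z = 0\<close>

locale hahn_params =
  fixes q A B :: real and N :: nat
  assumes q: "0 < q" "q < 1" and N: "1 \<le> N" and B: "0 < B"
begin

lemma powr_diff_nat: "q powr (real n - real N) = q ^ n / q ^ N"
  using q by (simp add: powr_diff powr_realpow)

lemma hahn_beta_raw_eq:
  assumes "n \<noteq> 0 \<or> A * B * q \<noteq> 1"
  shows "hahn_beta_raw q A B N n = qr_beta q N A B 0 n"
  using assms unfolding hahn_beta_raw_def qr_beta_def qr_A_def qr_C_def qr_fac_def powr_diff_nat
  by (auto simp: mult_ac)

lemma hahn_gamma_raw_eq:
  assumes "1 < n \<or> n = 1 \<and> A * B * q \<noteq> 1"
  shows "hahn_gamma_raw q A B N n = qr_gamma q N A B 0 n"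
proof -
  obtain n' where n: "n = Suc n'" using assms by (cases n) auto
  have 1: "q powr (real n - real N - 1) = q ^ n' / q ^ N"
    using powr_diff_nat[of n'] by (simp add: n)
  have 2: "q powr (2 * real n - 1) = q ^ (2 * n' + 1)"
    using powr_realpow[OF q(1), of "2 * n' + 1"] by (simp add: n algebra_simps)
  have A: "qr_A q N A B 0 n' = (1 - q ^ n' / q ^ N) * (1 - A * q ^ n) * (1 - A * B * q ^ n)
      / ((1 - A * B * q ^ (2 * n' + 1)) * (1 - A * B * q ^ (2 * n)))"
    using assms by (auto simp: qr_A_def qr_fac_def n mult_ac)
  show ?thesis
    unfolding hahn_gamma_raw_def qr_gamma_def 1 2 powr_diff_nat qr_C_def
    using A by (simp add: n power2_eq_square mult_ac)
qed

lemma prod_power: "(\<Prod>i<n. q ^ i) = q ^ (n choose 2)"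
proof (induction n)
  case (Suc n)
  have "Suc n choose 2 = (n choose 2) + n" by (simp add: numeral_2_eq_2)
  then show ?case using Suc by (simp add: power_add)
qed (simp add: numeral_2_eq_2)

lemma hahn_d2_raw_eq:
  assumes gen: "\<And>m. m \<le> 2 * N + 2 \<Longrightarrow> A * B * q ^ m \<noteq> 1" and n: "n \<le> N"
  shows "hahn_d2_raw q A B N n = qr_norm q N A B 0 n"
proof -
  have p: "q powr (- real N) = 1 / q ^ N"
    using powr_diff_nat[of 0] by simp
  have 0: "qpoch (0 * B * q ^ (N + 1)) q n = 1" by (simp add: qpoch_def)
  have ne: "qpoch (A * B * q ^ (N + 2)) q N \<noteq> 0" "qpoch (A * B * q ^ (n + 1)) q n \<noteq> 0"
    "qpoch (A * B * q ^ 2) q (2 * n) \<noteq> 0" "qpoch (A * B * q ^ 1) q n \<noteq> 0"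
    using n by (intro qpoch_power_nonzero gen; simp)+
  have s: "1 - A * B * q \<noteq> 0" "1 - A * B * q ^ (2 * n + 1) \<noteq> 0"
    using gen[of 1] gen[of "2 * n + 1"] n by simp_all
  \<comment> \<open>One factor is moved from the end of the q-factorial to its front. This merges
    the separate fraction (1 - A B q) / (1 - A B q^(2n+1)) of the q-Hahn norm into (A B
    q^2)_(2n).\<close>
  have "(1 - A * B * q) * qpoch (A * B * q ^ 2) q (2 * n) = qpoch (A * B * q) q (2 * n) * (1 - A * B * q ^ (2 * n + 1))"
    using qpoch_shift[of "A * B * q" q "2 * n"] by (simp add: power2_eq_square mult_ac)
  also have "qpoch (A * B * q) q (2 * n) = qpoch (A * B * q) q n * qpoch (A * B * q ^ (n + 1)) q n"
    unfolding mult_2 qpoch_add by (simp add: mult_ac)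
  finally have r: "(1 - A * B * q) / (1 - A * B * q ^ (2 * n + 1)) / (qpoch (A * B * q) q n * qpoch (A * B * q ^ (n + 1)) q n)
     = 1 / qpoch (A * B * q ^ 2) q (2 * n)"
    using ne s by (simp add: field_simps)
  have e: "(- A * q) ^ n * q powr (real (n choose 2) - real N * real n) = (\<Prod>i<n. 0 - A * q ^ (i + 1) / q ^ N)"
  proof -
    have "q powr (real (n choose 2) - real N * real n) = q ^ (n choose 2) / (q ^ N) ^ n"
      using q by (simp add: powr_diff powr_realpow power_mult[symmetric] flip: of_nat_mult)
    moreover have "(\<Prod>i<n. 0 - A * q ^ (i + 1) / q ^ N) = (\<Prod>i<n. (- A * q / q ^ N) * q ^ i)"
      by (intro prod.cong) auto
    moreover have "(- A * q / q ^ N) ^ n = (- A * q) ^ n / (q ^ N) ^ n"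
      by (rule power_divide)
    ultimately show ?thesis
      by (simp only: prod.distrib prod_power prod_constant card_lessThan) simp
  qed
  have "hahn_d2_raw q A B N n = (\<Prod>i<n. 0 - A * q ^ (i + 1) / q ^ N)
    * ((1 - A * B * q) / (1 - A * B * q ^ (2 * n + 1)) / (qpoch (A * B * q) q n * qpoch (A * B * q ^ (n + 1)) q n))
    * (qpoch q q n * qpoch (A * q) q n * qpoch (B * q) q n * qpoch (1 / q ^ N) q n * qpoch (A * B * q ^ (N + 2)) q n
       / qpoch (A * B * q ^ (n + 1)) q n)"
    unfolding hahn_d2_raw_def e p qpochs_def by (simp add: mult_ac)
  then show ?thesis
    unfolding r qr_norm_generic[OF ne(1)] 0 by (simp add: mult_ac)
qed

lemma tendsto_shifted: "((\<lambda>t. A + t) \<longlongrightarrow> A) (at 0)"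
  by (auto intro!: tendsto_eq_intros)

text \<open>The locale puts no condition on A, so its facts can be applied at the displaced value A
  + t.\<close>

lemma shifted_params: "hahn_params q B N"
  using q N B by unfold_locales

lemma eventually_shifted_generic:
  "\<forall>\<^sub>F t in at 0. \<forall>m\<in>{..M::nat}. (A + t) * B * q ^ m \<noteq> 1"
proof (rule eventually_ball_finite, simp, intro ballI)
  fix m :: nat
  have "\<forall>\<^sub>F t in at 0. t \<noteq> 1 / (B * q ^ m) - A"
    by (rule eventually_neq_at_within)
  then show "\<forall>\<^sub>F t in at 0. (A + t) * B * q ^ m \<noteq> 1"
    by (rule eventually_mono) (use q B in \<open>auto simp: field_simps\<close>)
qed

context
  assumes reg: "qr_regular q N A B"
begin

lemmas shifted_tendsto = tendsto_shifted tendsto_const[of B "at (0::real)"] tendsto_const[of 0 "at (0::real)"] reg N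

lemma hahn_beta_eq:
  assumes "n < N"
  shows "hahn_beta q A B N n = qr_beta q N A B 0 n"
  unfolding hahn_beta_def
proof (rule cancelled_eqI)
  show "((\<lambda>t. qr_beta q N (A + t) B 0 n) \<longlongrightarrow> qr_beta q N A B 0 n) (at 0)"
    by (rule tendsto_qr_beta[OF shifted_tendsto assms])
  show "\<forall>\<^sub>F t in at 0. hahn_beta_raw q (A + t) B N n = qr_beta q N (A + t) B 0 n"
    using eventually_shifted_generic[of 1]
  proof eventually_elim
    case (elim t)
    then have "(A + t) * B * q ^ 1 \<noteq> 1" by blast
    then show ?case by (intro hahn_params.hahn_beta_raw_eq[OF shifted_params]) simp
  qed
qed

lemma hahn_gamma_eq:
  assumes "n < N" "1 \<le> n"
  shows "hahn_gamma q A B N n = qr_gamma q N A B 0 n"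
  unfolding hahn_gamma_def
proof (rule cancelled_eqI)
  show "((\<lambda>t. qr_gamma q N (A + t) B 0 n) \<longlongrightarrow> qr_gamma q N A B 0 n) (at 0)"
    by (rule tendsto_qr_gamma[OF shifted_tendsto assms(1)])
  show "\<forall>\<^sub>F t in at 0. hahn_gamma_raw q (A + t) B N n = qr_gamma q N (A + t) B 0 n"
    using eventually_shifted_generic[of 1]
  proof eventually_elim
    case (elim t)
    then have "(A + t) * B * q ^ 1 \<noteq> 1" by blast
    then show ?case using assms by (intro hahn_params.hahn_gamma_raw_eq[OF shifted_params]) auto
  qed
qed

lemma hahn_d2_eq:
  assumes "n \<le> N"
  shows "hahn_d2 q A B N n = qr_norm q N A B 0 n"
  unfolding hahn_d2_def
proof (rule cancelled_eqI)
  show "((\<lambda>t. qr_norm q N (A + t) B 0 n) \<longlongrightarrow> qr_norm q N A B 0 n) (at 0)"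
    by (rule tendsto_qr_norm[OF shifted_tendsto assms])
  show "\<forall>\<^sub>F t in at 0. hahn_d2_raw q (A + t) B N n = qr_norm q N (A + t) B 0 n"
    using eventually_shifted_generic[of "2 * N + 2"]
  proof eventually_elim
    case (elim t)
    then show ?case by (intro hahn_params.hahn_d2_raw_eq[OF shifted_params] assms) auto
  qed
qed

end

text \<open>The q-Hahn weight is written with q-factorials of q^(-N), the common weight with
  q-factorials of positive powers. Reversing the order of the factors connects them, and the lattice
  difference -kappa q^(-s) cancels the constant -kappa.\<close>

lemma hahn_rho_eq:
  assumes s: "s \<le> N" and A: "0 < A"
    and Bne: "\<And>m. 1 \<le> m \<Longrightarrow> m \<le> N \<Longrightarrow> B * q ^ m \<noteq> 1"
  shows "hahn_rho q A B N s * fwd_diff (hahn_x q) (real s - 1/2) = qr_weight q N A B 0 s"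
proof -
  define m where "m = N - s"
  have N': "N = m + s" using s by (simp add: m_def)
  have p: "q powr (- real k) = 1 / q ^ k" for k
    using q by (simp add: powr_minus powr_realpow inverse_eq_divide)
  have x: "fwd_diff (hahn_x q) (real s - 1/2) = - kappa q / q ^ s"
  proof -
    have "- (real s - 1/2 + 1) = - real s + -1/2" "- (real s - 1/2) = - real s + 1/2"
      by simp_all
    then have h: "q powr (- (real s - 1/2 + 1)) = q powr (- real s) * q powr (-1/2)"
      "q powr (- (real s - 1/2)) = q powr (- real s) * q powr (1/2)"
      by (simp_all only: powr_add)
    show ?thesis
      unfolding fwd_diff_def hahn_x_def kappa_def h p by (simp add: diff_divide_distrib)
  qed
  \<comment> \<open>Reversal of a q-factorial, used with c = 1 for the numerator and c = B for the
    denominator.\<close>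
  have reflect: "qpoch (1 / (c * q ^ (m + s))) q s * (c ^ s * (\<Prod>i<s. q ^ (m + 1 + i))) = (- 1) ^ s * qpoch (c * q ^ (m + 1)) q s"
    if "c \<noteq> 0" for c :: real
  proof -
    have "qpoch (1 / (c * q ^ (m + s))) q s = (\<Prod>i<s. 1 - 1 / (c * q ^ (m + s)) * q ^ (s - Suc i))"
      unfolding qpoch_def by (rule prod.nat_diff_reindex[symmetric])
    also have "\<dots> * (c ^ s * (\<Prod>i<s. q ^ (m + 1 + i)))
      = (\<Prod>i<s. (1 - 1 / (c * q ^ (m + s)) * q ^ (s - Suc i)) * (c * q ^ (m + 1 + i)))"
      by (simp add: prod.distrib)
    also have "\<dots> = (\<Prod>i<s. (- 1) * (1 - c * q ^ (m + 1) * q ^ i))"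
    proof (intro prod.cong refl)
      fix i assume "i \<in> {..<s}"
      then have "q ^ (m + s) = q ^ (s - Suc i) * q ^ (m + 1 + i)"
        unfolding power_add[symmetric] by (simp add: add.commute)
      then show "(1 - 1 / (c * q ^ (m + s)) * q ^ (s - Suc i)) * (c * q ^ (m + 1 + i))
          = (- 1) * (1 - c * q ^ (m + 1) * q ^ i)"
        using q that by (simp add: field_simps power_add)
    qed
    also have "\<dots> = (- 1) ^ s * qpoch (c * q ^ (m + 1)) q s"
      by (simp only: prod.distrib prod_constant card_lessThan qpoch_def)
    finally show ?thesis .
  qed
  have Bq: "qpoch (B * q ^ (m + 1)) q s \<noteq> 0" "qpoch (B * q ^ 1) q m \<noteq> 0"
    by (intro qpoch_power_nonzero Bne; simp add: N')+
  have P: "(\<Prod>i<s. q ^ (m + 1 + i)) \<noteq> 0" using q by simp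
  have Q1: "qpoch (1 / q ^ N) q s = (- 1) ^ s * qpoch (q ^ (m + 1)) q s / (\<Prod>i<s. q ^ (m + 1 + i))"
    using reflect[of 1] P by (simp add: N' field_simps del: prod_zero_iff)
  have Q2: "qpoch (inverse B * (1 / q ^ N)) q s
      = (- 1) ^ s * qpoch (B * q ^ (m + 1)) q s / (\<Prod>i<s. q ^ (m + 1 + i)) / B ^ s"
    using reflect[of B] P B by (simp add: N' field_simps del: prod_zero_iff)
  have Q3: "qpoch (q ^ (m + 1)) q s = qpoch q q N / qpoch q q m"
    using qpoch_add[of q q m s] qpoch_q_nonzero[OF q, of m] by (simp add: N')
  have Q4: "qpoch (B * q) q N = qpoch (B * q) q m * qpoch (B * q ^ (m + 1)) q s"
    unfolding N' qpoch_add by (simp add: mult_ac)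
  \<comment> \<open>The signs and powers of q from the two reversals cancel. The remaining B^s is
    removed by (A B)^(-s).\<close>
  have R: "qpoch (1 / q ^ N) q s / qpoch (inverse B * (1 / q ^ N)) q s * qpoch (B * q) q N
     = B ^ s * (qpoch q q N / qpoch q q m) * qpoch (B * q) q m"
    unfolding Q1 Q2 Q3[symmetric] Q4 using Bq P B by (simp add: field_simps del: prod_zero_iff)
  have pi: "(A * B) powi (- int s) = 1 / (A ^ s * B ^ s)"
    by (simp add: power_int_minus power_mult_distrib inverse_eq_divide)
  have "hahn_rho q A B N s * fwd_diff (hahn_x q) (real s - 1/2)
    = 1 / (A ^ s * B ^ s) * (A * q) ^ N / q ^ s / qpoch (A * B * q ^ 2) q N * (qpoch (A * q) q s / qpoch q q s)
      * (qpoch (1 / q ^ N) q s / qpoch (inverse B * (1 / q ^ N)) q s * qpoch (B * q) q N)"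
    unfolding hahn_rho_def x pi p qpochs_def using kappa_nonzero[OF q] by (simp add: mult_ac)
  also have "\<dots> = q ^ m * A ^ m * qpoch (A * q) q s * qpoch (B * q) q m * (qpoch q q N / (qpoch q q m * qpoch q q s))
     / qpoch (A * B * q ^ 2) q N"
    unfolding R using A B q by (simp add: N' power_mult_distrib power_add mult_ac)
  also have "\<dots> = qr_weight q N A B 0 s"
    unfolding qr_weight_def m_def[symmetric] by (simp add: N' qpoch_def mult_ac)
  finally show ?thesis .
qed

end

text \<open>This identifies q^(a+1) / c_1 as the ratio C_(n+1) / C_n for every n.\<close>

lemma (in racah_params) scale_C_Suc: "scale_C q a (Suc n) = E * scale_C q a n"
proof -
  have "real (Suc n) / 2 * (2 * a + 1) = (a + 1/2) + real n / 2 * (2 * a + 1)"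
    by (simp add: field_simps)
  then have "q powr (real (Suc n) / 2 * (2 * a + 1)) = q powr (a + 1/2) * q powr (real n / 2 * (2 * a + 1))"
    by (simp only: powr_add)
  then show ?thesis
    unfolding scale_C_def E_eq by (simp add: power2_eq_square mult_ac)
qed

section \<open>The q-Racah relations for large a\<close>

text \<open>z < 1 keeps the denominators (z q^s; q)_(N+1) of the weight away from 0, and z B < 1
  does so for the lower parameter z B q^(N+1). Both hold for all large a.\<close>

locale regular_racah_params = racah_params +
  assumes regular: "qr_regular q N A B"
    and A_nonres: "\<And>m. 1 \<le> m \<Longrightarrow> m \<le> N \<Longrightarrow> A * q ^ m \<noteq> 1"
    and z_less: "z < 1" "z * B < 1"
begin

abbreviation "P n s \<equiv> qr_poly q N A B z n (qr_X q z s)"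
abbreviation "C n \<equiv> scale_C q a n"
abbreviation "u n s \<equiv> racah_u q a (a + real N + 1) \<alpha> \<beta> n (real s + a)"
abbreviation "c \<equiv> (1 + q) * q powr a"

lemma C_nonzero: "C n \<noteq> 0"
  using kappa_nonzero[OF q] q by (simp add: scale_C_def)

lemma C_mult_u:
  assumes "n \<le> N"
  shows "C n * u n s = P n s"
proof (rule scale_C_racah_u[OF q assms A B z])
  have "qpoch (A * q ^ 1) q n \<noteq> 0"
    by (intro qpoch_power_nonzero A_nonres) (use assms in auto)
  then show "qpoch (A * q) q n \<noteq> 0" by simp
  have "z * B * q ^ m < 1" for m
    by (rule power_le_one_mult_less[OF q]) (use pos z_less in auto)
  then show "qpoch (z * B * q ^ (N + 1)) q n \<noteq> 0"
    by (intro qpoch_power_nonzero) (metis less_irrefl)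
  show "qpoch (A * B * q ^ (n + 1)) q n \<noteq> 0"
  proof (cases "n = 0")
    case False
    then show ?thesis
      by (intro qr_regular_qpoch[OF regular]) (use assms in auto)
  qed simp
qed

lemma rho_eq:
  assumes "s \<le> N"
  shows "racah_rho q a (a + real N + 1) \<alpha> \<beta> (real s + a) * qnum q (2 * real s + 2 * a + 1)
    = qr_weight q N A B z s"
proof (rule racah_rho_eq_qr_weight[OF q assms A B z z_less(1)])
  show "qpoch (A * B * q ^ 2) q N \<noteq> 0"
    by (intro qr_regular_qpoch[OF regular]) (use N in auto)
qed

lemma C_C_mult_term:
  assumes "n \<le> N" "m \<le> N" "s \<le> N"
  shows "C n * C m * (u n s * u m s * racah_rho q a (a + real N + 1) \<alpha> \<beta> (real s + a)
      * qnum q (2 * real s + 2 * a + 1)) = P n s * P m s * qr_weight q N A B z s"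
  unfolding C_mult_u[OF assms(1), symmetric] C_mult_u[OF assms(2), symmetric] rho_eq[OF assms(3), symmetric]
  by (simp only: mult_ac)

lemma C_C_mult_norm:
  assumes "n \<le> N"
  shows "C n * C m * (if n = m then racah_d2 q a (a + real N + 1) \<alpha> \<beta> n else 0)
    = (if n = m then qr_norm q N A B z n else 0)"
  using scale_C_squared_d2[OF regular assms] by (auto simp: power2_eq_square)

lemma racah_orthogonality:
  assumes "n \<le> N" "m \<le> N"
  shows "(\<Sum>s=0..N. u n s * u m s * racah_rho q a (a + real N + 1) \<alpha> \<beta> (real s + a)
      * qnum q (2 * real s + 2 * a + 1)) = (if n = m then racah_d2 q a (a + real N + 1) \<alpha> \<beta> n else 0)"
    (is "?S = ?D")
proof -
  have "C n * C m * ?S = (\<Sum>s\<le>N. P n s * P m s * qr_weight q N A B z s)"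
    unfolding sum_distrib_left atMost_atLeast0
    by (intro sum.cong refl C_C_mult_term assms) simp
  also have "\<dots> = (if n = m then qr_norm q N A B z n else 0)"
    by (rule qr_orthogonality[OF q N _ z_less(1) regular _ A_nonres _ z_less(2) assms]) (use pos in auto)
  also have "\<dots> = C n * C m * ?D"
    by (rule C_C_mult_norm[OF assms(1), symmetric])
  finally show ?thesis
    using C_nonzero by simp
qed

context
  fixes n s :: nat
  assumes n: "n < N" and s: "s \<le> N"
begin

lemma E_C_mult_mu: "E * C n * (racah_mu q (real s + a) * u n s) = (qr_X q z s - c) * P n s"
  unfolding E_mult_racah_mu[symmetric] C_mult_u[OF less_imp_le[OF n], symmetric] by (simp only: mult_ac)

lemma E_C_mult_Suc: "E * C n * u (n + 1) s = P (n + 1) s"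
proof -
  have "n + 1 \<le> N" using n by simp
  then show ?thesis
    unfolding C_mult_u[OF \<open>n + 1 \<le> N\<close>, symmetric] using scale_C_Suc[of n] by simp
qed

lemma E_C_mult_beta: "E * C n * (racah_beta q a (a + real N + 1) \<alpha> \<beta> n * u n s) = (qr_beta q N A B z n - c) * P n s"
  unfolding E_mult_racah_beta[OF regular n, symmetric] C_mult_u[OF less_imp_le[OF n], symmetric]
  by (simp only: mult_ac)

lemma E_C_mult_gamma:
  "E * C n * (racah_gamma q a (a + real N + 1) \<alpha> \<beta> n * pred_poly (\<lambda>k. u k s) n)
    = qr_gamma q N A B z n * pred_poly (\<lambda>k. P k s) n"
proof (cases n)
  case 0
  then show ?thesis by (simp add: pred_poly_def)
next
  case (Suc k)
  have k: "k \<le> N" using n Suc by simp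
  have "E * C n * (racah_gamma q a (a + real N + 1) \<alpha> \<beta> n * u k s)
    = (E\<^sup>2 * racah_gamma q a (a + real N + 1) \<alpha> \<beta> n) * (C k * u k s)"
    unfolding Suc scale_C_Suc power2_eq_square by (simp only: mult_ac)
  also have "E\<^sup>2 * racah_gamma q a (a + real N + 1) \<alpha> \<beta> n = qr_gamma q N A B z n"
    by (rule E_mult_racah_gamma[OF regular n]) (simp add: Suc)
  finally show ?thesis
    unfolding C_mult_u[OF k] by (simp add: pred_poly_def Suc)
qed

text \<open>The shift \<open>c\<close> occurs with the same multiple of the n-th polynomial on both
  sides and cancels. The rescaled relation is then divided by the nonzero factor
  \<open>E * C n\<close>.\<close>

lemma racah_recurrence:
  "racah_mu q (real s + a) * u n s = u (n + 1) s + racah_beta q a (a + real N + 1) \<alpha> \<beta> n * u n s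
    + racah_gamma q a (a + real N + 1) \<alpha> \<beta> n * pred_poly (\<lambda>k. u k s) n"
proof -
  have g: "qr_gamma q N A B z n * pred_poly (\<lambda>k. P k s) n = qr_gamma q N A B z n * P (n - 1) s"
    by (cases n) (simp_all add: pred_poly_def qr_gamma_def)
  have "(qr_X q z s - c) * P n s = P (n + 1) s + (qr_beta q N A B z n - c) * P n s
      + qr_gamma q N A B z n * P (n - 1) s"
    using qr_poly_recurrence_regular[OF q N regular _ n, of "qr_X q z s" z] pos
    by (simp add: algebra_simps)
  then have "E * C n * (racah_mu q (real s + a) * u n s)
    = E * C n * (u (n + 1) s + racah_beta q a (a + real N + 1) \<alpha> \<beta> n * u n s
    + racah_gamma q a (a + real N + 1) \<alpha> \<beta> n * pred_poly (\<lambda>k. u k s) n)"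
    unfolding distrib_left E_C_mult_mu E_C_mult_Suc E_C_mult_beta E_C_mult_gamma g .
  then show ?thesis
    using E_nonzero C_nonzero[of n] mult_cancel_left by fastforce
qed

end

end

section \<open>The limit\<close>

text \<open>In the first range A B q^m < 1 for all m \<ge> 2; in the second A B q^m > 1 for all m
  \<le> 2N. Either way there is no resonance for 2 \<le> m \<le> 2N.\<close>

lemma params_cases:
  fixes q A B :: real and N :: nat
  assumes q: "0 < q" "q < 1" and N: "1 \<le> N"
    and params: "(0 < A * q \<and> A * q < 1 \<and> 0 < B * q \<and> B * q < 1)
                 \<or> (A > q powr (- real N) \<and> B > q powr (- real N))"
  shows "0 < A" "0 < B" "qr_regular q N A B"
    "\<And>m. 1 \<le> m \<Longrightarrow> m \<le> N \<Longrightarrow> A * q ^ m \<noteq> 1"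
    "\<And>m. 1 \<le> m \<Longrightarrow> m \<le> N \<Longrightarrow> B * q ^ m \<noteq> 1"
proof -
  have p: "q powr (- real N) = 1 / q ^ N"
    using q by (simp add: powr_minus powr_realpow inverse_eq_divide)
  have qpos: "0 < q ^ m" for m using q by simp
  have small: "x * q ^ m < 1" if "0 < x * q" "x * q < 1" "1 \<le> m" for x :: real and m
  proof -
    have "x * q * q ^ (m - 1) < 1"
      by (rule power_le_one_mult_less[OF q]) (use that in auto)
    then show ?thesis using that by (cases m) (auto simp: mult.assoc)
  qed
  have large: "1 < x * q ^ m" if "1 / q ^ N < x" "m \<le> N" for x :: real and m
  proof -
    have "1 < x * q ^ N" using that qpos[of N] by (simp add: divide_less_eq)
    moreover have "0 < x" using that qpos[of N] by (meson divide_pos_pos less_trans zero_less_one)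
    then have "x * q ^ N \<le> x * q ^ m"
      using that q by (intro mult_left_mono power_decreasing) auto
    ultimately show ?thesis by linarith
  qed
  have AB: "0 < A \<and> 0 < B \<and> qr_regular q N A B \<and> (\<forall>m. 1 \<le> m \<longrightarrow> m \<le> N \<longrightarrow> A * q ^ m \<noteq> 1 \<and> B * q ^ m \<noteq> 1)"
    using params
  proof
    assume h: "0 < A * q \<and> A * q < 1 \<and> 0 < B * q \<and> B * q < 1"
    have "A * B * q ^ m < 1" if m: "2 \<le> m" for m
    proof -
      have "(A * q) * (B * q ^ (m - 1)) < 1 * 1"
        by (rule mult_strict_mono) (use h small[of B "m - 1"] m q in \<open>auto simp: zero_less_mult_iff\<close>)
      moreover have "q * q ^ (m - 1) = q ^ m" using m by (cases m) auto
      ultimately show ?thesis by (simp add: mult_ac)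
    qed
    then have "qr_regular q N A B" unfolding qr_regular_def by (metis less_irrefl)
    moreover have "A * q ^ m \<noteq> 1" "B * q ^ m \<noteq> 1" if "1 \<le> m" for m
      using small[of A m] small[of B m] h that by auto
    ultimately show ?thesis using h q by (auto simp: zero_less_mult_iff)
  next
    assume "A > q powr (- real N) \<and> B > q powr (- real N)"
    then have h: "1 / q ^ N < A" "1 / q ^ N < B" unfolding p by auto
    then have pos: "0 < A" "0 < B" using qpos[of N] by (meson divide_pos_pos less_trans zero_less_one)+
    have "1 < A * B * q ^ m" if m: "m \<le> 2 * N" for m
    proof -
      \<comment> \<open>Splits m into two exponents, each at most N, so that A and B can be
        estimated separately.\<close>
      define i where "i = min m N"
      have i: "i \<le> N" "m - i \<le> N" "i + (m - i) = m" using m by (auto simp: i_def)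
      have "1 * 1 < (A * q ^ i) * (B * q ^ (m - i))"
        by (rule mult_strict_mono) (use large[OF h(1) i(1)] large[OF h(2) i(2)] in auto)
      moreover have "q ^ m = q ^ i * q ^ (m - i)"
        using i(3) by (metis power_add)
      ultimately show ?thesis by (simp add: mult_ac)
    qed
    then have "qr_regular q N A B" unfolding qr_regular_def by (metis less_irrefl)
    moreover have "A * q ^ m \<noteq> 1" "B * q ^ m \<noteq> 1" if "m \<le> N" for m
      using large[OF h(1) that] large[OF h(2) that] by auto
    ultimately show ?thesis using pos by auto
  qed
  then show "0 < A" "0 < B" "qr_regular q N A B"
    "\<And>m. 1 \<le> m \<Longrightarrow> m \<le> N \<Longrightarrow> A * q ^ m \<noteq> 1"
    "\<And>m. 1 \<le> m \<Longrightarrow> m \<le> N \<Longrightarrow> B * q ^ m \<noteq> 1"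
    by blast+
qed

lemma tendsto_powr_affine_at_top:
  fixes q b c :: real
  assumes "0 < q" "q < 1" "0 < b"
  shows "((\<lambda>a. q powr (b * a + c)) \<longlongrightarrow> 0) at_top"
proof -
  have "filterlim (\<lambda>a. b * a) at_top at_top"
    by (rule filterlim_tendsto_pos_mult_at_top[OF tendsto_const assms(3) filterlim_ident])
  then have "filterlim (\<lambda>a. c + b * a) at_top at_top"
    by (rule filterlim_tendsto_add_at_top[OF tendsto_const])
  then have "filterlim (\<lambda>a. ln q * (c + b * a)) at_bot at_top"
    by (rule filterlim_tendsto_neg_mult_at_bot[OF tendsto_const, rotated]) (use assms in simp)
  then have "((\<lambda>a. exp (ln q * (c + b * a))) \<longlongrightarrow> 0) at_top"
    by (rule filterlim_compose[OF exp_at_bot])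
  then show ?thesis
    using assms by (simp add: powr_def mult.commute add.commute)
qed

theorem mainTheorem6:
  fixes q \<alpha>t \<beta>t \<alpha> \<beta> :: real and N :: nat
    and b :: "real \<Rightarrow> real" and C :: "real \<Rightarrow> nat \<Rightarrow> real"
    and u :: "real \<Rightarrow> nat \<Rightarrow> real \<Rightarrow> real" and \<rho> :: "real \<Rightarrow> real \<Rightarrow> real"
    and d2 B G :: "real \<Rightarrow> nat \<Rightarrow> real"
    and h :: "nat \<Rightarrow> nat \<Rightarrow> real" and w :: "nat \<Rightarrow> real"
  assumes q: "0 < q" "q < 1"
    and N: "1 \<le> N"
    and params: "(0 < \<alpha>t * q \<and> \<alpha>t * q < 1 \<and> 0 < \<beta>t * q \<and> \<beta>t * q < 1)
                 \<or> (\<alpha>t > q powr (- real N) \<and> \<beta>t > q powr (- real N))"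
    and \<alpha>: "q powr \<alpha> = \<beta>t"
    and \<beta>: "q powr \<beta> = \<alpha>t"
  defines "b \<equiv> \<lambda>a. a + real N + 1"
    and "C \<equiv> \<lambda>a n. scale_C q a n"
    and "u \<equiv> \<lambda>a n s. racah_u q a (b a) \<alpha> \<beta> n s"
    and "\<rho> \<equiv> \<lambda>a s. racah_rho q a (b a) \<alpha> \<beta> s"
    and "d2 \<equiv> \<lambda>a n. racah_d2 q a (b a) \<alpha> \<beta> n"
    and "B \<equiv> \<lambda>a n. racah_beta q a (b a) \<alpha> \<beta> n"
    and "G \<equiv> \<lambda>a n. racah_gamma q a (b a) \<alpha> \<beta> n"
    and "h \<equiv> \<lambda>n s. hahn_h q \<alpha>t \<beta>t N n (hahn_x q (real s))"
    and "w \<equiv> \<lambda>s. hahn_rho q \<alpha>t \<beta>t N s * fwd_diff (hahn_x q) (real s - 1/2)"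
  shows
    \<comment> \<open>(1) the q-Racah orthogonality relation, its termwise limit, the q-Hahn one\<close>
    "(\<forall>n\<le>N. \<forall>m\<le>N.
        (\<forall>\<^sub>F a in at_top.
           (\<Sum>s=0..N. u a n (real s + a) * u a m (real s + a) * \<rho> a (real s + a)
              * qnum q (2 * real s + 2 * a + 1)) = (if n = m then d2 a n else 0))
        \<and> (\<forall>s\<le>N. ((\<lambda>a. C a n * C a m * (u a n (real s + a) * u a m (real s + a)
              * \<rho> a (real s + a) * qnum q (2 * real s + 2 * a + 1)))
              \<longlongrightarrow> h n s * h m s * w s) at_top)
        \<and> ((\<lambda>a. C a n * C a m * (if n = m then d2 a n else 0))
              \<longlongrightarrow> (if n = m then hahn_d2 q \<alpha>t \<beta>t N n else 0)) at_top
        \<and> (\<Sum>s=0..N. h n s * h m s * w s) = (if n = m then hahn_d2 q \<alpha>t \<beta>t N n else 0))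
     \<and> (\<forall>s\<le>N. ((\<lambda>a. \<rho> a (real s + a) * qnum q (2 * real s + 2 * a + 1)) \<longlongrightarrow> w s) at_top)
     \<and> (\<forall>n\<le>N. ((\<lambda>a. (C a n)\<^sup>2 * d2 a n) \<longlongrightarrow> hahn_d2 q \<alpha>t \<beta>t N n) at_top)
    \<comment> \<open>(2) the same for the three-term recurrence relations, multiplied by \<open>C\<^sub>n q\<^bsup>a+1\<^esup> / c\<^sub>1\<close>\<close>
     \<and> (\<forall>n<N. \<forall>s\<le>N.
        (\<forall>\<^sub>F a in at_top.
           racah_mu q (real s + a) * u a n (real s + a)
           = u a (n + 1) (real s + a) + B a n * u a n (real s + a)
             + G a n * pred_poly (\<lambda>k. u a k (real s + a)) n)
        \<and> ((\<lambda>a. q powr (a + 1) / racah_c1 q * C a n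
              * (racah_mu q (real s + a) * u a n (real s + a)))
              \<longlongrightarrow> hahn_x q (real s) * h n s) at_top
        \<and> ((\<lambda>a. q powr (a + 1) / racah_c1 q * C a n * u a (n + 1) (real s + a))
              \<longlongrightarrow> h (n + 1) s) at_top
        \<and> ((\<lambda>a. q powr (a + 1) / racah_c1 q * C a n * (B a n * u a n (real s + a)))
              \<longlongrightarrow> hahn_beta q \<alpha>t \<beta>t N n * h n s) at_top
        \<and> ((\<lambda>a. q powr (a + 1) / racah_c1 q * C a n
              * (G a n * pred_poly (\<lambda>k. u a k (real s + a)) n))
              \<longlongrightarrow> hahn_gamma q \<alpha>t \<beta>t N n * pred_poly (\<lambda>k. h k s) n) at_top
        \<and> hahn_x q (real s) * h n s
           = h (n + 1) s + hahn_beta q \<alpha>t \<beta>t N n * h n s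
             + hahn_gamma q \<alpha>t \<beta>t N n * pred_poly (\<lambda>k. h k s) n)
     \<and> (\<forall>n<N. ((\<lambda>a. q powr (a + 1) / racah_c1 q * B a n) \<longlongrightarrow> hahn_beta q \<alpha>t \<beta>t N n) at_top)
     \<and> (\<forall>n<N. 1 \<le> n \<longrightarrow>
          ((\<lambda>a. q powr (a + 1) / racah_c1 q * (C a n / C a (n - 1)) * G a n)
             \<longlongrightarrow> hahn_gamma q \<alpha>t \<beta>t N n) at_top)"
proof -
  note P = params_cases[OF q N params]
  define z where "z a = q powr (2 * a + 1)" for a
  let ?E = "\<lambda>a. q powr (a + 1) / racah_c1 q"
  have Aeq: "\<alpha>t = q powr \<beta>" "\<beta>t = q powr \<alpha>" using \<alpha> \<beta> by simp_all
  have z0: "(z \<longlongrightarrow> 0) at_top"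
    unfolding z_def by (rule tendsto_powr_affine_at_top[OF q]) simp
  have a0: "((\<lambda>a. q powr a) \<longlongrightarrow> 0) at_top"
    using tendsto_powr_affine_at_top[OF q, of 1 0] by simp
  have racah: "racah_params q a (z a) \<alpha>t \<beta>t \<alpha> \<beta> N" for a
    by unfold_locales (use q N Aeq z_def in auto)
  \<comment> \<open>The polynomials and the weight are identified only where this holds; the closed
    forms of norms and recurrence coefficients are taken from \<open>racah\<close> at every
    a.\<close>
  have good: "\<forall>\<^sub>F a in at_top. regular_racah_params q a (z a) \<alpha>t \<beta>t \<alpha> \<beta> N"
  proof -
    have "((\<lambda>a. z a * \<beta>t) \<longlongrightarrow> 0 * \<beta>t) at_top"
      by (intro tendsto_intros z0)
    then have "\<forall>\<^sub>F a in at_top. z a * \<beta>t < 1"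
      by (rule order_tendstoD) simp
    moreover have "\<forall>\<^sub>F a in at_top. z a < 1"
      using z0 by (rule order_tendstoD) simp
    ultimately show ?thesis
    proof eventually_elim
      case (elim a)
      then show ?case
        using racah[of a] P by (intro regular_racah_params.intro regular_racah_params_axioms.intro) auto
    qed
  qed
  have hahn: "hahn_params q \<beta>t N"
    by unfold_locales (use q N P in auto)
  note lim = tendsto_const[of \<alpha>t at_top] tendsto_const[of \<beta>t at_top] z0 P(3) N
  define p where "p a n s = qr_poly q N \<alpha>t \<beta>t (z a) n (qr_X q (z a) s)" for a n s
  have h_eq: "h n s = qr_poly q N \<alpha>t \<beta>t 0 n (qr_X q 0 s)" if "n \<le> N" for n s
    unfolding h_def
  proof (rule hahn_h_eq_qr_poly[OF q that])
    have "qpoch (\<alpha>t * q ^ 1) q n \<noteq> 0"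
      by (intro qpoch_power_nonzero P) (use that in auto)
    then show "qpoch (\<alpha>t * q) q n \<noteq> 0" by simp
    show "qpoch (\<alpha>t * \<beta>t * q ^ (n + 1)) q n \<noteq> 0"
    proof (cases "n = 0")
      case False
      then show ?thesis by (intro qr_regular_qpoch[OF P(3)]) (use that in auto)
    qed simp
  qed
  have p_lim: "((\<lambda>a. p a n s) \<longlongrightarrow> h n s) at_top" if "n \<le> N" for n s
    unfolding p_def h_eq[OF that] by (intro tendsto_qr_poly[OF lim] that tendsto_qr_X z0)
  have w_eq: "w s = qr_weight q N \<alpha>t \<beta>t 0 s" if "s \<le> N" for s
    unfolding w_def by (rule hahn_params.hahn_rho_eq[OF hahn that P(1) P(5)])
  have W_lim: "((\<lambda>a. qr_weight q N \<alpha>t \<beta>t (z a) s) \<longlongrightarrow> w s) at_top" if "s \<le> N" for s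
    unfolding w_eq[OF that] by (intro tendsto_qr_weight[OF lim] q) auto
  have X_lim: "((\<lambda>a. qr_X q (z a) s) \<longlongrightarrow> hahn_x q (real s)) at_top" for s
  proof -
    have "hahn_x q (real s) = qr_X q 0 s"
      using q by (simp add: hahn_x_def qr_X_def powr_minus powr_realpow inverse_eq_divide)
    then show ?thesis by (simp only:) (intro tendsto_qr_X z0)
  qed
  have norm_lim: "((\<lambda>a. qr_norm q N \<alpha>t \<beta>t (z a) n) \<longlongrightarrow> hahn_d2 q \<alpha>t \<beta>t N n) at_top" if "n \<le> N" for n
    unfolding hahn_params.hahn_d2_eq[OF hahn P(3) that] by (rule tendsto_qr_norm[OF lim that])
  have c_lim: "((\<lambda>a. (1 + q) * q powr a) \<longlongrightarrow> 0) at_top"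
    using tendsto_mult_right_zero[OF a0] .
  have beta_lim: "((\<lambda>a. qr_beta q N \<alpha>t \<beta>t (z a) n - (1 + q) * q powr a) \<longlongrightarrow> hahn_beta q \<alpha>t \<beta>t N n) at_top"
    if "n < N" for n
    using tendsto_diff[OF tendsto_qr_beta[OF lim that] c_lim]
    unfolding hahn_params.hahn_beta_eq[OF hahn P(3) that] by simp
  have gamma_lim: "((\<lambda>a. qr_gamma q N \<alpha>t \<beta>t (z a) n) \<longlongrightarrow> hahn_gamma q \<alpha>t \<beta>t N n) at_top"
    if "n < N" "1 \<le> n" for n
    unfolding hahn_params.hahn_gamma_eq[OF hahn P(3) that] by (rule tendsto_qr_gamma[OF lim that(1)])
  note tr = Lim_transform_eventually

  have orth: "\<forall>\<^sub>F a in at_top.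
        (\<Sum>s=0..N. u a n (real s + a) * u a m (real s + a) * \<rho> a (real s + a)
           * qnum q (2 * real s + 2 * a + 1)) = (if n = m then d2 a n else 0)"
    if "n \<le> N" "m \<le> N" for n m
    using good unfolding u_def \<rho>_def d2_def b_def
    by eventually_elim (rule regular_racah_params.racah_orthogonality[OF _ that])
  have term_lim: "((\<lambda>a. C a n * C a m * (u a n (real s + a) * u a m (real s + a)
              * \<rho> a (real s + a) * qnum q (2 * real s + 2 * a + 1)))
              \<longlongrightarrow> h n s * h m s * w s) at_top"
    if "n \<le> N" "m \<le> N" "s \<le> N" for n m s
  proof (rule tr)
    show "((\<lambda>a. p a n s * p a m s * qr_weight q N \<alpha>t \<beta>t (z a) s) \<longlongrightarrow> h n s * h m s * w s) at_top"
      by (intro tendsto_intros p_lim W_lim that)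
    show "\<forall>\<^sub>F a in at_top. p a n s * p a m s * qr_weight q N \<alpha>t \<beta>t (z a) s
      = C a n * C a m * (u a n (real s + a) * u a m (real s + a)
              * \<rho> a (real s + a) * qnum q (2 * real s + 2 * a + 1))"
      using good unfolding u_def \<rho>_def C_def b_def p_def
      by eventually_elim (rule regular_racah_params.C_C_mult_term[OF _ that, symmetric])
  qed
  have d2_lim: "((\<lambda>a. (C a n)\<^sup>2 * d2 a n) \<longlongrightarrow> hahn_d2 q \<alpha>t \<beta>t N n) at_top" if "n \<le> N" for n
    unfolding C_def d2_def b_def racah_params.scale_C_squared_d2[OF racah P(3) that]
    by (rule norm_lim[OF that])
  have norm_lim': "((\<lambda>a. C a n * C a m * (if n = m then d2 a n else 0))
              \<longlongrightarrow> (if n = m then hahn_d2 q \<alpha>t \<beta>t N n else 0)) at_top" if "n \<le> N" for n m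
    using d2_lim[OF that] by (cases "n = m") (simp_all add: power2_eq_square)
  have hahn_orth: "(\<Sum>s=0..N. h n s * h m s * w s) = (if n = m then hahn_d2 q \<alpha>t \<beta>t N n else 0)"
    if nm: "n \<le> N" "m \<le> N" for n m
  proof -
    have "(\<Sum>s=0..N. h n s * h m s * w s)
        = (\<Sum>s\<le>N. qr_poly q N \<alpha>t \<beta>t 0 n (qr_X q 0 s) * qr_poly q N \<alpha>t \<beta>t 0 m (qr_X q 0 s)
            * qr_weight q N \<alpha>t \<beta>t 0 s)"
      unfolding atMost_atLeast0 by (intro sum.cong) (simp_all add: h_eq nm w_eq)
    also have "\<dots> = (if n = m then qr_norm q N \<alpha>t \<beta>t 0 n else 0)"
      \<comment> \<open>No limit is taken here: q-Hahn orthogonality is the instance z = 0 of the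
        common relation.\<close>
      by (rule qr_orthogonality[OF q N _ _ P(3) _ P(4) P(2) _ nm]) (use P in auto)
    finally show ?thesis
      unfolding hahn_params.hahn_d2_eq[OF hahn P(3) nm(1)] .
  qed
  have rho_lim: "((\<lambda>a. \<rho> a (real s + a) * qnum q (2 * real s + 2 * a + 1)) \<longlongrightarrow> w s) at_top"
    if "s \<le> N" for s
  proof (rule tr[OF W_lim[OF that]])
    show "\<forall>\<^sub>F a in at_top. qr_weight q N \<alpha>t \<beta>t (z a) s = \<rho> a (real s + a) * qnum q (2 * real s + 2 * a + 1)"
      using good unfolding \<rho>_def b_def
      by eventually_elim (rule regular_racah_params.rho_eq[OF _ that, symmetric])
  qed
  have rec: "\<forall>\<^sub>F a in at_top.
           racah_mu q (real s + a) * u a n (real s + a)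
           = u a (n + 1) (real s + a) + B a n * u a n (real s + a)
             + G a n * pred_poly (\<lambda>k. u a k (real s + a)) n"
    if "n < N" "s \<le> N" for n s
    using good unfolding u_def B_def G_def b_def
    by eventually_elim (rule regular_racah_params.racah_recurrence[OF _ that])
  have mu_lim: "((\<lambda>a. ?E a * C a n * (racah_mu q (real s + a) * u a n (real s + a)))
              \<longlongrightarrow> hahn_x q (real s) * h n s) at_top"
    if "n < N" "s \<le> N" for n s
  proof (rule tr)
    have "((\<lambda>a. (qr_X q (z a) s - (1 + q) * q powr a) * p a n s) \<longlongrightarrow> (hahn_x q (real s) - 0) * h n s) at_top"
      by (intro tendsto_intros X_lim c_lim p_lim) (use that in auto)
    then show "((\<lambda>a. (qr_X q (z a) s - (1 + q) * q powr a) * p a n s) \<longlongrightarrow> hahn_x q (real s) * h n s) at_top"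
      by simp
    show "\<forall>\<^sub>F a in at_top. (qr_X q (z a) s - (1 + q) * q powr a) * p a n s
        = ?E a * C a n * (racah_mu q (real s + a) * u a n (real s + a))"
      using good unfolding u_def C_def b_def p_def
      by eventually_elim (rule regular_racah_params.E_C_mult_mu[OF _ that, symmetric])
  qed
  have Suc_lim: "((\<lambda>a. ?E a * C a n * u a (n + 1) (real s + a)) \<longlongrightarrow> h (n + 1) s) at_top"
    if "n < N" "s \<le> N" for n s
  proof (rule tr[OF p_lim])
    show "n + 1 \<le> N" using that by simp
    show "\<forall>\<^sub>F a in at_top. p a (n + 1) s = ?E a * C a n * u a (n + 1) (real s + a)"
      using good unfolding u_def C_def b_def p_def
      by eventually_elim (rule regular_racah_params.E_C_mult_Suc[OF _ that, symmetric])
  qed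
  have B_lim: "((\<lambda>a. ?E a * C a n * (B a n * u a n (real s + a)))
              \<longlongrightarrow> hahn_beta q \<alpha>t \<beta>t N n * h n s) at_top"
    if "n < N" "s \<le> N" for n s
  proof (rule tr)
    show "((\<lambda>a. (qr_beta q N \<alpha>t \<beta>t (z a) n - (1 + q) * q powr a) * p a n s)
        \<longlongrightarrow> hahn_beta q \<alpha>t \<beta>t N n * h n s) at_top"
      by (intro tendsto_mult beta_lim p_lim) (use that in auto)
    show "\<forall>\<^sub>F a in at_top. (qr_beta q N \<alpha>t \<beta>t (z a) n - (1 + q) * q powr a) * p a n s
        = ?E a * C a n * (B a n * u a n (real s + a))"
      using good unfolding u_def B_def C_def b_def p_def
      by eventually_elim (rule regular_racah_params.E_C_mult_beta[OF _ that, symmetric])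
  qed
  have G_lim: "((\<lambda>a. ?E a * C a n * (G a n * pred_poly (\<lambda>k. u a k (real s + a)) n))
              \<longlongrightarrow> hahn_gamma q \<alpha>t \<beta>t N n * pred_poly (\<lambda>k. h k s) n) at_top"
    if "n < N" "s \<le> N" for n s
  proof (rule tr)
    show "((\<lambda>a. qr_gamma q N \<alpha>t \<beta>t (z a) n * pred_poly (\<lambda>k. p a k s) n)
        \<longlongrightarrow> hahn_gamma q \<alpha>t \<beta>t N n * pred_poly (\<lambda>k. h k s) n) at_top"
    proof (cases n)
      case 0
      then show ?thesis by (simp add: pred_poly_def)
    next
      case (Suc k)
      have "((\<lambda>a. p a k s) \<longlongrightarrow> h k s) at_top"
        by (rule p_lim) (use that Suc in simp)
      then show ?thesis
        using tendsto_mult[OF gamma_lim[OF that(1)]] by (simp add: pred_poly_def Suc)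
    qed
    show "\<forall>\<^sub>F a in at_top. qr_gamma q N \<alpha>t \<beta>t (z a) n * pred_poly (\<lambda>k. p a k s) n
        = ?E a * C a n * (G a n * pred_poly (\<lambda>k. u a k (real s + a)) n)"
      using good unfolding u_def G_def C_def b_def p_def
      by eventually_elim (rule regular_racah_params.E_C_mult_gamma[OF _ that, symmetric])
  qed
  have hahn_rec: "hahn_x q (real s) * h n s
           = h (n + 1) s + hahn_beta q \<alpha>t \<beta>t N n * h n s
             + hahn_gamma q \<alpha>t \<beta>t N n * pred_poly (\<lambda>k. h k s) n"
    if "n < N" "s \<le> N" for n s
  proof -
    \<comment> \<open>The rescaled left side of the q-Racah relation has a limit through mu and a
      limit through the right side; their equality is the q-Hahn relation.\<close>
    have "((\<lambda>a. ?E a * C a n * (racah_mu q (real s + a) * u a n (real s + a)))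
      \<longlongrightarrow> h (n + 1) s + hahn_beta q \<alpha>t \<beta>t N n * h n s
             + hahn_gamma q \<alpha>t \<beta>t N n * pred_poly (\<lambda>k. h k s) n) at_top"
    proof (rule tr[OF tendsto_add[OF tendsto_add[OF Suc_lim[OF that] B_lim[OF that]] G_lim[OF that]]])
      show "\<forall>\<^sub>F a in at_top. ?E a * C a n * u a (n + 1) (real s + a)
          + ?E a * C a n * (B a n * u a n (real s + a))
          + ?E a * C a n * (G a n * pred_poly (\<lambda>k. u a k (real s + a)) n)
        = ?E a * C a n * (racah_mu q (real s + a) * u a n (real s + a))"
        using rec[OF that] by eventually_elim (simp only: distrib_left)
    qed
    then show ?thesis
      using tendsto_unique[OF _ mu_lim[OF that]] by simp
  qed
  have beta_lim': "((\<lambda>a. ?E a * B a n) \<longlongrightarrow> hahn_beta q \<alpha>t \<beta>t N n) at_top" if "n < N" for n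
    unfolding B_def b_def racah_params.E_mult_racah_beta[OF racah P(3) that]
    by (rule beta_lim[OF that])
  have gamma_lim': "((\<lambda>a. ?E a * (C a n / C a (n - 1)) * G a n) \<longlongrightarrow> hahn_gamma q \<alpha>t \<beta>t N n) at_top"
    if n: "n < N" "1 \<le> n" for n
  proof (rule tr[OF gamma_lim[OF n]], rule always_eventually, rule allI)
    fix a
    have C0: "scale_C q a (n - 1) \<noteq> 0"
      using kappa_nonzero[OF q] q by (simp add: scale_C_def)
    have "scale_C q a n = ?E a * scale_C q a (n - 1)"
      using racah_params.scale_C_Suc[OF racah, of a "n - 1"] n by simp
    then have "?E a * (C a n / C a (n - 1)) * G a n = (?E a)\<^sup>2 * G a n"
      unfolding C_def using C0 by (simp add: power2_eq_square)
    also have "\<dots> = qr_gamma q N \<alpha>t \<beta>t (z a) n"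
      unfolding G_def b_def by (rule racah_params.E_mult_racah_gamma[OF racah P(3) n])
    finally show "qr_gamma q N \<alpha>t \<beta>t (z a) n = ?E a * (C a n / C a (n - 1)) * G a n" by simp
  qed
  show ?thesis
    using orth term_lim norm_lim' hahn_orth rho_lim d2_lim rec mu_lim Suc_lim B_lim G_lim hahn_rec
      beta_lim' gamma_lim' by (intro conjI allI impI)
qed

end
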